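(* Let $\theta\in(-\frac{\pi}{2},\frac{\pi}{2})$, let $Q_\theta=-e^{-i\theta}\frac{d^2}{dx^2}+e^{i\theta}x^2$ acting on $L^2(\mathbb{R})$, and let $t\in\Omega_\theta$, where $$\Omega_\theta=\{\operatorname{Re} t>0\}\cap\left\{t\in\mathbb{C}:|\arg\tanh t|\le\frac{\pi}{2}-|\theta|\right\}.$$ Write $\phi=\arg\tanh t\in(-\pi,\pi)$ and $$A=\frac12|\sinh 2t|^2(\cos2\theta+\cos2\phi).$$ Then, as an operator in $\mathcal{L}(L^2(\mathbb{R}))$, $$\|e^{-tQ_\theta}\|=\left(\sqrt{1+A}+\sqrt{A}\right)^{-1/2}.$$
   Context: Let $h_k$, $k\in\mathbb{N}=\{0,1,2,\dots\}$, be the Hermite functions, i.e. the eigenfunctions of $-\frac{d^2}{dx^2}+x^2$ with eigenvalue $2k+1$, extended to entire functions. The functions $u_k(x)=h_k(e^{i\theta/2}x)$ belong to $L^2(\mathbb{R})$, satisfy $Q_\theta u_k=(1+2k)u_k$, and have dense span in $L^2(\mathbb{R})$. For $t\in\mathbb{C}$, the operator $e^{-tQ_\theta}$ is the closure in $L^2(\mathbb{R})$ (graph closure) of the operator with domain $\operatorname{Span}\{u_k\}_{k\ge0}$ defined by linear extension of $u_k\mapsto e^{-t(1+2k)}u_k$. $\mathcal{L}(L^2(\mathbb{R}))$ denotes the bounded operators on $L^2(\mathbb{R})$ with the operator norm. *)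

theory Defs
  imports "HOL-Complex_Analysis.Complex_Analysis" "HOL-Probability.Probability"
begin

section \<open>The Hilbert space of square-integrable functions on the real line\<close>

definition sq_integrable :: "(real \<Rightarrow> complex) \<Rightarrow> bool" where
  "sq_integrable f \<longleftrightarrow> f \<in> borel_measurable lborel \<and> integrable lborel (\<lambda>x. (cmod (f x))\<^sup>2)"

definition ae_equal :: "(real \<Rightarrow> complex) \<Rightarrow> (real \<Rightarrow> complex) \<Rightarrow> bool" where
  "ae_equal f g \<longleftrightarrow> sq_integrable f \<and> sq_integrable g \<and> (AE x in lborel. f x = g x)"

lemma sq_integrable_0 [simp]: "sq_integrable (\<lambda>x. 0)"
  by (simp add: sq_integrable_def)

lemma sq_integrable_cmult:
  assumes "sq_integrable f"
  shows "sq_integrable (\<lambda>x. c * f x)"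
  using assms by (auto simp: sq_integrable_def norm_mult power_mult_distrib)

lemma sq_integrable_scaleR:
  assumes "sq_integrable f"
  shows "sq_integrable (\<lambda>x. r *\<^sub>R f x)"
  using sq_integrable_cmult[OF assms, of "of_real r"] by (simp add: scaleR_conv_of_real)

lemma sq_integrable_uminus:
  assumes "sq_integrable f"
  shows "sq_integrable (\<lambda>x. - f x)"
  using assms by (auto simp: sq_integrable_def)

lemma sq_integrable_add:
  assumes "sq_integrable f" "sq_integrable g"
  shows "sq_integrable (\<lambda>x. f x + g x)"
proof -
  have [measurable]: "f \<in> borel_measurable lborel" "g \<in> borel_measurable lborel"
    using assms by (auto simp: sq_integrable_def)
  have "integrable lborel (\<lambda>x. (cmod (f x + g x))\<^sup>2)"
  proof (rule Bochner_Integration.integrable_bound)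
    show "integrable lborel (\<lambda>x. 2 * (cmod (f x))\<^sup>2 + 2 * (cmod (g x))\<^sup>2)"
      using assms by (auto simp: sq_integrable_def)
    have "(cmod (a + b))\<^sup>2 \<le> 2 * (cmod a)\<^sup>2 + 2 * (cmod b)\<^sup>2" for a b
    proof -
      have "(cmod (a + b))\<^sup>2 \<le> (cmod a + cmod b)\<^sup>2"
        by (intro power_mono norm_triangle_ineq) auto
      also have "\<dots> \<le> 2 * (cmod a)\<^sup>2 + 2 * (cmod b)\<^sup>2"
        using zero_le_power2[of "cmod a - cmod b"] by (simp add: power2_eq_square algebra_simps)
      finally show ?thesis .
    qed
    then show "AE x in lborel. norm ((cmod (f x + g x))\<^sup>2)
        \<le> norm (2 * (cmod (f x))\<^sup>2 + 2 * (cmod (g x))\<^sup>2)"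
      by auto
  qed auto
  then show ?thesis by (simp add: sq_integrable_def)
qed

lemma sq_integrable_diff:
  assumes "sq_integrable f" "sq_integrable g"
  shows "sq_integrable (\<lambda>x. f x - g x)"
  using sq_integrable_add[OF assms(1) sq_integrable_uminus[OF assms(2)]] by simp

lemma sq_integrable_sum:
  assumes "\<And>i. i \<in> I \<Longrightarrow> sq_integrable (f i)"
  shows "sq_integrable (\<lambda>x. \<Sum>i\<in>I. f i x)"
  using assms by (induction I rule: infinite_finite_induct) (auto intro: sq_integrable_add)

lemma integrable_inner:
  assumes "sq_integrable f" "sq_integrable g"
  shows "integrable lborel (\<lambda>x. f x \<bullet> g x)"
proof -
  have "f x \<bullet> g x = ((cmod (f x + g x))\<^sup>2 - (cmod (f x))\<^sup>2 - (cmod (g x))\<^sup>2) / 2" for x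
    by (simp add: dot_norm)
  then show ?thesis
    using assms sq_integrable_add[OF assms] unfolding sq_integrable_def
    by (auto simp only: intro!: Bochner_Integration.integrable_diff integrable_divide_zero)
qed

quotient_type L2 = "real \<Rightarrow> complex" / partial: ae_equal
proof (rule part_equivpI)
  show "\<exists>f. ae_equal f f" by (rule exI[of _ "\<lambda>x. 0"]) (simp add: ae_equal_def)
  show "symp ae_equal" by (auto simp: symp_def ae_equal_def elim: AE_mp)
  show "transp ae_equal"
    unfolding transp_def ae_equal_def by (auto elim: AE_mp)
qed

instantiation L2 :: real_vector
begin

lift_definition zero_L2 :: L2 is "\<lambda>x. 0" by (simp add: ae_equal_def)
lift_definition plus_L2 :: "L2 \<Rightarrow> L2 \<Rightarrow> L2" is "\<lambda>f g x. f x + g x"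
  by (auto simp: ae_equal_def intro: sq_integrable_add)
lift_definition minus_L2 :: "L2 \<Rightarrow> L2 \<Rightarrow> L2" is "\<lambda>f g x. f x - g x"
  by (auto simp: ae_equal_def intro: sq_integrable_diff)
lift_definition uminus_L2 :: "L2 \<Rightarrow> L2" is "\<lambda>f x. - f x"
  by (auto simp: ae_equal_def intro: sq_integrable_uminus)
lift_definition scaleR_L2 :: "real \<Rightarrow> L2 \<Rightarrow> L2" is "\<lambda>r f x. r *\<^sub>R f x"
  by (auto simp: ae_equal_def intro: sq_integrable_scaleR)

instance
  by standard
    (transfer; auto simp: ae_equal_def algebra_simps
       intro!: sq_integrable_add sq_integrable_diff sq_integrable_uminus sq_integrable_scaleR)+

end

instantiation L2 :: real_inner
begin

lift_definition inner_L2 :: "L2 \<Rightarrow> L2 \<Rightarrow> real" is "\<lambda>f g. LINT x|lborel. f x \<bullet> g x"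
  by (auto simp: ae_equal_def sq_integrable_def intro!: integral_cong_AE)

lift_definition norm_L2 :: "L2 \<Rightarrow> real" is "\<lambda>f. sqrt (LINT x|lborel. (cmod (f x))\<^sup>2)"
  by (auto simp: ae_equal_def sq_integrable_def intro!: integral_cong_AE)

definition dist_L2 :: "L2 \<Rightarrow> L2 \<Rightarrow> real" where "dist_L2 f g = norm (f - g)"
definition sgn_L2 :: "L2 \<Rightarrow> L2" where "sgn_L2 f = inverse (norm f) *\<^sub>R f"
definition uniformity_L2 :: "(L2 \<times> L2) filter" where
  "uniformity_L2 = (INF e\<in>{0<..}. principal {(f, g). dist f g < e})"
definition open_L2 :: "L2 set \<Rightarrow> bool" where
  "open_L2 U \<longleftrightarrow> (\<forall>f\<in>U. eventually (\<lambda>(f', g). f' = f \<longrightarrow> g \<in> U) uniformity)"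

instance
proof
  fix f g k :: L2 and r :: real and U :: "L2 set"
  show "dist f g = norm (f - g)" by (rule dist_L2_def)
  show "sgn f = f /\<^sub>R norm f" by (rule sgn_L2_def)
  show "uniformity = (INF e\<in>{0<..}. principal {(f, g :: L2). dist f g < e})"
    by (rule uniformity_L2_def)
  show "open U \<longleftrightarrow> (\<forall>f\<in>U. \<forall>\<^sub>F (f', g) in uniformity. f' = f \<longrightarrow> g \<in> U)"
    by (rule open_L2_def)
  show "f \<bullet> g = g \<bullet> f"
    by transfer (simp add: inner_commute)
  show "(f + g) \<bullet> k = f \<bullet> k + g \<bullet> k"
    by transfer (simp add: ae_equal_def inner_add_left integrable_inner)
  show "r *\<^sub>R f \<bullet> g = r * (f \<bullet> g)"
    by transfer simp
  show "0 \<le> f \<bullet> f"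
    by transfer simp
  show "f \<bullet> f = 0 \<longleftrightarrow> f = 0"
  proof transfer
    fix f assume "ae_equal f f"
    then have f: "sq_integrable f" by (simp add: ae_equal_def)
    have "(LINT x|lborel. f x \<bullet> f x) = 0 \<longleftrightarrow> (AE x in lborel. f x \<bullet> f x = 0)"
      by (rule integral_nonneg_eq_0_iff_AE) (auto intro: integrable_inner f)
    also have "\<dots> \<longleftrightarrow> ae_equal f (\<lambda>x. 0)"
      using f by (simp add: ae_equal_def)
    finally show "((LINT x|lborel. f x \<bullet> f x) = 0) = ae_equal f (\<lambda>x. 0)" .
  qed
  show "norm f = sqrt (f \<bullet> f)"
    by transfer (simp add: power2_norm_eq_inner)
qed

end

lift_definition scaleC_L2 :: "complex \<Rightarrow> L2 \<Rightarrow> L2"  (infixr "\<cdot>\<^sub>C" 75)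
  is "\<lambda>c f x. c * f x"
  by (auto simp: ae_equal_def intro: sq_integrable_cmult)

text \<open>
  The real-normed-space notions \<^const>\<open>bounded_linear\<close>, \<^const>\<open>onorm\<close> and
  \<^const>\<open>closure\<close> do not depend on the scalar field, so a bounded operator on the complex
  Hilbert space is a \<^const>\<open>bounded_linear\<close> map that also commutes with complex scalars, and its
  operator norm is \<^const>\<open>onorm\<close>.
\<close>

definition bounded_operator :: "(L2 \<Rightarrow> L2) \<Rightarrow> bool" where
  "bounded_operator T \<longleftrightarrow> bounded_linear T \<and> (\<forall>c f. T (c \<cdot>\<^sub>C f) = c \<cdot>\<^sub>C T f)"

section \<open>The rotated harmonic oscillator and its semigroup\<close>

definition Q :: "real \<Rightarrow> (real \<Rightarrow> complex) \<Rightarrow> real \<Rightarrow> complex" where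
  "Q \<theta> f x =
     - exp (- \<i> * of_real \<theta>) * vector_derivative (\<lambda>y. vector_derivative f (at y)) (at x)
     + exp (\<i> * of_real \<theta>) * (of_real x)\<^sup>2 * f x"

text \<open>
  An entire function whose restriction to the real line is an eigenfunction of
  $-d^2/dx^2 + x^2$, that is of \<^term>\<open>Q 0\<close>, on the space of square-integrable functions.
  No normalization is imposed.
\<close>

definition hermite_function :: "nat \<Rightarrow> (complex \<Rightarrow> complex) \<Rightarrow> bool" where
  "hermite_function k h \<longleftrightarrow>
     h holomorphic_on UNIV \<and>
     sq_integrable (\<lambda>x. h (of_real x)) \<and>
     (\<exists>x::real. h (of_real x) \<noteq> 0) \<and>
     (\<forall>x. Q 0 (\<lambda>y. h (of_real y)) x = of_real (1 + 2 * real k) * h (of_real x))"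

definition rotated :: "real \<Rightarrow> (complex \<Rightarrow> complex) \<Rightarrow> real \<Rightarrow> complex" where
  "rotated \<theta> h x = h (exp (\<i> * of_real \<theta> / 2) * of_real x)"

text \<open>
  Operators are represented by their graphs in the product space. The operator
  $e^{-t Q_\<theta>}$ is the closure of the one that multiplies each eigenfunction
  of \<^term>\<open>Q \<theta>\<close> (see \<open>Q_rotated\<close> below) with eigenvalue $1 + 2k$ by
  $e^{-t(1 + 2k)}$. The rotated Hermite functions are square-integrable for
  $|\<theta>| < \<pi>/2$ (\<open>sq_integrable_rotated\<close>), so \<open>abs_L2\<close> below takes their class.
\<close>

definition exp_Q_span :: "(nat \<Rightarrow> complex \<Rightarrow> complex) \<Rightarrow> real \<Rightarrow> complex \<Rightarrow> (L2 \<times> L2) set" where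
  "exp_Q_span h \<theta> t =
     {(\<Sum>k<n. c k \<cdot>\<^sub>C abs_L2 (rotated \<theta> (h k)),
       \<Sum>k<n. c k \<cdot>\<^sub>C exp (- t * (1 + 2 * of_nat k)) \<cdot>\<^sub>C abs_L2 (rotated \<theta> (h k))) | n c. True}"

definition exp_Q :: "(nat \<Rightarrow> complex \<Rightarrow> complex) \<Rightarrow> real \<Rightarrow> complex \<Rightarrow> (L2 \<times> L2) set" where
  "exp_Q h \<theta> t = closure (exp_Q_span h \<theta> t)"

definition \<Omega> :: "real \<Rightarrow> complex set" where
  "\<Omega> \<theta> = {t. Re t > 0} \<inter> {t. \<bar>Arg (tanh t)\<bar> \<le> pi / 2 - \<bar>\<theta>\<bar>}"

section \<open>Existence of Hermite functions and the eigenvalue equation for the rotated functions\<close>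

lemma has_vector_derivative_line:
  assumes "h holomorphic_on UNIV"
  shows "((\<lambda>x. h (a * of_real x)) has_vector_derivative a * deriv h (a * of_real x)) (at x)"
proof -
  have "(h has_field_derivative deriv h (a * of_real x)) (at (a * of_real x))"
    using assms by (intro holomorphic_derivI[where S = UNIV]) auto
  moreover have "((\<lambda>x. a * of_real x) has_vector_derivative a) (at x)"
    by (auto intro!: derivative_eq_intros)
  ultimately show ?thesis
    using field_vector_diff_chain_at[of "\<lambda>x. a * of_real x" a x h "deriv h (a * of_real x)"]
    by (simp add: o_def)
qed

lemma Q_line:
  assumes h: "h holomorphic_on UNIV"
  shows "Q \<theta> (\<lambda>x. h (a * of_real x)) x
    = - exp (- \<i> * of_real \<theta>) * a\<^sup>2 * deriv (deriv h) (a * of_real x)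
      + exp (\<i> * of_real \<theta>) * (of_real x)\<^sup>2 * h (a * of_real x)"
proof -
  have 1: "(\<lambda>y. vector_derivative (\<lambda>x. h (a * of_real x)) (at y)) = (\<lambda>y. a * deriv h (a * of_real y))"
    by (intro ext vector_derivative_at has_vector_derivative_line h)
  have "deriv h holomorphic_on UNIV" using h by (intro holomorphic_deriv) auto
  then have "((\<lambda>y. a * deriv h (a * of_real y)) has_vector_derivative
      a * (a * deriv (deriv h) (a * of_real x))) (at x)"
    by (intro has_vector_derivative_mult_right has_vector_derivative_line)
  then show ?thesis
    unfolding Q_def 1 by (simp add: vector_derivative_at power2_eq_square)
qed

lemma hermite_function_ode:
  assumes "hermite_function k h"
  shows "- deriv (deriv h) z + z\<^sup>2 * h z = of_real (1 + 2 * real k) * h z"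
proof -
  let ?f = "\<lambda>z. - deriv (deriv h) z + z\<^sup>2 * h z - of_real (1 + 2 * real k) * h z"
  have h: "h holomorphic_on UNIV" using assms by (simp add: hermite_function_def)
  then have "deriv (deriv h) holomorphic_on UNIV" by (intro holomorphic_deriv) auto
  then have f: "?f holomorphic_on UNIV" using h by (auto intro!: holomorphic_intros)
  have "?f z = 0"
  proof (rule analytic_continuation[OF f, of "range complex_of_real" 0])
    show "0 islimpt range complex_of_real"
      unfolding islimpt_approachable
    proof (intro allI impI)
      fix e :: real assume "e > 0"
      then show "\<exists>x'\<in>range complex_of_real. x' \<noteq> 0 \<and> dist x' 0 < e"
        by (intro bexI[of _ "of_real (e / 2)"]) (auto simp del: of_real_divide)
    qed
    fix w assume "w \<in> range complex_of_real"
    then obtain x where w: "w = of_real x" by auto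
    have "Q 0 (\<lambda>y. h (of_real y)) x = of_real (1 + 2 * real k) * h (of_real x)"
      using assms by (simp add: hermite_function_def)
    then show "?f w = 0"
      using Q_line[OF h, of 0 1 x] w by simp
  qed auto
  then show ?thesis by simp
qed

lemma Q_rotated:
  assumes "hermite_function k h"
  shows "Q \<theta> (rotated \<theta> h) x = of_real (1 + 2 * real k) * rotated \<theta> h x"
proof -
  let ?a = "exp (\<i> * of_real \<theta> / 2)"
  have h: "h holomorphic_on UNIV" using assms by (simp add: hermite_function_def)
  have a2: "?a\<^sup>2 = exp (\<i> * of_real \<theta>)"
    by (simp add: power2_eq_square flip: exp_add)
  have "exp (- \<i> * of_real \<theta>) * ?a\<^sup>2 = 1"
    unfolding a2 by (simp flip: exp_add)
  then have "Q \<theta> (rotated \<theta> h) x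
      = - deriv (deriv h) (?a * of_real x) + (?a * of_real x)\<^sup>2 * h (?a * of_real x)"
    unfolding rotated_def Q_line[OF h] by (simp add: power_mult_distrib a2)
  then show ?thesis
    unfolding hermite_function_ode[OF assms] by (simp add: rotated_def)
qed

fun hermite_poly :: "nat \<Rightarrow> complex poly" where
  "hermite_poly 0 = 1"
| "hermite_poly (Suc n) = [:0, 2:] * hermite_poly n - pderiv (hermite_poly n)"

lemma pderiv_hermite_poly:
  "pderiv (hermite_poly (Suc n)) = smult (2 * (of_nat n + 1)) (hermite_poly n)"
proof (induction n)
  case 0
  show ?case by (simp add: pderiv_pCons)
next
  case (Suc n)
  let ?p = "hermite_poly (Suc n)"
  have "pderiv (hermite_poly (Suc (Suc n))) = smult 2 ?p + [:0, 2:] * pderiv ?p - pderiv (pderiv ?p)"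
    unfolding hermite_poly.simps(2)[of "Suc n"] pderiv_diff pderiv_mult
    by (simp add: pderiv_pCons)
  also have "\<dots> = smult 2 ?p + smult (2 * (of_nat n + 1)) ?p"
    unfolding Suc.IH by (simp add: pderiv_smult smult_diff_right)
  also have "\<dots> = smult (2 * (of_nat (Suc n) + 1)) ?p"
    unfolding smult_add_left[symmetric] by (simp add: algebra_simps)
  finally show ?case .
qed

lemma hermite_poly_ode:
  "pderiv (pderiv (hermite_poly n)) = [:0, 2:] * pderiv (hermite_poly n) - smult (2 * of_nat n) (hermite_poly n)"
proof (cases n)
  case 0
  then show ?thesis by simp
next
  case (Suc m)
  show ?thesis
    unfolding Suc pderiv_hermite_poly pderiv_smult
    by (simp add: smult_diff_right add.commute)
qed

lemma hermite_poly_nonzero: "hermite_poly n \<noteq> 0"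
proof (induction n)
  case (Suc n)
  have "(2 * (of_nat n + 1) :: complex) \<noteq> 0"
    by (metis mult_eq_0_iff of_nat_Suc of_nat_neq_0 zero_neq_numeral add.commute)
  then have "pderiv (hermite_poly (Suc n)) \<noteq> 0"
    unfolding pderiv_hermite_poly using Suc.IH by simp
  then show ?case by fastforce
qed simp

lemma sq_integrable_poly_gauss:
  assumes "Re a > 0"
  shows "sq_integrable (\<lambda>x. poly p (of_real x) * exp (- (a * (of_real x)\<^sup>2 / 2)))"
proof -
  have mono: "sq_integrable (\<lambda>x. of_real x ^ i * exp (- (a * (of_real x)\<^sup>2 / 2)))" for i
  proof -
    define s where "s = 1 / sqrt (2 * Re a)"
    have s: "s > 0" "2 * s\<^sup>2 = 1 / Re a" using assms
      by (auto simp: s_def power_divide)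
    have "(cmod (of_real x ^ i * exp (- (a * (of_real x)\<^sup>2 / 2))))\<^sup>2
        = sqrt (2 * pi * s\<^sup>2) * (normal_density 0 s x * (x - 0) ^ (2 * i))" for x
    proof -
      have "(cmod (of_real x ^ i * exp (- (a * (of_real x)\<^sup>2 / 2))))\<^sup>2 = x ^ (2 * i) * exp (- (Re a * x\<^sup>2))"
        by (simp add: norm_mult norm_power power_mult_distrib power_even_abs flip: power_mult exp_of_nat_mult of_real_power)
           (simp add: mult.commute power_even_abs)
      moreover have "normal_density 0 s x = 1 / sqrt (2 * pi * s\<^sup>2) * exp (- (Re a * x\<^sup>2))"
        unfolding normal_density_def s(2) by (simp add: mult.commute)
      ultimately show ?thesis using s(1) by simp
    qed
    moreover have "integrable lborel (\<lambda>x. sqrt (2 * pi * s\<^sup>2) * (normal_density 0 s x * (x - 0) ^ (2 * i)))"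
      by (intro integrable_mult_right integrable_normal_moment s)
    ultimately show ?thesis
      unfolding sq_integrable_def by (auto intro!: borel_measurable_continuous_onI continuous_intros)
  qed
  have "(\<lambda>x. poly p (of_real x) * exp (- (a * (of_real x)\<^sup>2 / 2)))
    = (\<lambda>x. \<Sum>i\<le>degree p. coeff p i * (of_real x ^ i * exp (- (a * (of_real x)\<^sup>2 / 2))))"
    by (simp add: poly_altdef sum_distrib_right mult.assoc)
  then show ?thesis
    by (simp only:) (intro sq_integrable_sum sq_integrable_cmult mono)
qed

theorem hermite_function_exists:
  "hermite_function k (\<lambda>z. poly (hermite_poly k) z * exp (- (z\<^sup>2 / 2)))"
proof -
  let ?p = "hermite_poly k" and ?e = "\<lambda>z::complex. exp (- (z\<^sup>2 / 2))"
  let ?h = "\<lambda>z. poly ?p z * ?e z"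
  have hol: "?h holomorphic_on UNIV" by (intro holomorphic_intros) auto
  have D: "((\<lambda>z. poly q z * ?e z) has_field_derivative poly (pderiv q - [:0, 1:] * q) z * ?e z) (at z)"
    for q z
    by (rule derivative_eq_intros poly_DERIV refl | simp add: algebra_simps)+
  have D1: "deriv (\<lambda>z. poly q z * ?e z) = (\<lambda>z. poly (pderiv q - [:0, 1:] * q) z * ?e z)" for q
    by (intro ext DERIV_imp_deriv D)
  have D2: "deriv (deriv ?h) z = (z\<^sup>2 - of_real (1 + 2 * real k)) * ?h z" for z
    unfolding D1 pderiv_diff pderiv_mult hermite_poly_ode
    by (simp add: pderiv_pCons algebra_simps power2_eq_square)
  have "Q 0 (\<lambda>y. ?h (of_real y)) x = of_real (1 + 2 * real k) * ?h (of_real x)" for x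
    using Q_line[OF hol, of 0 1 x] unfolding D2 by (simp add: algebra_simps)
  moreover have "sq_integrable (\<lambda>x. ?h (of_real x))"
    using sq_integrable_poly_gauss[of 1 ?p] by simp
  moreover have "\<exists>x::real. ?h (of_real x) \<noteq> 0"
  proof (rule ccontr)
    assume "\<not> ?thesis"
    then have "range complex_of_real \<subseteq> {z. poly ?p z = 0}" by auto
    then have "finite (range complex_of_real)"
      using poly_roots_finite[OF hermite_poly_nonzero] finite_subset by blast
    then show False
      by (metis finite_imageD infinite_UNIV_char_0 inj_of_real)
  qed
  ultimately show ?thesis using hol unfolding hermite_function_def by blast
qed

lemma sq_integrable_rotated:
  assumes "- pi / 2 < \<theta>" "\<theta> < pi / 2"
  shows "sq_integrable (rotated \<theta> (\<lambda>z. poly (hermite_poly k) z * exp (- (z\<^sup>2 / 2))))"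
proof -
  let ?a = "exp (\<i> * of_real \<theta> / 2)"
  have a2: "?a\<^sup>2 = exp (\<i> * of_real \<theta>)"
    by (simp add: power2_eq_square flip: exp_add)
  have "Re (exp (\<i> * of_real \<theta>)) = cos \<theta>" by (simp add: Re_exp)
  then have "Re (?a\<^sup>2) > 0" unfolding a2 using cos_gt_zero_pi[of \<theta>] assms by simp
  from sq_integrable_poly_gauss[OF this, of "pcompose (hermite_poly k) [:0, ?a:]"]
  show ?thesis
    unfolding rotated_def by (simp add: poly_pcompose power_mult_distrib mult.commute)
qed

end

theory Submission
  imports Defs
begin

text \<open>
  By Mehler's formula, $e^{-tQ_\<theta>}$ should be the integral operator $T$ with kernel
  $K(x,y) = c\,e^{-a(x^2+y^2)/2 + bxy}$, where $a = e^{i\<theta>}\coth 2t$ and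
  $b = e^{i\<theta>}/\sinh 2t$. The condition $t \in \Omega_\<theta>$ amounts to
  $|\mathrm{Re}\,b| \le \mathrm{Re}\,a$. Integrating $K(x,y)\overline{K(x,y')}$ over $x$ gives a
  Gaussian kernel for $T^*T$, which up to conjugation by a unimodular function is a multiple of
  $e^{-P(y^2+y'^2)/2 + Qyy'}$ with real $P \ge |Q|$. Schur's test with the weight
  $e^{-\omega y^2/2}$, $\omega = \sqrt{P^2-Q^2}$, bounds its norm, and Gaussian test functions show
  that the bound is sharp (it need not be attained, since $\omega = 0$ on the boundary of
  $\Omega_\<theta>$). Integration by parts shows that $T$ acts on the rotated Hermite functions
  as prescribed. As these span a dense subspace, the closure of the prescribed graph is the graph
  of the bounded operator $T$.
\<close>

section \<open>Square-integrable functions\<close>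

text \<open>The rotated Hermite functions need not be orthogonal, so their eigenvalues alone do not
  determine the norm; this is why the kernel is needed. The relation a^2 - b^2 = e^{2i\<theta>}
  makes them eigenfunctions of T, with b / (a + e^{i\<theta>}) = e^{-2t} as the ratio of consecutive
  eigenvalues. The constant c is defined as e^{-t} divided by a complex Gaussian integral: the
  lowest eigenvalue is then right by construction, whatever the phase of that integral, and only its
  modulus enters the norm. The squared norm is |c|^2 sqrt(pi / Re a) sqrt(2 pi / (P + \<omega>)).
  After scaling by 2 |sinh 2t|^2 Re a, the sum P + \<omega> becomes 1 + 2A + 2 sqrt(A(1 + A)), the
  square of sqrt(1 + A) + sqrt A, which is the origin of the formula. The functions h_k are known
  only through their equation and square integrability, so a Wronskian argument first identifies
  them, up to constant factors, with the explicit ones.\<close>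

lemma ae_equal_self_iff [simp]: "ae_equal f f \<longleftrightarrow> sq_integrable f"
  by (simp add: ae_equal_def)

lemma sq_integrable_measurable: "sq_integrable f \<Longrightarrow> f \<in> borel_measurable borel"
  by (simp add: sq_integrable_def)

lemma abs_L2_eq_iff:
  assumes "sq_integrable f" "sq_integrable g"
  shows "abs_L2 f = abs_L2 g \<longleftrightarrow> (AE x in lborel. f x = g x)"
  using assms Quotient3_rel[OF Quotient3_L2, of f g] by (simp add: ae_equal_def)

lemma sq_integrable_rep_L2: "sq_integrable (rep_L2 F)"
  using Quotient3_rep_reflp[OF Quotient3_L2, of F] by simp

lemma abs_rep_L2: "abs_L2 (rep_L2 F) = F"
  by (rule Quotient3_abs_rep[OF Quotient3_L2])

lemma L2_cases:
  obtains f where "sq_integrable f" "F = abs_L2 f"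
  using sq_integrable_rep_L2 abs_rep_L2 by metis

lemma abs_L2_add:
  "sq_integrable f \<Longrightarrow> sq_integrable g \<Longrightarrow> abs_L2 f + abs_L2 g = abs_L2 (\<lambda>x. f x + g x)"
  by (simp add: plus_L2.abs_eq)

lemma abs_L2_diff:
  "sq_integrable f \<Longrightarrow> sq_integrable g \<Longrightarrow> abs_L2 f - abs_L2 g = abs_L2 (\<lambda>x. f x - g x)"
  by (simp add: minus_L2.abs_eq)

lemma abs_L2_scaleC: "sq_integrable f \<Longrightarrow> c \<cdot>\<^sub>C abs_L2 f = abs_L2 (\<lambda>x. c * f x)"
  by (simp add: scaleC_L2.abs_eq)

lemma abs_L2_scaleR: "sq_integrable f \<Longrightarrow> r *\<^sub>R abs_L2 f = abs_L2 (\<lambda>x. r *\<^sub>R f x)"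
  by (simp add: scaleR_L2.abs_eq)

lemma scaleR_L2_eq_scaleC: "r *\<^sub>R F = of_real r \<cdot>\<^sub>C (F :: L2)"
  by (rule L2_cases[of F]) (simp add: abs_L2_scaleR abs_L2_scaleC scaleR_conv_of_real)

lemma norm_abs_L2: "sq_integrable f \<Longrightarrow> norm (abs_L2 f) = sqrt (LINT x|lborel. (cmod (f x))\<^sup>2)"
  by (simp add: norm_L2.abs_eq)

lemma norm_scaleC_L2: "norm (c \<cdot>\<^sub>C F) = cmod c * norm (F :: L2)"
  by (rule L2_cases[of F])
    (simp add: abs_L2_scaleC norm_abs_L2 sq_integrable_cmult norm_mult power_mult_distrib real_sqrt_mult)

lemma scaleC_add_right_L2: "c \<cdot>\<^sub>C (F + G) = c \<cdot>\<^sub>C F + c \<cdot>\<^sub>C (G :: L2)"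
  by (rule L2_cases[of F], rule L2_cases[of G])
    (simp add: abs_L2_scaleC abs_L2_add sq_integrable_cmult sq_integrable_add distrib_left)

lemma scaleC_add_left_L2: "(c + d) \<cdot>\<^sub>C F = c \<cdot>\<^sub>C F + d \<cdot>\<^sub>C (F :: L2)"
  by (rule L2_cases[of F])
    (simp add: abs_L2_scaleC abs_L2_add sq_integrable_cmult distrib_right)

lemma scaleC_scaleC_L2: "c \<cdot>\<^sub>C d \<cdot>\<^sub>C F = (c * d) \<cdot>\<^sub>C (F :: L2)"
  by (rule L2_cases[of F]) (simp add: abs_L2_scaleC sq_integrable_cmult mult.assoc)

lemma bounded_linear_scaleC_L2: "bounded_linear (\<lambda>F :: L2. c \<cdot>\<^sub>C F)"
  by (rule bounded_linear_intro[of _ "cmod c"])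
    (auto simp: scaleC_add_right_L2 norm_scaleC_L2 scaleR_L2_eq_scaleC scaleC_scaleC_L2 mult.commute)

lemma sq_integrable_bound:
  assumes "sq_integrable g" "f \<in> borel_measurable borel" "\<And>x. cmod (f x) \<le> cmod (g x)"
  shows "sq_integrable f"
  unfolding sq_integrable_def
proof
  show "f \<in> borel_measurable lborel" using assms by simp
  show "integrable lborel (\<lambda>x. (cmod (f x))\<^sup>2)"
    by (rule Bochner_Integration.integrable_bound[of _ "\<lambda>x. (cmod (g x))\<^sup>2"])
      (use assms in \<open>auto simp: sq_integrable_def intro!: power_mono\<close>)
qed

lemma integrable_mult_sq_integrable:
  assumes "sq_integrable f" "sq_integrable g"
  shows "integrable lborel (\<lambda>x. f x * g x)"
proof (rule Bochner_Integration.integrable_bound)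
  show "integrable lborel (\<lambda>x. (cmod (f x))\<^sup>2 + (cmod (g x))\<^sup>2)"
    using assms by (auto simp: sq_integrable_def)
  show "(\<lambda>x. f x * g x) \<in> borel_measurable lborel"
    using assms by (auto simp: sq_integrable_def)
  have "a * b \<le> a\<^sup>2 + b\<^sup>2" if "a \<ge> 0" "b \<ge> 0" for a b :: real
    using sum_squares_bound[of a b] mult_nonneg_nonneg[OF that] by linarith
  then show "AE x in lborel. norm (f x * g x) \<le> norm ((cmod (f x))\<^sup>2 + (cmod (g x))\<^sup>2)"
    by (auto simp: norm_mult)
qed

text \<open>Dominated convergence with majorant (2|G|)^2. The limits in the density argument are
  taken pointwise on representatives, and this turns them into limits in norm.\<close>

lemma tendsto_abs_L2:
  assumes G: "sq_integrable G"
    and s: "\<And>n. s n \<in> borel_measurable borel" "\<And>n x. cmod (s n x) \<le> cmod (G x)"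
    and lim: "\<And>x. (\<lambda>n. s n x) \<longlonglongrightarrow> f x"
  shows "sq_integrable f" "(\<lambda>n. abs_L2 (s n)) \<longlonglongrightarrow> abs_L2 f"
proof -
  have sn: "sq_integrable (s n)" for n by (rule sq_integrable_bound[OF G s])
  have fm: "f \<in> borel_measurable borel"
    by (rule borel_measurable_LIMSEQ_metric[OF s(1) lim])
  have le: "cmod (f x) \<le> cmod (G x)" for x
    by (rule LIMSEQ_le_const2[OF tendsto_norm[OF lim]]) (use s(2) in blast)
  show f: "sq_integrable f" by (rule sq_integrable_bound[OF G fm le])
  have "(\<lambda>n. LINT x|lborel. (cmod (s n x - f x))\<^sup>2) \<longlonglongrightarrow> (LINT x|(lborel::real measure). 0)"
  proof (rule integral_dominated_convergence)
    show "integrable lborel (\<lambda>x. (2 * cmod (G x))\<^sup>2)"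
      using G by (auto simp: sq_integrable_def power_mult_distrib)
    show "AE x in lborel. (\<lambda>n. (cmod (s n x - f x))\<^sup>2) \<longlonglongrightarrow> 0"
    proof (rule AE_I2)
      fix x show "(\<lambda>n. (cmod (s n x - f x))\<^sup>2) \<longlonglongrightarrow> 0"
        using tendsto_power[OF tendsto_norm_zero[OF LIM_zero[OF lim[of x]]], of 2] by simp
    qed
    have "cmod (s n x - f x) \<le> 2 * cmod (G x)" for n x
      using norm_triangle_ineq4[of "s n x" "f x"] s(2)[of n x] le[of x] by linarith
    then show "AE x in lborel. norm ((cmod (s n x - f x))\<^sup>2) \<le> (2 * cmod (G x))\<^sup>2" for n
      using power_mono[of "cmod (s n x - f x)" "2 * cmod (G x)" 2 for x]
      by (auto intro!: AE_I2 power_mono simp del: power_mult_distrib)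
  qed (use s fm in auto)
  then have "(\<lambda>n. (norm (abs_L2 (s n) - abs_L2 f))\<^sup>2) \<longlonglongrightarrow> 0"
    by (simp add: abs_L2_diff sn f norm_abs_L2 sq_integrable_diff)
  then have "(\<lambda>n. sqrt ((norm (abs_L2 (s n) - abs_L2 f))\<^sup>2)) \<longlonglongrightarrow> sqrt 0"
    by (rule tendsto_real_sqrt)
  then show "(\<lambda>n. abs_L2 (s n)) \<longlonglongrightarrow> abs_L2 f"
    by (subst LIM_zero_iff[symmetric]) (simp add: tendsto_norm_zero_iff)
qed

section \<open>Gaussian integrals\<close>

text \<open>The substitution u = s x - p reduces the integral to the characteristic function of the
  standard normal distribution: Re z moves the centre of the density, Im z becomes the
  frequency.\<close>

lemma integral_exp_gauss_linear:
  fixes z :: complex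
  assumes r: "r > 0"
  shows "has_bochner_integral lborel (\<lambda>x. exp (- of_real r * (of_real x)\<^sup>2 + z * of_real x))
    (of_real (sqrt (pi / r)) * exp (z\<^sup>2 / (4 * of_real r)))"
proof -
  define s where "s = sqrt (2 * r)"
  have s: "s > 0" "s\<^sup>2 = 2 * r" using r by (auto simp: s_def)
  have base: "has_bochner_integral lborel (\<lambda>x. std_normal_density x *\<^sub>R iexp (t * x))
     (of_real (exp (- t\<^sup>2 / 2)))" for t
  proof -
    have i: "integrable std_normal_distribution (\<lambda>x. iexp (t * x))"
      by (rule prob_space.integrable_iexp[OF prob_space_normal_density]) auto
    have "integrable lborel (\<lambda>x. std_normal_density x *\<^sub>R iexp (t * x))"
      using i by (subst (asm) integrable_density) (auto)
    moreover have "(LINT x|lborel. std_normal_density x *\<^sub>R iexp (t * x)) = of_real (exp (- t\<^sup>2 / 2))"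
      using fun_cong[OF char_std_normal_distribution, of t] unfolding char_def
      by (subst (asm) integral_density) auto
    ultimately show ?thesis by (simp add: has_bochner_integral_iff)
  qed
  define p where "p = Re z / s"
  define t where "t = Im z / s"
  have z: "z = of_real s * (of_real p + \<i> * of_real t)"
    using s(1) by (auto simp: p_def t_def complex_eq_iff)
  have "has_bochner_integral lborel (\<lambda>x. std_normal_density (- p + s * x) *\<^sub>R iexp (t * (- p + s * x)))
     (of_real (exp (- t\<^sup>2 / 2)) /\<^sub>R \<bar>s\<bar>)"
    using lborel_has_bochner_integral_real_affine_iff[of s "\<lambda>x. std_normal_density x *\<^sub>R iexp (t * x)" "of_real (exp (- t\<^sup>2 / 2))" "-p"] base[of t] s(1)
    by simp
  then have "has_bochner_integral lborel (\<lambda>x. (of_real (sqrt (2 * pi)) * exp (of_real (p\<^sup>2 / 2) + \<i> * of_real (t * p))) *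
      (std_normal_density (- p + s * x) *\<^sub>R iexp (t * (- p + s * x))))
     ((of_real (sqrt (2 * pi)) * exp (of_real (p\<^sup>2 / 2) + \<i> * of_real (t * p))) * (of_real (exp (- t\<^sup>2 / 2)) /\<^sub>R \<bar>s\<bar>))"
    by (intro has_bochner_integral_mult_right) auto
  moreover have "(of_real (sqrt (2 * pi)) * exp (of_real (p\<^sup>2 / 2) + \<i> * of_real (t * p))) *
      (std_normal_density (- p + s * x) *\<^sub>R iexp (t * (- p + s * x)))
      = exp (- of_real r * (of_real x)\<^sup>2 + z * of_real x)" for x
  proof -
    have "std_normal_density (- p + s * x) = exp (- (s * x - p)\<^sup>2 / 2) / sqrt (2 * pi)"
      by (simp add: normal_density_def)
    then have "(of_real (sqrt (2 * pi)) * exp (of_real (p\<^sup>2 / 2) + \<i> * of_real (t * p))) *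
      (std_normal_density (- p + s * x) *\<^sub>R iexp (t * (- p + s * x)))
      = exp (of_real (p\<^sup>2 / 2) + \<i> * of_real (t * p)) *
       (of_real (exp (- (s * x - p)\<^sup>2 / 2)) * iexp (t * (- p + s * x)))"
      by (simp add: scaleR_conv_of_real)
    also have "\<dots> = exp (of_real (p\<^sup>2 / 2) + \<i> * of_real (t * p) + of_real (- (s * x - p)\<^sup>2 / 2) + \<i> * of_real (t * (- p + s * x)))"
      by (simp only: exp_add exp_of_real mult.assoc)
    also have "of_real (p\<^sup>2 / 2) + \<i> * of_real (t * p) + of_real (- (s * x - p)\<^sup>2 / 2) + \<i> * of_real (t * (- p + s * x)) = - of_real r * (of_real x)\<^sup>2 + z * of_real x"
    proof -
      have "r = s\<^sup>2 / 2" using s by simp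
      then show ?thesis unfolding z
        by (simp add: complex_eq_iff power2_eq_square field_simps)
    qed
    finally show ?thesis .
  qed
  moreover have "(of_real (sqrt (2 * pi)) * exp (of_real (p\<^sup>2 / 2) + \<i> * of_real (t * p))) * (of_real (exp (- t\<^sup>2 / 2)) /\<^sub>R \<bar>s\<bar>)
     = of_real (sqrt (pi / r)) * exp (z\<^sup>2 / (4 * of_real r))"
  proof -
    have "sqrt (2 * pi) / s = sqrt (pi / r)"
      using r by (simp add: s_def flip: real_sqrt_divide)
    moreover have "z\<^sup>2 / (4 * of_real r) = of_real (p\<^sup>2 / 2) + \<i> * of_real (t * p) + of_real (- t\<^sup>2 / 2)"
    proof -
      have r': "complex_of_real r = (of_real s)\<^sup>2 / 2" using s by (metis of_real_divide of_real_numeral of_real_power nonzero_mult_div_cancel_left zero_neq_numeral)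
      have "complex_of_real s \<noteq> 0" using s by simp
      then show ?thesis unfolding r' z
        by (simp add: field_simps power2_eq_square)
    qed
    ultimately have "of_real (sqrt (pi / r)) * exp (z\<^sup>2 / (4 * of_real r))
        = of_real (sqrt (2 * pi) / s) * (exp (of_real (p\<^sup>2 / 2) + \<i> * of_real (t * p)) * of_real (exp (- t\<^sup>2 / 2)))"
      by (simp only: exp_add exp_of_real)
    moreover have "of_real u * v * (w /\<^sub>R k) = of_real (u / k) * (v * w)" for u k :: real and v w :: complex
      by (simp add: scaleR_conv_of_real divide_inverse)
    ultimately show ?thesis
      using s(1) by (simp only: abs_of_pos)
  qed
  ultimately show ?thesis by simp
qed

text \<open>The factor 1/2 matches the Hermite functions, which are polynomials times
  \<open>exp (- (z\<^sup>2 / 2))\<close>.\<close>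

definition gauss_exp :: "complex \<Rightarrow> complex \<Rightarrow> real \<Rightarrow> complex" where
  "gauss_exp w \<beta> x = exp (- (w * (of_real x)\<^sup>2 / 2) + \<beta> * of_real x)"

lemma norm_gauss_exp: "cmod (gauss_exp w \<beta> x) = exp (- (Re w * x\<^sup>2 / 2) + Re \<beta> * x)"
  by (simp add: gauss_exp_def flip: of_real_power)

lemma continuous_gauss_exp [continuous_intros]:
  "continuous_on A f \<Longrightarrow> continuous_on A (\<lambda>x. gauss_exp w \<beta> (f x))"
  unfolding gauss_exp_def by (intro continuous_intros) auto

lemma borel_measurable_gauss_exp [measurable]: "gauss_exp w \<beta> \<in> borel_measurable borel"
  by (rule borel_measurable_continuous_onI) (intro continuous_intros)

lemma gauss_exp_mult: "gauss_exp w \<beta> x * gauss_exp w' \<beta>' x = gauss_exp (w + w') (\<beta> + \<beta>') x"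
  unfolding gauss_exp_def exp_add[symmetric] by (rule arg_cong[of _ _ exp]) (simp add: field_simps)

lemma cnj_gauss_exp: "cnj (gauss_exp w \<beta> x) = gauss_exp (cnj w) (cnj \<beta>) x"
  by (simp add: gauss_exp_def exp_cnj)

lemma has_integral_gauss_exp_real:
  assumes "r > 0"
  shows "has_bochner_integral lborel (gauss_exp (of_real r) z)
    (of_real (sqrt (2 * pi / r)) * exp (z\<^sup>2 / (2 * of_real r)))"
  using integral_exp_gauss_linear[of "r / 2" z] assms
  by (simp add: gauss_exp_def[abs_def] mult.commute)

lemma integrable_gauss_exp:
  assumes "Re w > 0"
  shows "integrable lborel (gauss_exp w \<beta>)"
proof (rule Bochner_Integration.integrable_bound)
  show "integrable lborel (gauss_exp (of_real (Re w)) (of_real (Re \<beta>)))"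
    using has_integral_gauss_exp_real[OF assms] by (simp add: has_bochner_integral_iff)
qed (auto simp: norm_gauss_exp)

lemma sq_integrable_gauss_exp:
  assumes "Re w > 0"
  shows "sq_integrable (gauss_exp w \<beta>)"
proof -
  have "(cmod (gauss_exp w \<beta> x))\<^sup>2 = cmod (gauss_exp (2 * w) (2 * \<beta>) x)" for x
    by (simp add: norm_gauss_exp power2_eq_square flip: exp_add)
  then show ?thesis
    using integrable_norm[OF integrable_gauss_exp[of "2 * w" "2 * \<beta>"]] assms
    by (simp add: sq_integrable_def)
qed

text \<open>
  The substitution $y = y' + u$ turns the double integral on the left into two integrals whose
  quadratic coefficients are real, which avoids contour shifts and branches of the square root.
\<close>
lemma gauss_integral_mult_cnj:
  assumes "Re w > 0"
  shows "(LINT y|lborel. gauss_exp w \<beta> y) * cnj (LINT y|lborel. gauss_exp w 0 y)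
    = of_real (2 * pi / cmod w) * exp (\<beta>\<^sup>2 / (2 * w))"
proof -
  define r where "r = Re w"
  have r: "r > 0" using assms by (simp add: r_def)
  have w0: "w \<noteq> 0" using assms by auto
  have cw: "cnj w = 2 * of_real r - w" by (simp add: r_def complex_eq_iff)
  have cmw: "complex_of_real ((cmod w)\<^sup>2) = w * cnj w" by (rule complex_norm_square)
  have R: "complex_of_real r \<noteq> 0" "2 * complex_of_real r - w \<noteq> 0"
    using r w0 by (simp_all flip: cw)
  let ?F = "gauss_exp w \<beta>" and ?G = "gauss_exp (cnj w) 0"
  have G: "integrable lborel ?G" and F: "integrable lborel ?F"
    using assms by (auto intro: integrable_gauss_exp)
  have shift: "(LINT u|lborel. norm (?F (y + u))) = (LINT u|lborel. norm (?F u))"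
    "(LINT u|lborel. ?F (y + u)) = (LINT u|lborel. ?F u)" for y
    using lborel_integral_real_affine[of 1 "\<lambda>u. norm (?F u)" y]
      lborel_integral_real_affine[of 1 ?F y] by simp_all
  have Fs: "integrable lborel (\<lambda>u. ?F (y + u))" for y
    using lborel_integrable_real_affine[OF F, of 1 y] by simp
  have prod: "integrable (lborel \<Otimes>\<^sub>M lborel) (\<lambda>(y, u). ?F (y + u) * ?G y)"
  proof (rule lborel_pair.Fubini_integrable)
    show "(\<lambda>(y, u). ?F (y + u) * ?G y) \<in> borel_measurable (lborel \<Otimes>\<^sub>M lborel)" by measurable
    show "integrable lborel (\<lambda>y. LINT u|lborel. norm (case (y, u) of (y, u) \<Rightarrow> ?F (y + u) * ?G y))"
      using G by (simp add: norm_mult shift)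
  qed (use Fs in simp)
  have "(LINT y|lborel. ?F y) * cnj (LINT y|lborel. gauss_exp w 0 y)
      = (LINT y|lborel. (LINT u|lborel. ?F u) * ?G y)"
    by (simp add: cnj_gauss_exp Bochner_Integration.integral_cnj[symmetric])
  also have "\<dots> = (LINT y|lborel. LINT u|lborel. ?F (y + u) * ?G y)"
    by (simp add: shift)
  also have "\<dots> = (LINT u|lborel. LINT y|lborel. ?F (y + u) * ?G y)"
    using lborel_pair.Fubini_integral[OF prod] by simp
  \<comment> \<open>In y the quadratic coefficient is w + cnj w = 2 Re w. Completing the square
    leaves w - w^2 / (2 Re w) = |w|^2 / (2 Re w) as the coefficient in u, which is again
    positive.\<close>
  also have "(\<lambda>u. LINT y|lborel. ?F (y + u) * ?G y)
    = (\<lambda>u. of_real (sqrt (pi / r)) * exp (\<beta>\<^sup>2 / (4 * of_real r)) *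
         gauss_exp (of_real ((cmod w)\<^sup>2 / (2 * r))) (\<beta> * cnj w / (2 * of_real r)) u)"
  proof
    fix u
    have "?F (y + u) * ?G y = exp (\<beta> * of_real u - w * (of_real u)\<^sup>2 / 2)
        * gauss_exp (of_real (2 * r)) (\<beta> - w * of_real u) y" for y
      unfolding gauss_exp_def of_real_mult of_real_numeral exp_add[symmetric] cw
      by (rule arg_cong[of _ _ exp]) (simp add: field_simps power2_eq_square)
    then have "(LINT y|lborel. ?F (y + u) * ?G y) = exp (\<beta> * of_real u - w * (of_real u)\<^sup>2 / 2) *
        (of_real (sqrt (2 * pi / (2 * r))) * exp ((\<beta> - w * of_real u)\<^sup>2 / (2 * of_real (2 * r))))"
      using has_integral_gauss_exp_real[of "2 * r" "\<beta> - w * of_real u"] r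
      by (simp add: has_bochner_integral_iff)
    also have "\<dots> = of_real (sqrt (pi / r)) *
       exp (\<beta> * of_real u - w * (of_real u)\<^sup>2 / 2 + (\<beta> - w * of_real u)\<^sup>2 / (4 * of_real r))"
      by (simp add: exp_add)
    also have "\<beta> * of_real u - w * (of_real u)\<^sup>2 / 2 + (\<beta> - w * of_real u)\<^sup>2 / (4 * of_real r)
      = \<beta>\<^sup>2 / (4 * of_real r) + (- (of_real ((cmod w)\<^sup>2 / (2 * r)) * (of_real u)\<^sup>2 / 2)
          + \<beta> * cnj w / (2 * of_real r) * of_real u)"
      unfolding of_real_divide of_real_mult cmw cw of_real_numeral
      using R by (simp add: field_simps power2_eq_square)
    finally show "(LINT y|lborel. ?F (y + u) * ?G y) = of_real (sqrt (pi / r)) * exp (\<beta>\<^sup>2 / (4 * of_real r)) *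
         gauss_exp (of_real ((cmod w)\<^sup>2 / (2 * r))) (\<beta> * cnj w / (2 * of_real r)) u"
      unfolding gauss_exp_def exp_add by (simp only: mult.assoc)
  qed
  also have "(LINT u|lborel. of_real (sqrt (pi / r)) * exp (\<beta>\<^sup>2 / (4 * of_real r)) *
         gauss_exp (of_real ((cmod w)\<^sup>2 / (2 * r))) (\<beta> * cnj w / (2 * of_real r)) u)
    = of_real (sqrt (pi / r) * sqrt (2 * pi / ((cmod w)\<^sup>2 / (2 * r)))) *
      exp (\<beta>\<^sup>2 / (4 * of_real r) + (\<beta> * cnj w / (2 * of_real r))\<^sup>2 / (2 * of_real ((cmod w)\<^sup>2 / (2 * r))))"
    using has_integral_gauss_exp_real[of "(cmod w)\<^sup>2 / (2 * r)" "\<beta> * cnj w / (2 * of_real r)"] r w0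
    by (simp add: has_bochner_integral_iff exp_add)
  also have "sqrt (pi / r) * sqrt (2 * pi / ((cmod w)\<^sup>2 / (2 * r))) = 2 * pi / cmod w"
  proof -
    have "sqrt (pi / r) * sqrt (2 * pi / ((cmod w)\<^sup>2 / (2 * r))) = sqrt ((2 * pi / cmod w)\<^sup>2)"
      using r unfolding real_sqrt_mult[symmetric] by (simp add: field_simps power2_eq_square)
    then show ?thesis by simp
  qed
  also have "\<beta>\<^sup>2 / (4 * of_real r) + (\<beta> * cnj w / (2 * of_real r))\<^sup>2 / (2 * of_real ((cmod w)\<^sup>2 / (2 * r)))
     = \<beta>\<^sup>2 / (2 * w)"
    unfolding of_real_divide of_real_mult cmw cw of_real_numeral
    using R w0 by (simp add: field_simps power2_eq_square)
  finally show ?thesis .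
qed

text \<open>The case \<beta> = 0 of the preceding product. The phase, that is the branch of the
  square root of 2 pi / w, stays undetermined.\<close>

lemma norm_gauss_integral:
  assumes "Re w > 0"
  shows "(cmod (LINT y|lborel. gauss_exp w 0 y))\<^sup>2 = 2 * pi / cmod w"
proof -
  have "complex_of_real ((cmod (LINT y|lborel. gauss_exp w 0 y))\<^sup>2) = of_real (2 * pi / cmod w)"
    using gauss_integral_mult_cnj[OF assms, of 0] by (simp only: complex_norm_square) simp
  then show ?thesis by (simp only: of_real_eq_iff)
qed

lemma gauss_integral_nonzero:
  assumes "Re w > 0"
  shows "(LINT y|lborel. gauss_exp w 0 y) \<noteq> 0"
proof
  assume "(LINT y|lborel. gauss_exp w 0 y) = 0"
  with norm_gauss_integral[OF assms] have "2 * pi / cmod w = 0" by simp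
  with assms show False by auto
qed

text \<open>The values of \<open>gauss_integral_mult_cnj\<close> for \<beta> and for 0 share the
  same nonzero conjugate factor, which cancels.\<close>

lemma gauss_integral_linear:
  assumes "Re w > 0"
  shows "(LINT y|lborel. gauss_exp w \<beta> y) = (LINT y|lborel. gauss_exp w 0 y) * exp (\<beta>\<^sup>2 / (2 * w))"
proof -
  let ?J = "LINT y|lborel. gauss_exp w 0 y"
  have J: "?J * cnj ?J = of_real (2 * pi / cmod w)"
    using gauss_integral_mult_cnj[OF assms, of 0] by simp
  have "(?J * exp (\<beta>\<^sup>2 / (2 * w))) * cnj ?J = (?J * cnj ?J) * exp (\<beta>\<^sup>2 / (2 * w))"
    by (simp only: mult_ac)
  then have "(LINT y|lborel. gauss_exp w \<beta> y) * cnj ?J = (?J * exp (\<beta>\<^sup>2 / (2 * w))) * cnj ?J"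
    unfolding J gauss_integral_mult_cnj[OF assms, of \<beta>] ..
  then show ?thesis using gauss_integral_nonzero[OF assms] by simp
qed

section \<open>Polynomials times Gaussians: integrability, decay and integration by parts\<close>

lemma integrable_poly_gauss_exp:
  assumes "Re w > 0"
  shows "integrable lborel (\<lambda>y. poly q (of_real y) * gauss_exp w \<beta> y)"
proof -
  \<comment> \<open>One half of the Gaussian makes the polynomial square-integrable, the other half
    absorbs the linear exponent.\<close>
  have "sq_integrable (\<lambda>y. poly q (of_real y) * gauss_exp (w / 2) 0 y)"
    using sq_integrable_poly_gauss[of "w / 2" q] assms by (simp add: gauss_exp_def)
  moreover have "sq_integrable (gauss_exp (w / 2) \<beta>)"
    using assms by (intro sq_integrable_gauss_exp) simp
  ultimately have "integrable lborel (\<lambda>y. poly q (of_real y) * gauss_exp (w / 2) 0 y * gauss_exp (w / 2) \<beta> y)"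
    by (rule integrable_mult_sq_integrable)
  then show ?thesis by (simp add: mult.assoc gauss_exp_mult)
qed

lemma tendsto_poly_gauss_exp_at_top:
  assumes "Re w > 0"
  shows "((\<lambda>y. poly q (of_real y) * gauss_exp w \<beta> y) \<longlongrightarrow> 0) at_top"
proof -
  have mono: "((\<lambda>y. of_real y ^ k * gauss_exp w \<beta> y) \<longlongrightarrow> 0) at_top" for k
  proof (rule Lim_null_comparison)
    \<comment> \<open>The maximum over x of the exponent plus x, so that the Gaussian is dominated
      by e^{s - x}.\<close>
    define s where "s = (Re \<beta> + 1)\<^sup>2 / (2 * Re w)"
    have le: "- (Re w * x\<^sup>2 / 2) + Re \<beta> * x \<le> s - x" for x
    proof -
      have "s - x - (- (Re w * x\<^sup>2 / 2) + Re \<beta> * x) = (Re w * x - (Re \<beta> + 1))\<^sup>2 / (2 * Re w)"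
        using assms by (simp add: s_def field_simps power2_eq_square)
      moreover have "\<dots> \<ge> 0" using assms by simp
      ultimately show ?thesis by linarith
    qed
    show "eventually (\<lambda>y. norm (of_real y ^ k * gauss_exp w \<beta> y) \<le> exp s * (y ^ k / exp y)) at_top"
      using eventually_ge_at_top[of 0]
    proof eventually_elim
      case (elim y)
      have "norm (of_real y ^ k * gauss_exp w \<beta> y) = y ^ k * exp (- (Re w * y\<^sup>2 / 2) + Re \<beta> * y)"
        using elim by (simp add: norm_mult norm_power norm_gauss_exp)
      also have "\<dots> \<le> y ^ k * exp (s - y)" using elim le by (intro mult_left_mono) auto
      finally show ?case by (simp add: exp_diff mult.commute)
    qed
    show "((\<lambda>y. exp s * (y ^ k / exp y)) \<longlongrightarrow> 0) at_top"
      using tendsto_mult_right_zero[OF tendsto_power_div_exp_0] by blast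
  qed
  have "((\<lambda>y. \<Sum>i\<le>degree q. coeff q i * (of_real y ^ i * gauss_exp w \<beta> y)) \<longlongrightarrow> (\<Sum>i\<le>degree q. coeff q i * 0)) at_top"
    by (intro tendsto_sum tendsto_mult tendsto_const mono)
  then show ?thesis by (simp add: poly_altdef sum_distrib_right mult.assoc)
qed

lemma tendsto_poly_gauss_exp_at_bot:
  assumes "Re w > 0"
  shows "((\<lambda>y. poly q (of_real y) * gauss_exp w \<beta> y) \<longlongrightarrow> 0) at_bot"
  using tendsto_poly_gauss_exp_at_top[OF assms, of "pcompose q [:0, -1:]" "- \<beta>"]
  unfolding filterlim_at_bot_mirror by (simp add: poly_pcompose gauss_exp_def)

text \<open>The function q e^{-w y^2/2 + \<beta> y} vanishes at both ends, and its derivative is q'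
  + \<beta> q - w y q times the same exponential.\<close>

lemma integral_poly_gauss_exp_by_parts:
  assumes "Re w > 0"
  shows "(LINT y|lborel. poly (pderiv q) (of_real y) * gauss_exp w \<beta> y)
    + \<beta> * (LINT y|lborel. poly q (of_real y) * gauss_exp w \<beta> y)
    = w * (LINT y|lborel. poly ([:0, 1:] * q) (of_real y) * gauss_exp w \<beta> y)"
proof -
  let ?I = "\<lambda>q. LINT y|lborel. poly q (of_real y) * gauss_exp w \<beta> y"
  let ?p = "pderiv q + smult \<beta> q - smult w ([:0, 1:] * q)"
  let ?F = "\<lambda>y. poly q (of_real y) * gauss_exp w \<beta> y" and ?f = "\<lambda>y. poly ?p (of_real y) * gauss_exp w \<beta> y"
  have "(LBINT y=-\<infinity>..\<infinity>. ?f y) = 0 - 0"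
  proof (rule interval_integral_FTC_integrable)
    show "(?F has_vector_derivative ?f x) (at x)" for x
    proof -
      have "((\<lambda>z. poly q z * exp (- (w * z\<^sup>2 / 2) + \<beta> * z)) has_field_derivative
          poly ?p (of_real x) * exp (- (w * (of_real x)\<^sup>2 / 2) + \<beta> * of_real x)) (at (of_real x))"
        by (rule derivative_eq_intros poly_DERIV refl | simp add: algebra_simps)+
      moreover have "(of_real has_vector_derivative (1::complex)) (at x)"
        by (auto intro!: derivative_eq_intros)
      ultimately show ?thesis
        using field_vector_diff_chain_at[of complex_of_real 1 x] unfolding gauss_exp_def o_def
        by fastforce
    qed
    show "isCont ?f x" for x
      unfolding gauss_exp_def by (intro continuous_intros) auto
    show "set_integrable lborel (einterval (- \<infinity>) \<infinity>) ?f"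
      using integrable_poly_gauss_exp[OF assms, of ?p \<beta>] by (simp add: set_integrable_def)
    show "((?F \<circ> real_of_ereal) \<longlongrightarrow> 0) (at_right (- \<infinity>))" "((?F \<circ> real_of_ereal) \<longlongrightarrow> 0) (at_left \<infinity>)"
      using tendsto_poly_gauss_exp_at_top[OF assms, of q \<beta>] tendsto_poly_gauss_exp_at_bot[OF assms, of q \<beta>]
      by (simp_all add: ereal_tendsto_simps)
  qed simp
  then have "?I ?p = 0"
    by (simp add: interval_lebesgue_integral_def set_lebesgue_integral_def)
  moreover have "?I ?p = ?I (pderiv q) + \<beta> * ?I q - w * ?I ([:0, 1:] * q)"
  proof -
    have i: "integrable lborel (\<lambda>y. poly q (of_real y) * gauss_exp w \<beta> y)" for q
      by (rule integrable_poly_gauss_exp[OF assms])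
    have "?I ?p = (LINT y|lborel. poly (pderiv q) (of_real y) * gauss_exp w \<beta> y + \<beta> * (poly q (of_real y) * gauss_exp w \<beta> y)
       - w * (poly ([:0, 1:] * q) (of_real y) * gauss_exp w \<beta> y))"
      by (simp add: algebra_simps)
    also have "\<dots> = ?I (pderiv q) + \<beta> * ?I q - w * ?I ([:0, 1:] * q)"
      using i[of "pderiv q"] i[of q] i[of "[:0, 1:] * q"] by simp
    finally show ?thesis .
  qed
  ultimately show ?thesis by simp
qed

section \<open>The norm of an operator with Gaussian kernel\<close>

lemma has_integral_gauss_real:
  fixes r q :: real
  assumes "r > 0"
  shows "has_bochner_integral lborel (\<lambda>x. exp (- (r * x\<^sup>2 / 2) + q * x))
    (sqrt (2 * pi / r) * exp (q\<^sup>2 / (2 * r)))"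
proof -
  have "gauss_exp (of_real r) (of_real q) x = of_real (exp (- (r * x\<^sup>2 / 2) + q * x))" for x
    by (simp add: gauss_exp_def flip: exp_of_real)
  moreover have "of_real (sqrt (2 * pi / r)) * exp ((of_real q)\<^sup>2 / (2 * of_real r))
      = complex_of_real (sqrt (2 * pi / r) * exp (q\<^sup>2 / (2 * r)))"
    by (simp flip: exp_of_real)
  ultimately show ?thesis
    using has_bochner_integral_bounded_linear[OF bounded_linear_Re has_integral_gauss_exp_real[OF assms, of "of_real q"]]
    by (simp only: Re_complex_of_real)
qed

text \<open>
  Schur's test with the weight $e^{-\<omega> y^2/2}$, which is an eigenfunction of the kernel
  when $\<omega> = \sqrt{P^2 - Q^2}$.
\<close>
lemma schur_test_gauss:
  fixes P Q :: real and F :: "real \<Rightarrow> real"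
  assumes P: "P > 0" "\<bar>Q\<bar> \<le> P" and \<omega>: "\<omega> = sqrt (P\<^sup>2 - Q\<^sup>2)"
    and F: "F \<in> borel_measurable borel" "integrable lborel (\<lambda>y. (F y)\<^sup>2)"
  defines "k \<equiv> \<lambda>(y, y'). exp (- (P * (y\<^sup>2 + y'\<^sup>2) / 2) + Q * y * y') * (F y * F y')"
  shows "integrable (lborel \<Otimes>\<^sub>M lborel) k"
    and "(LINT p|(lborel \<Otimes>\<^sub>M lborel). k p) \<le> sqrt (2 * pi / (P + \<omega>)) * (LINT y|lborel. (F y)\<^sup>2)"
proof -
  note [measurable] = F(1)
  have QP: "Q\<^sup>2 \<le> P\<^sup>2" using P by (auto simp: abs_le_square_iff[symmetric])
  have \<omega>0: "\<omega> \<ge> 0" and \<omega>2: "Q\<^sup>2 = (P - \<omega>) * (P + \<omega>)"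
    using QP by (auto simp: \<omega> algebra_simps power2_eq_square[symmetric])
  have r: "P + \<omega> > 0" using P \<omega>0 by simp
  define L where "L = sqrt (2 * pi / (P + \<omega>))"
  \<comment> \<open>Majorant for the inequality of arithmetic and geometric means: the kernel times
    F(y)^2 times the quotient of the weights at y' and at y.\<close>
  define h where "h = (\<lambda>(y, y'). exp (- (P * (y\<^sup>2 + y'\<^sup>2) / 2) + Q * y * y') *
    ((F y)\<^sup>2 * exp (\<omega> * y\<^sup>2 / 2 - \<omega> * y'\<^sup>2 / 2)))"
  have hm [measurable]: "h \<in> borel_measurable (lborel \<Otimes>\<^sub>M lborel)" unfolding h_def by measurable
  have h0: "h p \<ge> 0" for p by (auto simp: h_def split: prod.split)
  have inner: "has_bochner_integral lborel (\<lambda>y'. h (y, y')) (L * (F y)\<^sup>2)" for y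
  proof -
    have "h (y, y') = (F y)\<^sup>2 * exp ((\<omega> - P) * y\<^sup>2 / 2) * exp (- ((P + \<omega>) * y'\<^sup>2 / 2) + (Q * y) * y')" for y'
      unfolding h_def prod.case mult.left_commute[of "exp _" "(F y)\<^sup>2"] mult.assoc[of "(F y)\<^sup>2"] exp_add[symmetric]
      by (intro arg_cong[of _ _ "\<lambda>x. _ * exp x"]) (simp add: field_simps)
    moreover have "(F y)\<^sup>2 * exp ((\<omega> - P) * y\<^sup>2 / 2) * (sqrt (2 * pi / (P + \<omega>)) * exp ((Q * y)\<^sup>2 / (2 * (P + \<omega>)))) = L * (F y)\<^sup>2"
    proof -
      \<comment> \<open>The eigenfunction property of the weight: Q^2 / (P + \<omega>) = P -
        \<omega> cancels the exponents left after integrating over y'.\<close>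
      have "(\<omega> - P) * y\<^sup>2 / 2 + (Q * y)\<^sup>2 / (2 * (P + \<omega>)) = 0"
        using r unfolding power_mult_distrib \<omega>2 by (simp add: field_simps)
      then have "exp ((\<omega> - P) * y\<^sup>2 / 2) * exp ((Q * y)\<^sup>2 / (2 * (P + \<omega>))) = 1"
        by (simp flip: exp_add)
      moreover have "u * v * (w * v') = w * u * (v * v')" for u v w v' :: real
        by (simp only: mult_ac)
      ultimately show ?thesis unfolding L_def by simp
    qed
    ultimately show ?thesis
      using has_bochner_integral_mult_right[OF has_integral_gauss_real[OF r, of "Q * y"], of "(F y)\<^sup>2 * exp ((\<omega> - P) * y\<^sup>2 / 2)"]
      by (simp only: simp_thms)
  qed
  have hi: "integrable (lborel \<Otimes>\<^sub>M lborel) h"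
  proof (rule lborel_pair.Fubini_integrable[OF hm])
    show "integrable lborel (\<lambda>x. LINT y|lborel. norm (h (x, y)))"
      using inner h0 F(2) by (simp add: has_bochner_integral_iff)
  qed (use inner in \<open>auto simp: has_bochner_integral_iff\<close>)
  have hI: "integral\<^sup>L (lborel \<Otimes>\<^sub>M lborel) h = L * (LINT y|lborel. (F y)\<^sup>2)"
    using lborel_pair.integral_fst'[OF hi] inner by (simp add: has_bochner_integral_iff)
  have hi': "integrable (lborel \<Otimes>\<^sub>M lborel) (\<lambda>(y, y'). h (y', y))"
    by (rule lborel_pair.integrable_product_swap[OF hi])
  have hI': "(LINT (y, y')|(lborel \<Otimes>\<^sub>M lborel). h (y', y)) = L * (LINT y|lborel. (F y)\<^sup>2)"
    using lborel_pair.integral_product_swap[OF hm] hI by simp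
  have le: "\<bar>k p\<bar> \<le> (h p + (case p of (y, y') \<Rightarrow> h (y', y))) / 2" for p
  proof (cases p)
    case (Pair y y')
    \<comment> \<open>The square root of the weight quotient multiplies one factor and divides the
      other before 2uv \<le> u^2 + v^2 is applied.\<close>
    let ?e = "exp (\<omega> * y\<^sup>2 / 4 - \<omega> * y'\<^sup>2 / 4)" and ?s = "exp (- (P * (y\<^sup>2 + y'\<^sup>2) / 2) + Q * y * y')"
    have e: "exp (\<omega> * y\<^sup>2 / 2 - \<omega> * y'\<^sup>2 / 2) = ?e\<^sup>2" "exp (\<omega> * y'\<^sup>2 / 2 - \<omega> * y\<^sup>2 / 2) = (inverse ?e)\<^sup>2"
      by (simp_all add: power2_eq_square flip: exp_add exp_minus)
    have s: "exp (- (P * (y'\<^sup>2 + y\<^sup>2) / 2) + Q * y' * y) = ?s" by (simp add: algebra_simps)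
    have "2 * (\<bar>F y\<bar> * ?e) * (\<bar>F y'\<bar> * inverse ?e) \<le> (\<bar>F y\<bar> * ?e)\<^sup>2 + (\<bar>F y'\<bar> * inverse ?e)\<^sup>2"
      by (rule sum_squares_bound)
    moreover have "2 * (u * ?e) * (v * inverse ?e) = 2 * (u * v)" for u v by simp
    ultimately have "\<bar>F y * F y'\<bar> \<le> ((F y)\<^sup>2 * ?e\<^sup>2 + (F y')\<^sup>2 * (inverse ?e)\<^sup>2) / 2"
      by (simp add: power_mult_distrib abs_mult)
    then have "?s * \<bar>F y * F y'\<bar> \<le> ?s * (((F y)\<^sup>2 * ?e\<^sup>2 + (F y')\<^sup>2 * (inverse ?e)\<^sup>2) / 2)"
      by (rule mult_left_mono) simp
    then show ?thesis
      unfolding Pair k_def h_def prod.case e s by (simp add: abs_mult algebra_simps)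
  qed
  have int2: "integrable (lborel \<Otimes>\<^sub>M lborel) (\<lambda>p. (h p + (case p of (y, y') \<Rightarrow> h (y', y))) / 2)"
    using hi hi' by simp
  show ki: "integrable (lborel \<Otimes>\<^sub>M lborel) k"
  proof (rule Bochner_Integration.integrable_bound[OF int2])
    show "k \<in> borel_measurable (lborel \<Otimes>\<^sub>M lborel)" unfolding k_def by measurable
    show "AE p in lborel \<Otimes>\<^sub>M lborel. norm (k p) \<le> norm ((h p + (case p of (y, y') \<Rightarrow> h (y', y))) / 2)"
      by (intro AE_I2) (use le in \<open>auto intro: order_trans[OF _ abs_ge_self]\<close>)
  qed
  have "(LINT p|(lborel \<Otimes>\<^sub>M lborel). k p) \<le> (LINT p|(lborel \<Otimes>\<^sub>M lborel). (h p + (case p of (y, y') \<Rightarrow> h (y', y))) / 2)"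
    using order_trans[OF abs_ge_self le] by (intro integral_mono[OF ki int2])
  also have "\<dots> = L * (LINT y|lborel. (F y)\<^sup>2)"
    using hi hi' hI hI' by simp
  finally show "(LINT p|(lborel \<Otimes>\<^sub>M lborel). k p) \<le> sqrt (2 * pi / (P + \<omega>)) * (LINT y|lborel. (F y)\<^sup>2)"
    by (simp add: L_def)
qed

section \<open>Integral operators with Gaussian kernel and their overlap kernels\<close>

definition gauss_kernel :: "complex \<Rightarrow> complex \<Rightarrow> complex \<Rightarrow> real \<Rightarrow> real \<Rightarrow> complex" where
  "gauss_kernel a b c x y = c * gauss_exp a 0 x * gauss_exp a (b * of_real x) y"

definition gauss_op :: "complex \<Rightarrow> complex \<Rightarrow> complex \<Rightarrow> (real \<Rightarrow> complex) \<Rightarrow> real \<Rightarrow> complex" where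
  "gauss_op a b c f x = (LINT y|lborel. gauss_kernel a b c x y * f y)"

text \<open>The integral of K(x,y) cnj K(x,y') over x, by \<open>has_integral_gauss_overlap\<close>;
  thus the kernel of T^*T at (y', y).\<close>

definition gauss_overlap :: "complex \<Rightarrow> complex \<Rightarrow> complex \<Rightarrow> real \<Rightarrow> real \<Rightarrow> complex" where
  "gauss_overlap a b c y y' = of_real ((cmod c)\<^sup>2 * sqrt (pi / Re a)) *
     (gauss_exp a 0 y * gauss_exp (cnj a) 0 y' *
       exp ((b * of_real y + cnj b * of_real y')\<^sup>2 / (4 * of_real (Re a))))"

text \<open>The kernel is encoded as a Gaussian in y; by symmetry it is also one in x, the variable
  over which overlaps are integrated.\<close>

lemma gauss_kernel_sym: "gauss_kernel a b c x y = gauss_kernel a b c y x"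
  unfolding gauss_kernel_def gauss_exp_def mult.assoc exp_add[symmetric]
  by (intro arg_cong[of _ _ "\<lambda>x. c * exp x"]) (simp add: algebra_simps)

lemma has_integral_gauss_overlap:
  assumes "Re a > 0"
  shows "has_bochner_integral lborel (\<lambda>x. gauss_kernel a b c x y * cnj (gauss_kernel a b c x y'))
    (gauss_overlap a b c y y')"
proof -
  have "gauss_kernel a b c x y * cnj (gauss_kernel a b c x y')
    = of_real ((cmod c)\<^sup>2) * (gauss_exp a 0 y * gauss_exp (cnj a) 0 y') *
      gauss_exp (of_real (2 * Re a)) (b * of_real y + cnj b * of_real y') x" for x
  proof -
    have "gauss_kernel a b c x y * cnj (gauss_kernel a b c x y')
      = (c * cnj c) * (gauss_exp a 0 y * gauss_exp (cnj a) 0 y') *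
      (gauss_exp a (b * of_real y) x * gauss_exp (cnj a) (cnj b * of_real y') x)"
      unfolding gauss_kernel_sym[of a b c x] by (simp add: gauss_kernel_def cnj_gauss_exp)
    also have "a + cnj a = of_real (2 * Re a)" by (simp add: complex_eq_iff)
    then have "gauss_exp a (b * of_real y) x * gauss_exp (cnj a) (cnj b * of_real y') x
       = gauss_exp (of_real (2 * Re a)) (b * of_real y + cnj b * of_real y') x"
      by (simp only: gauss_exp_mult)
    finally show ?thesis by (simp only: complex_norm_square)
  qed
  moreover have "of_real ((cmod c)\<^sup>2) * (gauss_exp a 0 y * gauss_exp (cnj a) 0 y') *
     (of_real (sqrt (2 * pi / (2 * Re a))) * exp ((b * of_real y + cnj b * of_real y')\<^sup>2 / (2 * of_real (2 * Re a))))
     = gauss_overlap a b c y y'"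
    by (simp add: gauss_overlap_def)
  ultimately show ?thesis
    using has_bochner_integral_mult_right[OF has_integral_gauss_exp_real[of "2 * Re a" "b * of_real y + cnj b * of_real y'"],
       of "of_real ((cmod c)\<^sup>2) * (gauss_exp a 0 y * gauss_exp (cnj a) 0 y')"] assms
    by simp
qed

text \<open>This is P of the overview, and \<open>overlap_off\<close> is Q: the parameters of the
  modulus of \<open>gauss_overlap\<close>. Im a and Im (b^2) appear beside them only in the
  phase.\<close>

definition overlap_diag :: "complex \<Rightarrow> complex \<Rightarrow> real" where
  "overlap_diag a b = Re a - Re (b\<^sup>2) / (2 * Re a)"

definition overlap_off :: "complex \<Rightarrow> complex \<Rightarrow> real" where
  "overlap_off a b = (cmod b)\<^sup>2 / (2 * Re a)"

lemma norm_gauss_overlap: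
  assumes "Re a > 0"
  shows "cmod (gauss_overlap a b c y y') = (cmod c)\<^sup>2 * sqrt (pi / Re a) *
    exp (- (overlap_diag a b * (y\<^sup>2 + y'\<^sup>2) / 2) + overlap_off a b * y * y')"
proof -
  have "Re ((b * of_real y + cnj b * of_real y')\<^sup>2) = Re (b\<^sup>2) * (y\<^sup>2 + y'\<^sup>2) + 2 * (cmod b)\<^sup>2 * y * y'"
    unfolding cmod_power2 by (simp add: power2_eq_square algebra_simps)
  then have "Re ((b * of_real y + cnj b * of_real y')\<^sup>2 / (4 * of_real (Re a)))
     = (Re (b\<^sup>2) * (y\<^sup>2 + y'\<^sup>2) + 2 * (cmod b)\<^sup>2 * y * y') / (4 * Re a)"
    using Re_divide_of_real[of "(b * of_real y + cnj b * of_real y')\<^sup>2" "4 * Re a"] by simp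
  then have "cmod (gauss_exp a 0 y * gauss_exp (cnj a) 0 y' *
       exp ((b * of_real y + cnj b * of_real y')\<^sup>2 / (4 * of_real (Re a))))
     = exp (- (Re a * y\<^sup>2 / 2) - Re a * y'\<^sup>2 / 2 + (Re (b\<^sup>2) * (y\<^sup>2 + y'\<^sup>2) + 2 * (cmod b)\<^sup>2 * y * y') / (4 * Re a))"
    by (simp only: norm_mult norm_exp_eq_Re norm_gauss_exp exp_add[symmetric]) simp
  also have "- (Re a * y\<^sup>2 / 2) - Re a * y'\<^sup>2 / 2 + (Re (b\<^sup>2) * (y\<^sup>2 + y'\<^sup>2) + 2 * (cmod b)\<^sup>2 * y * y') / (4 * Re a)
    = - (overlap_diag a b * (y\<^sup>2 + y'\<^sup>2) / 2) + overlap_off a b * y * y'"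
    using assms unfolding overlap_diag_def overlap_off_def
    by (simp add: field_simps del: Re_power2)
  finally show ?thesis
    using assms by (simp add: gauss_overlap_def norm_mult norm_power)
qed

text \<open>P - Q = ((Re a)^2 - (Re b)^2) / Re a, which is where the bound on Re b enters.\<close>

lemma overlap_pos:
  assumes "Re a > 0" "\<bar>Re b\<bar> \<le> Re a"
  shows "overlap_diag a b > 0" "\<bar>overlap_off a b\<bar> \<le> overlap_diag a b"
proof -
  have b2: "(Re b)\<^sup>2 \<le> (Re a)\<^sup>2" using assms by (simp add: abs_le_square_iff[symmetric])
  have "2 * Re a * overlap_diag a b = 2 * (Re a)\<^sup>2 - (Re b)\<^sup>2 + (Im b)\<^sup>2"
    using assms by (simp add: overlap_diag_def field_simps power2_eq_square)
  moreover have "\<dots> > 0" using b2 assms by (smt (verit) zero_less_power2 zero_le_power2)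
  ultimately show "overlap_diag a b > 0" using assms zero_less_mult_pos[of "2 * Re a" "overlap_diag a b"] by simp
  have "overlap_diag a b - overlap_off a b = ((Re a)\<^sup>2 - (Re b)\<^sup>2) / Re a"
    using assms unfolding overlap_diag_def overlap_off_def cmod_power2
    by (simp add: field_simps power2_eq_square)
  moreover have "\<dots> \<ge> 0" using b2 assms by simp
  moreover have "overlap_off a b \<ge> 0" using assms by (simp add: overlap_off_def)
  ultimately show "\<bar>overlap_off a b\<bar> \<le> overlap_diag a b" by linarith
qed

lemma sq_integrable_gauss_kernel:
  assumes "Re a > 0"
  shows "sq_integrable (gauss_kernel a b c x)"
  unfolding gauss_kernel_def[abs_def] by (intro sq_integrable_cmult sq_integrable_gauss_exp assms)

lemma integrable_gauss_kernel_mult: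
  assumes "Re a > 0" "sq_integrable f"
  shows "integrable lborel (\<lambda>y. gauss_kernel a b c x y * f y)"
  by (rule integrable_mult_sq_integrable[OF sq_integrable_gauss_kernel[OF assms(1)] assms(2)])

lemma borel_measurable_cnj [measurable (raw)]:
  "f \<in> borel_measurable M \<Longrightarrow> (\<lambda>x. cnj (f x)) \<in> borel_measurable M"
  by (rule borel_measurable_continuous_on[of cnj]) (intro continuous_intros)

lemma borel_measurable_gauss_kernel [measurable (raw)]:
  assumes [measurable]: "f \<in> borel_measurable M" "g \<in> borel_measurable M"
  shows "(\<lambda>p. gauss_kernel a b c (f p) (g p)) \<in> borel_measurable M"
  unfolding gauss_kernel_def gauss_exp_def by measurable

lemma borel_measurable_gauss_overlap [measurable (raw)]:
  assumes [measurable]: "f \<in> borel_measurable M" "g \<in> borel_measurable M"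
  shows "(\<lambda>p. gauss_overlap a b c (f p) (g p)) \<in> borel_measurable M"
  unfolding gauss_overlap_def gauss_exp_def by measurable

lemma borel_measurable_gauss_op:
  assumes "sq_integrable f"
  shows "gauss_op a b c f \<in> borel_measurable borel"
proof -
  note [measurable] = sq_integrable_measurable[OF assms]
  show ?thesis unfolding gauss_op_def[abs_def] by measurable
qed

lemma norm_gauss_kernel:
  "cmod (gauss_kernel a b c x y) = cmod (gauss_kernel (of_real (Re a)) (of_real (Re b)) c x y)"
  by (simp add: gauss_kernel_def norm_mult norm_gauss_exp)

lemma gauss_kernel_real_nonneg:
  "gauss_kernel (of_real \<alpha>) (of_real \<beta>) (of_real \<gamma>) x y =
     of_real (\<gamma> * exp (- (\<alpha> * x\<^sup>2 / 2)) * exp (- (\<alpha> * y\<^sup>2 / 2) + \<beta> * x * y))"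
  by (simp add: gauss_kernel_def gauss_exp_def flip: exp_of_real)

text \<open>The modulus of the kernel is the Gaussian kernel with parameters Re a, Re b and |c|, so
  the overlap formula applies to it too. This supplies the absolute integrability for Fubini's
  theorem.\<close>

lemma integral_norm_gauss_kernel_mult:
  assumes "Re a > 0"
  shows "has_bochner_integral lborel (\<lambda>x. cmod (gauss_kernel a b c x y) * cmod (gauss_kernel a b c x y'))
    (cmod (gauss_overlap (of_real (Re a)) (of_real (Re b)) c y y'))"
proof -
  let ?K = "gauss_kernel (of_real (Re a)) (of_real (Re b)) (of_real (cmod c))"
  have K: "?K x y = of_real (cmod (gauss_kernel a b c x y))" for x y
    by (simp add: gauss_kernel_real_nonneg norm_gauss_kernel[of a b c])
      (simp add: gauss_kernel_def norm_mult norm_gauss_exp)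
  have int: "has_bochner_integral lborel (\<lambda>x. complex_of_real (cmod (gauss_kernel a b c x y) * cmod (gauss_kernel a b c x y')))
    (gauss_overlap (of_real (Re a)) (of_real (Re b)) (of_real (cmod c)) y y')"
    using has_integral_gauss_overlap[of "of_real (Re a)" "of_real (Re b)" "of_real (cmod c)" y y'] assms
    by (simp add: K)
  define I where "I = (LINT x|lborel. cmod (gauss_kernel a b c x y) * cmod (gauss_kernel a b c x y'))"
  have "has_bochner_integral lborel (\<lambda>x. cmod (gauss_kernel a b c x y) * cmod (gauss_kernel a b c x y'))
    (Re (gauss_overlap (of_real (Re a)) (of_real (Re b)) (of_real (cmod c)) y y'))"
    using has_bochner_integral_bounded_linear[OF bounded_linear_Re int] by simp
  \<comment> \<open>Being the integral of a nonnegative function, this overlap is a nonnegative real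
    and equals its own modulus.\<close>
  moreover have "gauss_overlap (of_real (Re a)) (of_real (Re b)) (of_real (cmod c)) y y' = of_real I"
    using int unfolding I_def has_bochner_integral_iff integral_complex_of_real by metis
  moreover have "I \<ge> 0" unfolding I_def by simp
  moreover have "cmod (gauss_overlap (of_real (Re a)) (of_real (Re b)) (of_real (cmod c)) y y')
    = cmod (gauss_overlap (of_real (Re a)) (of_real (Re b)) c y y')"
    using assms by (simp add: norm_gauss_overlap)
  ultimately show ?thesis by simp
qed

lemma integrable_overlap_mult:
  assumes a: "Re a > 0" "\<bar>Re b\<bar> \<le> Re a" and f: "sq_integrable f"
  shows "integrable (lborel \<Otimes>\<^sub>M lborel) (\<lambda>(y, y'). gauss_overlap a b c y y' * (f y * cnj (f y')))" (is ?A)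
    and "(LINT p|(lborel \<Otimes>\<^sub>M lborel). cmod (case p of (y, y') \<Rightarrow> gauss_overlap a b c y y' * (f y * cnj (f y'))))
      \<le> (cmod c)\<^sup>2 * sqrt (pi / Re a) *
        sqrt (2 * pi / (overlap_diag a b + sqrt ((overlap_diag a b)\<^sup>2 - (overlap_off a b)\<^sup>2))) *
        (LINT y|lborel. (cmod (f y))\<^sup>2)" (is ?B)
proof -
  note [measurable] = sq_integrable_measurable[OF f]
  let ?C = "(cmod c)\<^sup>2 * sqrt (pi / Re a)"
  let ?k = "\<lambda>(y, y'). exp (- (overlap_diag a b * (y\<^sup>2 + y'\<^sup>2) / 2) + overlap_off a b * y * y') * (cmod (f y) * cmod (f y'))"
  have k: "cmod (case p of (y, y') \<Rightarrow> gauss_overlap a b c y y' * (f y * cnj (f y'))) = ?C * ?k p" for p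
    using a by (simp add: norm_mult norm_gauss_overlap split: prod.split)
  have f2: "(\<lambda>y. cmod (f y)) \<in> borel_measurable borel" "integrable lborel (\<lambda>y. (cmod (f y))\<^sup>2)"
    using f by (auto simp: sq_integrable_def)
  note S = schur_test_gauss[OF overlap_pos[OF a] refl f2]
  have ki: "integrable (lborel \<Otimes>\<^sub>M lborel) (\<lambda>p. ?C * ?k p)" using S(1) by simp
  show ?A
  proof (rule Bochner_Integration.integrable_bound[OF ki])
    show "AE p in lborel \<Otimes>\<^sub>M lborel. norm (case p of (y, y') \<Rightarrow> gauss_overlap a b c y y' * (f y * cnj (f y'))) \<le> norm (?C * ?k p)"
      unfolding k real_norm_def by (intro AE_I2 abs_ge_self)
  qed measurable
  have "?C \<ge> 0" using a by simp
  from mult_left_mono[OF S(2) this] show ?B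
    unfolding k by (simp add: mult.assoc)
qed

text \<open>|T f(x)|^2 is expanded into a double integral over (y, y'), and the integration over x
  is then carried out first. The same application of Fubini's theorem shows that T f is
  square-integrable.\<close>

lemma integral_norm_gauss_op:
  assumes a: "Re a > 0" "\<bar>Re b\<bar> \<le> Re a" and f: "sq_integrable f"
  shows "sq_integrable (gauss_op a b c f)" (is ?A)
    and "of_real (LINT x|lborel. (cmod (gauss_op a b c f x))\<^sup>2)
     = (LINT (y, y')|(lborel \<Otimes>\<^sub>M lborel). gauss_overlap a b c y y' * (f y * cnj (f y')))" (is ?B)
proof -
  note [measurable] = sq_integrable_measurable[OF f]
  let ?K = "gauss_kernel a b c"
  interpret PP: pair_sigma_finite "lborel \<Otimes>\<^sub>M lborel :: (real \<times> real) measure" "lborel :: real measure"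
    by (intro pair_sigma_finite.intro lborel_pair.P.sigma_finite_measure_axioms lborel.sigma_finite_measure_axioms)
  define H where "H = (\<lambda>(p, x). (?K x (fst p) * f (fst p)) * cnj (?K x (snd p) * f (snd p)))"
  have Hm [measurable]: "H \<in> borel_measurable ((lborel \<Otimes>\<^sub>M lborel) \<Otimes>\<^sub>M lborel)"
    unfolding H_def by measurable
  have Hp: "H (p, x) = (f (fst p) * cnj (f (snd p))) * (?K x (fst p) * cnj (?K x (snd p)))" for p x
    by (simp add: H_def)
  have Hx: "has_bochner_integral lborel (\<lambda>x. H (p, x)) (gauss_overlap a b c (fst p) (snd p) * (f (fst p) * cnj (f (snd p))))" for p
    unfolding Hp mult.commute[of "gauss_overlap a b c (fst p) (snd p)"]
    by (intro has_bochner_integral_mult_right has_integral_gauss_overlap a)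
  have Hi: "integrable ((lborel \<Otimes>\<^sub>M lborel) \<Otimes>\<^sub>M lborel) H"
  proof (rule PP.Fubini_integrable[OF Hm])
    \<comment> \<open>Absolute values replace a and b by their real parts. These satisfy the same
      two inequalities, so Schur's test covers them as well.\<close>
    have "(\<lambda>p. LINT x|lborel. norm (H (p, x))) = (\<lambda>p. cmod (case p of (y, y') \<Rightarrow>
        gauss_overlap (of_real (Re a)) (of_real (Re b)) c y y' * (f y * cnj (f y'))))"
    proof
      fix p :: "real \<times> real"
      have "(LINT x|lborel. norm (H (p, x))) = (LINT x|lborel. cmod (f (fst p) * f (snd p)) * (cmod (?K x (fst p)) * cmod (?K x (snd p))))"
        by (simp add: Hp norm_mult mult_ac)
      also have "\<dots> = cmod (f (fst p) * f (snd p)) * cmod (gauss_overlap (of_real (Re a)) (of_real (Re b)) c (fst p) (snd p))"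
        using integral_norm_gauss_kernel_mult[OF a(1), of b c "fst p" "snd p"]
        by (simp add: has_bochner_integral_iff)
      finally show "(LINT x|lborel. norm (H (p, x))) = cmod (case p of (y, y') \<Rightarrow>
        gauss_overlap (of_real (Re a)) (of_real (Re b)) c y y' * (f y * cnj (f y')))"
        by (simp add: norm_mult split: prod.split)
    qed
    then show "integrable (lborel \<Otimes>\<^sub>M lborel) (\<lambda>p. LINT x|lborel. norm (H (p, x)))"
      using integrable_norm[OF integrable_overlap_mult(1)[of "of_real (Re a)" "of_real (Re b)" f c]] a f by simp
  qed (use Hx in \<open>auto simp: has_bochner_integral_iff\<close>)
  have prod: "(LINT p|(lborel \<Otimes>\<^sub>M lborel). H (p, x)) = of_real ((cmod (gauss_op a b c f x))\<^sup>2)" for x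
  proof -
    let ?g = "\<lambda>y. ?K x y * f y"
    have g: "integrable lborel ?g" by (rule integrable_gauss_kernel_mult[OF a(1) f])
    have "integrable (lborel \<Otimes>\<^sub>M lborel) (\<lambda>(y, y'). ?g y * cnj (?g y'))"
    proof (rule lborel_pair.Fubini_integrable)
      show "integrable lborel (\<lambda>y. LINT y'|lborel. norm (case (y, y') of (y, y') \<Rightarrow> ?g y * cnj (?g y')))"
        using integrable_norm[OF g] by (simp add: norm_mult)
      show "AE y in lborel. integrable lborel (\<lambda>y'. case (y, y') of (y, y') \<Rightarrow> ?g y * cnj (?g y'))"
        using g by (simp del: complex_cnj_mult)
    qed measurable
    from lborel_pair.integral_fst'[OF this]
    have "(LINT p|(lborel \<Otimes>\<^sub>M lborel). H (p, x)) = (LINT y|lborel. LINT y'|lborel. ?g y * cnj (?g y'))"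
      by (simp add: H_def case_prod_unfold)
    also have "\<dots> = gauss_op a b c f x * cnj (gauss_op a b c f x)"
      by (simp add: gauss_op_def del: complex_cnj_mult)
    finally show ?thesis by (simp only: complex_norm_square)
  qed
  have "integrable lborel (\<lambda>x. LINT p|(lborel \<Otimes>\<^sub>M lborel). H (p, x))"
    using PP.integrable_snd[of "\<lambda>p x. H (p, x)"] Hi by simp
  then have "integrable lborel (\<lambda>x. complex_of_real ((cmod (gauss_op a b c f x))\<^sup>2))"
    by (simp only: prod)
  from integrable_Re[OF this] show ?A
    using borel_measurable_gauss_op[OF f] by (simp add: sq_integrable_def)
  have "of_real (LINT x|lborel. (cmod (gauss_op a b c f x))\<^sup>2) = (LINT x|lborel. LINT p|(lborel \<Otimes>\<^sub>M lborel). H (p, x))"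
    unfolding prod by (rule integral_complex_of_real[symmetric])
  also have "\<dots> = (LINT p|(lborel \<Otimes>\<^sub>M lborel). LINT x|lborel. H (p, x))"
    using PP.Fubini_integral[of "\<lambda>p x. H (p, x)"] Hi by simp
  also have "\<dots> = (LINT (y, y')|(lborel \<Otimes>\<^sub>M lborel). gauss_overlap a b c y y' * (f y * cnj (f y')))"
    using Hx by (simp add: has_bochner_integral_iff case_prod_unfold)
  finally show ?B .
qed

lemma gauss_op_norm_le:
  assumes a: "Re a > 0" "\<bar>Re b\<bar> \<le> Re a" and f: "sq_integrable f"
  shows "(LINT x|lborel. (cmod (gauss_op a b c f x))\<^sup>2) \<le> (cmod c)\<^sup>2 * sqrt (pi / Re a) *
        sqrt (2 * pi / (overlap_diag a b + sqrt ((overlap_diag a b)\<^sup>2 - (overlap_off a b)\<^sup>2))) *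
        (LINT y|lborel. (cmod (f y))\<^sup>2)"
proof -
  have "(LINT x|lborel. (cmod (gauss_op a b c f x))\<^sup>2) = cmod (of_real (LINT x|lborel. (cmod (gauss_op a b c f x))\<^sup>2))"
    by simp
  also have "\<dots> \<le> (LINT p|(lborel \<Otimes>\<^sub>M lborel). cmod (case p of (y, y') \<Rightarrow> gauss_overlap a b c y y' * (f y * cnj (f y'))))"
    unfolding integral_norm_gauss_op(2)[OF assms] by (rule integral_norm_bound)
  also note integrable_overlap_mult(2)[OF assms]
  finally show ?thesis .
qed

text \<open>
  The imaginary part of the exponent of the test function cancels the phase of the overlap kernel,
  so that both sides are real Gaussian integrals.
\<close>
lemma gauss_op_norm_ge:
  assumes a: "Re a > 0" "\<bar>Re b\<bar> \<le> Re a"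
    and \<epsilon>: "\<epsilon> > sqrt ((overlap_diag a b)\<^sup>2 - (overlap_off a b)\<^sup>2)"
  obtains f where "sq_integrable f" "(LINT y|lborel. (cmod (f y))\<^sup>2) > 0"
    "(LINT x|lborel. (cmod (gauss_op a b c f x))\<^sup>2) \<ge> (cmod c)\<^sup>2 * sqrt (pi / Re a) *
        sqrt (2 * pi / (overlap_diag a b + \<epsilon>)) * (LINT y|lborel. (cmod (f y))\<^sup>2)"
proof -
  define P Q where "P = overlap_diag a b" and "Q = overlap_off a b"
  have PQ: "P > 0" "\<bar>Q\<bar> \<le> P" using overlap_pos[OF a] by (simp_all add: P_def Q_def)
  then have Q2: "Q\<^sup>2 \<le> P\<^sup>2" by (auto simp: abs_le_square_iff[symmetric])
  then have w0: "sqrt (P\<^sup>2 - Q\<^sup>2) \<ge> 0" by simp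
  have e0: "\<epsilon> > 0" using \<epsilon> w0 unfolding P_def Q_def by linarith
  have "(sqrt (P\<^sup>2 - Q\<^sup>2))\<^sup>2 \<le> \<epsilon>\<^sup>2"
    using \<epsilon> w0 unfolding P_def Q_def by (intro power_mono) auto
  then have e2: "P\<^sup>2 - Q\<^sup>2 \<le> \<epsilon>\<^sup>2" using Q2 by simp
  let ?R = "P + \<epsilon>"
  let ?C = "(cmod c)\<^sup>2 * sqrt (pi / Re a)"
  define v where "v = Complex \<epsilon> (Im (b\<^sup>2) / (2 * Re a) - Im a)"
  define f where "f = gauss_exp v 0"
  have f: "sq_integrable f" using e0 by (auto simp: f_def v_def intro!: sq_integrable_gauss_exp)
  have f2: "(cmod (f y))\<^sup>2 = exp (- (2 * \<epsilon> * y\<^sup>2 / 2) + 0 * y)" for y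
    by (simp add: f_def norm_gauss_exp v_def power2_eq_square flip: exp_add)
  have nf: "(LINT y|lborel. (cmod (f y))\<^sup>2) = sqrt (pi / \<epsilon>)"
    unfolding f2 using has_integral_gauss_real[of "2 * \<epsilon>" 0] e0 by (simp add: has_bochner_integral_iff)
  have ov: "gauss_overlap a b c y y' * (f y * cnj (f y'))
    = of_real (?C * exp (- (?R * y\<^sup>2 / 2)) * exp (- (?R * y'\<^sup>2 / 2) + (Q * y) * y'))" for y y'
  proof -
    have "Im ((b * of_real y + cnj b * of_real y')\<^sup>2) = Im (b\<^sup>2) * (y\<^sup>2 - y'\<^sup>2)"
      by (simp add: power2_eq_square algebra_simps)
    then have im: "Im ((b * of_real y + cnj b * of_real y')\<^sup>2 / (4 * of_real (Re a))) = Im (b\<^sup>2) * (y\<^sup>2 - y'\<^sup>2) / (4 * Re a)"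
      using Im_divide_of_real[of "(b * of_real y + cnj b * of_real y')\<^sup>2" "4 * Re a"] by simp
    have "Re ((b * of_real y + cnj b * of_real y')\<^sup>2) = Re (b\<^sup>2) * (y\<^sup>2 + y'\<^sup>2) + 2 * (cmod b)\<^sup>2 * y * y'"
      unfolding cmod_power2 by (simp add: power2_eq_square algebra_simps)
    then have re: "Re ((b * of_real y + cnj b * of_real y')\<^sup>2 / (4 * of_real (Re a)))
       = (Re (b\<^sup>2) * (y\<^sup>2 + y'\<^sup>2) + 2 * (cmod b)\<^sup>2 * y * y') / (4 * Re a)"
      using Re_divide_of_real[of "(b * of_real y + cnj b * of_real y')\<^sup>2" "4 * Re a"] by simp
    define z where "z = (b * of_real y + cnj b * of_real y')\<^sup>2 / (4 * of_real (Re a))"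
    note re = re[folded z_def] and im = im[folded z_def]
    have "- (a * (of_real y)\<^sup>2 / 2) + - (cnj a * (of_real y')\<^sup>2 / 2) + z +
        (- (v * (of_real y)\<^sup>2 / 2) + - (cnj v * (of_real y')\<^sup>2 / 2))
      = of_real (- (?R * y\<^sup>2 / 2) + (- (?R * y'\<^sup>2 / 2) + (Q * y) * y'))"
      using a(1)
      by (simp add: complex_eq_iff re im v_def P_def Q_def overlap_diag_def overlap_off_def field_simps
           del: Re_power2 Im_power2 flip: of_real_power)
    then have "exp (- (a * (of_real y)\<^sup>2 / 2) + - (cnj a * (of_real y')\<^sup>2 / 2) + z +
        (- (v * (of_real y)\<^sup>2 / 2) + - (cnj v * (of_real y')\<^sup>2 / 2)))
      = of_real (exp (- (?R * y\<^sup>2 / 2) + (- (?R * y'\<^sup>2 / 2) + (Q * y) * y')))"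
      by (simp only: exp_of_real)
    then show ?thesis
      unfolding f_def cnj_gauss_exp unfolding exp_add gauss_overlap_def z_def gauss_exp_def of_real_mult
      by (simp add: mult.assoc)
  qed
  have R: "?R > 0" using PQ e0 by simp
  have RQ: "?R\<^sup>2 - Q\<^sup>2 > 0"
  proof -
    have "?R\<^sup>2 - Q\<^sup>2 = (P\<^sup>2 - Q\<^sup>2) + (2 * P * \<epsilon> + \<epsilon>\<^sup>2)" by (simp add: power2_sum)
    moreover have "2 * P * \<epsilon> + \<epsilon>\<^sup>2 > 0" using PQ e0 by (simp add: add_pos_pos)
    ultimately show ?thesis using Q2 by linarith
  qed
  \<comment> \<open>The quadratic coefficient left in y after the integration over y' has
    contributed Q^2 / (P + \<epsilon>).\<close>
  define T where "T = ?R - Q\<^sup>2 / ?R"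
  have T: "T > 0" "?R * T = ?R\<^sup>2 - Q\<^sup>2" using R RQ by (simp_all add: T_def field_simps power2_eq_square)
  have inner: "(LINT y'|lborel. of_real (?C * exp (- (?R * y\<^sup>2 / 2)) * exp (- (?R * y'\<^sup>2 / 2) + (Q * y) * y')))
     = complex_of_real (?C * sqrt (2 * pi / ?R) * exp (- (T * y\<^sup>2 / 2) + 0 * y))" for y
  proof -
    have "(LINT y'|lborel. ?C * exp (- (?R * y\<^sup>2 / 2)) * exp (- (?R * y'\<^sup>2 / 2) + (Q * y) * y'))
      = ?C * exp (- (?R * y\<^sup>2 / 2)) * (sqrt (2 * pi / ?R) * exp ((Q * y)\<^sup>2 / (2 * ?R)))"
      using has_bochner_integral_mult_right[OF has_integral_gauss_real[OF R, of "Q * y"], of "?C * exp (- (?R * y\<^sup>2 / 2))"]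
      by (simp only: has_bochner_integral_iff)
    also have "\<dots> = ?C * sqrt (2 * pi / ?R) * exp (- (?R * y\<^sup>2 / 2) + (Q * y)\<^sup>2 / (2 * ?R))"
      unfolding exp_add by (simp only: mult_ac)
    also have "- (?R * y\<^sup>2 / 2) + (Q * y)\<^sup>2 / (2 * ?R) = - (T * y\<^sup>2 / 2) + 0 * y"
      using R by (simp add: T_def field_simps power2_eq_square)
    finally show ?thesis by (simp only: integral_complex_of_real)
  qed
  have "complex_of_real (LINT x|lborel. (cmod (gauss_op a b c f x))\<^sup>2)
    = (LINT y|lborel. LINT y'|lborel. gauss_overlap a b c y y' * (f y * cnj (f y')))"
    unfolding integral_norm_gauss_op(2)[OF a f]
    using lborel_pair.integral_fst'[OF integrable_overlap_mult(1)[OF a f]] by simp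
  also have "\<dots> = complex_of_real (LINT y|lborel. ?C * sqrt (2 * pi / ?R) * exp (- (T * y\<^sup>2 / 2) + 0 * y))"
    unfolding ov inner by (rule integral_complex_of_real)
  also have "(LINT y|lborel. ?C * sqrt (2 * pi / ?R) * exp (- (T * y\<^sup>2 / 2) + 0 * y)) = ?C * sqrt (2 * pi / ?R) * sqrt (2 * pi / T)"
    using has_bochner_integral_mult_right[OF has_integral_gauss_real[OF T(1), of 0], of "?C * sqrt (2 * pi / ?R)"]
    by (simp add: has_bochner_integral_iff)
  finally have eq: "(LINT x|lborel. (cmod (gauss_op a b c f x))\<^sup>2) = ?C * sqrt (2 * pi / ?R) * sqrt (2 * pi / T)"
    by (simp only: of_real_eq_iff)
  \<comment> \<open>Multiplied by P + \<epsilon>, this reads P^2 - Q^2 \<le> \<epsilon>^2, the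
    condition on \<epsilon>. It compares the exact value of the integral with the norm of f.\<close>
  have "T \<le> 2 * \<epsilon>"
  proof -
    have "?R * T \<le> ?R * (2 * \<epsilon>)" unfolding T(2) using e2 by (simp add: power2_sum algebra_simps power2_eq_square)
    then show ?thesis using R by simp
  qed
  then have "pi / \<epsilon> \<le> 2 * pi / T" using T(1) e0 by (simp add: field_simps)
  then have "sqrt (pi / \<epsilon>) \<le> sqrt (2 * pi / T)" by simp
  then have "?C * sqrt (2 * pi / ?R) * sqrt (pi / \<epsilon>) \<le> ?C * sqrt (2 * pi / ?R) * sqrt (2 * pi / T)"
    using a R by (intro mult_left_mono) auto
  then show thesis
    using that[of f] f nf eq e0 by (simp add: P_def)
qed

section \<open>The operator induced on classes and its norm\<close>

definition gauss_L2 :: "complex \<Rightarrow> complex \<Rightarrow> complex \<Rightarrow> L2 \<Rightarrow> L2" where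
  "gauss_L2 a b c F = abs_L2 (gauss_op a b c (rep_L2 F))"

text \<open>Functions that agree almost everywhere have the same kernel integral at every x.\<close>

lemma gauss_L2_abs:
  assumes "sq_integrable f"
  shows "gauss_L2 a b c (abs_L2 f) = abs_L2 (gauss_op a b c f)"
proof -
  let ?g = "rep_L2 (abs_L2 f)"
  have ae: "AE y in lborel. ?g y = f y"
    using abs_L2_eq_iff[OF sq_integrable_rep_L2 assms] abs_rep_L2 by blast
  note [measurable] = sq_integrable_measurable[OF assms] sq_integrable_measurable[OF sq_integrable_rep_L2]
  have "gauss_op a b c ?g x = gauss_op a b c f x" for x
    unfolding gauss_op_def
    by (rule integral_cong_AE) (measurable, use ae in \<open>auto elim: AE_mp\<close>)
  then have "gauss_op a b c ?g = gauss_op a b c f" by blast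
  then show ?thesis by (simp add: gauss_L2_def)
qed

text \<open>At \<epsilon> = sqrt (P^2 - Q^2) this is Schur's bound for the squared norm; at a larger
  \<epsilon> it is the lower bound from the test function whose exponent has real part -\<epsilon>
  y^2 / 2.\<close>

definition gauss_norm_sq :: "complex \<Rightarrow> complex \<Rightarrow> complex \<Rightarrow> real \<Rightarrow> real" where
  "gauss_norm_sq a b c \<epsilon> = (cmod c)\<^sup>2 * sqrt (pi / Re a) * sqrt (2 * pi / (overlap_diag a b + \<epsilon>))"

context
  fixes a b c :: complex
  assumes a: "Re a > 0" "\<bar>Re b\<bar> \<le> Re a"
begin

lemma gauss_L2_add: "gauss_L2 a b c (F + G) = gauss_L2 a b c F + gauss_L2 a b c G"
proof (rule L2_cases[of F], rule L2_cases[of G])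
  fix f g assume f: "sq_integrable f" "F = abs_L2 f" and g: "sq_integrable g" "G = abs_L2 g"
  have "gauss_op a b c (\<lambda>x. f x + g x) = (\<lambda>x. gauss_op a b c f x + gauss_op a b c g x)"
    using integrable_gauss_kernel_mult[OF a(1) f(1)] integrable_gauss_kernel_mult[OF a(1) g(1)]
    by (simp add: gauss_op_def distrib_left fun_eq_iff)
  then show ?thesis
    using f g integral_norm_gauss_op(1)[OF a]
    by (simp add: abs_L2_add gauss_L2_abs sq_integrable_add)
qed

lemma gauss_L2_scaleC: "gauss_L2 a b c (z \<cdot>\<^sub>C F) = z \<cdot>\<^sub>C gauss_L2 a b c F"
proof (rule L2_cases[of F])
  fix f assume f: "sq_integrable f" "F = abs_L2 f"
  have "gauss_op a b c (\<lambda>x. z * f x) = (\<lambda>x. z * gauss_op a b c f x)"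
    by (simp add: gauss_op_def fun_eq_iff mult.left_commute)
  then show ?thesis
    using f integral_norm_gauss_op(1)[OF a]
    by (simp add: abs_L2_scaleC gauss_L2_abs sq_integrable_cmult)
qed

lemma norm_gauss_L2_le:
  "norm (gauss_L2 a b c F) \<le> sqrt (gauss_norm_sq a b c (sqrt ((overlap_diag a b)\<^sup>2 - (overlap_off a b)\<^sup>2))) * norm F"
proof (rule L2_cases[of F])
  fix f assume f: "sq_integrable f" "F = abs_L2 f"
  show ?thesis
    using gauss_op_norm_le[OF a f(1), of c] unfolding f(2)
    by (simp add: gauss_L2_abs norm_abs_L2 f(1) integral_norm_gauss_op(1)[OF a] gauss_norm_sq_def flip: real_sqrt_mult)
qed

lemma bounded_operator_gauss_L2: "bounded_operator (gauss_L2 a b c)"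
  unfolding bounded_operator_def
proof (intro conjI allI)
  show "bounded_linear (gauss_L2 a b c)"
    by (rule bounded_linear_intro[OF gauss_L2_add])
      (auto simp: scaleR_L2_eq_scaleC gauss_L2_scaleC mult.commute intro!: norm_gauss_L2_le)
qed (rule gauss_L2_scaleC)

lemma onorm_gauss_L2:
  "onorm (gauss_L2 a b c) = sqrt (gauss_norm_sq a b c (sqrt ((overlap_diag a b)\<^sup>2 - (overlap_off a b)\<^sup>2)))"
proof (rule antisym)
  let ?w = "sqrt ((overlap_diag a b)\<^sup>2 - (overlap_off a b)\<^sup>2)"
  have PQ: "overlap_diag a b > 0" "\<bar>overlap_off a b\<bar> \<le> overlap_diag a b" by (rule overlap_pos[OF a])+
  then have "?w \<ge> 0" by (auto simp: abs_le_square_iff[symmetric])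
  then have pos: "overlap_diag a b + ?w > 0" using PQ by linarith
  show "onorm (gauss_L2 a b c) \<le> sqrt (gauss_norm_sq a b c ?w)"
    using a pos by (intro onorm_bound norm_gauss_L2_le) (simp add: gauss_norm_sq_def)
  have lower: "sqrt (gauss_norm_sq a b c \<epsilon>) \<le> onorm (gauss_L2 a b c)" if e: "\<epsilon> > ?w" for \<epsilon>
  proof -
    obtain f where f: "sq_integrable f" "(LINT y|lborel. (cmod (f y))\<^sup>2) > 0"
      "(LINT x|lborel. (cmod (gauss_op a b c f x))\<^sup>2) \<ge> gauss_norm_sq a b c \<epsilon> * (LINT y|lborel. (cmod (f y))\<^sup>2)"
      using gauss_op_norm_ge[OF a e, of c] unfolding gauss_norm_sq_def by blast
    have "sqrt (gauss_norm_sq a b c \<epsilon>) * norm (abs_L2 f) \<le> norm (gauss_L2 a b c (abs_L2 f))"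
      using f(3) by (simp add: gauss_L2_abs norm_abs_L2 f(1) integral_norm_gauss_op(1)[OF a] flip: real_sqrt_mult)
    also have "\<dots> \<le> onorm (gauss_L2 a b c) * norm (abs_L2 f)"
      using bounded_operator_gauss_L2 by (intro onorm) (simp add: bounded_operator_def)
    finally show ?thesis using f(1,2) by (simp add: norm_abs_L2)
  qed
  \<comment> \<open>The lower bounds hold for \<epsilon> strictly above \<open>?w\<close>, where the
    test function decays even if \<open>?w\<close> is 0. The formula is continuous at
    \<open>?w\<close> because P + \<open>?w\<close> is positive.\<close>
  have "((\<lambda>\<epsilon>. sqrt (gauss_norm_sq a b c \<epsilon>)) \<longlongrightarrow> sqrt (gauss_norm_sq a b c ?w)) (at_right ?w)"
    unfolding gauss_norm_sq_def using pos by (intro tendsto_intros) auto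
  then show "sqrt (gauss_norm_sq a b c ?w) \<le> onorm (gauss_L2 a b c)"
    by (rule tendsto_upperbound) (use lower in \<open>auto intro!: eventually_at_rightI[of _ "?w + 1"]\<close>)
qed

end

section \<open>Uniqueness of the Hermite functions\<close>

definition std_hermite :: "nat \<Rightarrow> complex \<Rightarrow> complex" where
  "std_hermite k z = poly (hermite_poly k) z * exp (- (z\<^sup>2 / 2))"

lemma hermite_function_std: "hermite_function k (std_hermite k)"
  unfolding std_hermite_def[abs_def] by (rule hermite_function_exists)

lemma deriv_std_hermite:
  "deriv (std_hermite k) z = poly (pderiv (hermite_poly k) - [:0, 1:] * hermite_poly k) z * exp (- (z\<^sup>2 / 2))"
  unfolding std_hermite_def[abs_def]
  by (rule DERIV_imp_deriv) (rule derivative_eq_intros poly_DERIV refl | simp add: algebra_simps)+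

lemma sq_integrable_deriv_std_hermite: "sq_integrable (\<lambda>x. deriv (std_hermite k) (of_real x))"
  using sq_integrable_poly_gauss[of 1 "pderiv (hermite_poly k) - [:0, 1:] * hermite_poly k"]
  by (simp only: deriv_std_hermite) simp

lemma norm_integral_interval_le:
  fixes f :: "real \<Rightarrow> complex"
  assumes "integrable lborel f"
  shows "cmod (LINT x|lborel. indicator {0..R} x *\<^sub>R f x) \<le> (LINT x|lborel. cmod (f x))"
proof -
  have "cmod (LINT x|lborel. indicator {0..R} x *\<^sub>R f x) \<le> (LINT x|lborel. norm (indicator {0..R} x *\<^sub>R f x))"
    by (rule integral_norm_bound)
  also have "\<dots> \<le> (LINT x|lborel. cmod (f x))"
  proof (rule integral_mono)
    show "integrable lborel (\<lambda>x. norm (indicator {0..R} x *\<^sub>R f x))"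
      using assms by (intro integrable_norm integrable_mult_indicator) auto
  qed (use assms in \<open>auto simp: indicator_def\<close>)
  finally show ?thesis .
qed

text \<open>
  The Wronskian $W = h g' - h' g$ is constant, and integrating it over $[0, R]$ gives
  $W R = 2 \int_0^R h g' - [h g]_0^R$. The integral is bounded in $R$ and $h g$ is
  integrable, which forces $W = 0$.
\<close>
lemma wronskian_zero:
  assumes h: "h holomorphic_on UNIV" "sq_integrable (\<lambda>x. h (of_real x))"
    and g: "g holomorphic_on UNIV" "sq_integrable (\<lambda>x. g (of_real x))"
      "sq_integrable (\<lambda>x. deriv g (of_real x))"
    and W: "\<And>z. h z * deriv g z - deriv h z * g z = W"
  shows "W = 0"
proof (rule ccontr)
  assume W0: "W \<noteq> 0"
  let ?hg = "\<lambda>x::real. h (of_real x) * g (of_real x)"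
  let ?hg' = "\<lambda>x::real. h (of_real x) * deriv g (of_real x)"
  \<comment> \<open>Bounds, uniformly in R, every term of the integrated identity except W R and the
    value of h g at R.\<close>
  define D where "D = 2 * (LINT x|lborel. cmod (?hg' x)) + cmod (?hg 0)"
  have i1: "integrable lborel ?hg'" by (rule integrable_mult_sq_integrable[OF h(2) g(3)])
  have i2: "integrable lborel ?hg" by (rule integrable_mult_sq_integrable[OF h(2) g(2)])
  have hd: "(h has_field_derivative deriv h z) (at z)" "(g has_field_derivative deriv g z) (at z)" for z
    using h g by (auto intro!: holomorphic_derivI[where S = UNIV])
  have lower: "cmod W * R - D \<le> cmod (?hg R)" if "R \<ge> 0" for R
  proof -
    \<comment> \<open>As W = h g' - h' g, adding x W to h g turns the derivative h' g + h g' into 2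
      h g'.\<close>
    have vd: "((\<lambda>x. ?hg x + of_real x * W) has_vector_derivative 2 * ?hg' x) (at x within {0..R})" for x
    proof -
      have "((\<lambda>z. h z * g z + z * W) has_field_derivative
          (deriv h (of_real x) * g (of_real x) + deriv g (of_real x) * h (of_real x)) + W) (at (of_real x))"
        by (rule derivative_eq_intros hd refl | simp)+
      moreover have "(deriv h (of_real x) * g (of_real x) + deriv g (of_real x) * h (of_real x)) + W = 2 * ?hg' x"
        unfolding W[of "of_real x", symmetric] by (simp add: algebra_simps)
      moreover have "(of_real has_vector_derivative (1::complex)) (at x)"
        by (auto intro!: derivative_eq_intros)
      ultimately have "((\<lambda>x. ?hg x + of_real x * W) has_vector_derivative 2 * ?hg' x) (at x)"
        using field_vector_diff_chain_at[of complex_of_real 1 x "\<lambda>z. h z * g z + z * W" "2 * ?hg' x"]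
        by (simp add: o_def)
      then show ?thesis by (rule has_vector_derivative_at_within)
    qed
    have c: "continuous_on UNIV (deriv g)" "continuous_on UNIV h"
      using g h by (auto intro!: holomorphic_on_imp_continuous_on holomorphic_deriv)
    have "continuous_on {0..R} (\<lambda>x. 2 * ?hg' x)"
      by (intro continuous_on_mult continuous_on_const continuous_on_compose2[OF c(1)] continuous_on_compose2[OF c(2)]
          continuous_on_of_real continuous_on_id) auto
    from integral_FTC_atLeastAtMost[OF that vd this]
    have 1: "(LINT x|lborel. indicator {0..R} x *\<^sub>R (2 * ?hg' x)) = (?hg R + of_real R * W) - (?hg 0 + of_real 0 * W)" .
    have "(LINT x|lborel. indicator {0..R} x *\<^sub>R (2 * ?hg' x)) = (LINT x|lborel. 2 * (indicator {0..R} x *\<^sub>R ?hg' x))"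
      by (simp add: scaleR_conv_of_real mult.left_commute)
    then have 2: "(LINT x|lborel. indicator {0..R} x *\<^sub>R (2 * ?hg' x)) = 2 * (LINT x|lborel. indicator {0..R} x *\<^sub>R ?hg' x)"
      by (simp only: integral_mult_right_zero)
    have "J = (p + q) - (r + of_real 0 * W) \<Longrightarrow> J = 2 * I \<Longrightarrow> q = 2 * I + r - p" for J p q r I :: complex
      by simp
    from this[OF 1 2] have eq: "of_real R * W = 2 * (LINT x|lborel. indicator {0..R} x *\<^sub>R ?hg' x) + ?hg 0 - ?hg R" .
    have "R * cmod W = cmod (2 * (LINT x|lborel. indicator {0..R} x *\<^sub>R ?hg' x) + ?hg 0 - ?hg R)"
      unfolding eq[symmetric] using that by (simp add: norm_mult)
    also have "\<dots> \<le> 2 * cmod (LINT x|lborel. indicator {0..R} x *\<^sub>R ?hg' x) + cmod (?hg 0) + cmod (?hg R)"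
      using norm_triangle_ineq4[of "2 * (LINT x|lborel. indicator {0..R} x *\<^sub>R ?hg' x) + ?hg 0" "?hg R"]
        norm_triangle_ineq[of "2 * (LINT x|lborel. indicator {0..R} x *\<^sub>R ?hg' x)" "?hg 0"]
      by (simp add: norm_mult)
    also have "\<dots> \<le> D + cmod (?hg R)"
      using norm_integral_interval_le[OF i1, of R] unfolding D_def by linarith
    finally show ?thesis by (simp add: mult.commute)
  qed
  \<comment> \<open>From \<open>R0\<close> on, |h g| is at least 1, so its integral is at least the
    length of any interval beyond \<open>R0\<close>.\<close>
  define R0 where "R0 = (D + 1) / cmod W"
  have D0: "D \<ge> 0" unfolding D_def by simp
  then have R0: "R0 \<ge> 0" by (simp add: R0_def)
  have one: "1 \<le> cmod (?hg R)" if "R \<ge> R0" for R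
  proof -
    have "D + 1 \<le> cmod W * R" using that W0 by (simp add: R0_def field_simps)
    then show ?thesis using lower[of R] R0 that by linarith
  qed
  have le: "n \<le> (LINT x|lborel. cmod (?hg x))" if "n \<ge> 0" for n :: real
  proof -
    have "(LINT x|lborel. indicator {R0..R0 + n} x) \<le> (LINT x|lborel. cmod (?hg x))"
    proof (rule integral_mono)
      show "integrable lborel (indicator {R0..R0 + n} :: real \<Rightarrow> real)"
        by (rule integrable_real_indicator) (simp_all add: emeasure_lborel_Icc_eq)
      show "integrable lborel (\<lambda>x. cmod (?hg x))" using i2 by (rule integrable_norm)
      show "indicator {R0..R0 + n} x \<le> cmod (?hg x)" for x
        using one[of x] by (cases "x \<in> {R0..R0 + n}") auto
    qed
    then show ?thesis using that by simp
  qed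
  have "(LINT x|lborel. cmod (?hg x)) \<ge> 0"
    by (rule Bochner_Integration.integral_nonneg) simp
  then show False using le[of "(LINT x|lborel. cmod (?hg x)) + 1"] by linarith
qed

text \<open>Needed because the theorem admits any choice of Hermite functions. By the common
  equation the Wronskian with \<open>std_hermite k\<close> is constant, hence 0 by square
  integrability, and then the quotient has derivative 0.\<close>

lemma hermite_function_unique:
  assumes "hermite_function k h"
  obtains d where "d \<noteq> 0" "h = (\<lambda>z. d * std_hermite k z)"
proof -
  let ?g = "std_hermite k"
  have h: "h holomorphic_on UNIV" "sq_integrable (\<lambda>x. h (of_real x))" "\<exists>x::real. h (of_real x) \<noteq> 0"
    and g: "?g holomorphic_on UNIV" "sq_integrable (\<lambda>x. ?g (of_real x))" "\<exists>x::real. ?g (of_real x) \<noteq> 0"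
    using assms hermite_function_std[of k] by (auto simp: hermite_function_def)
  have hd: "(h has_field_derivative deriv h z) (at z)" "(?g has_field_derivative deriv ?g z) (at z)"
    "(deriv h has_field_derivative deriv (deriv h) z) (at z)"
    "(deriv ?g has_field_derivative deriv (deriv ?g) z) (at z)" for z
    using h(1) g(1) by (auto intro!: holomorphic_derivI[where S = UNIV] holomorphic_deriv)
  let ?W = "\<lambda>z. h z * deriv ?g z - deriv h z * ?g z"
  have "(?W has_field_derivative 0) (at z)" for z
  proof -
    have "deriv (deriv h) z = (z\<^sup>2 - of_real (1 + 2 * real k)) * h z"
      "deriv (deriv ?g) z = (z\<^sup>2 - of_real (1 + 2 * real k)) * ?g z"
      using hermite_function_ode[OF assms, of z] hermite_function_ode[OF hermite_function_std, of k z]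
      by (auto simp: algebra_simps)
    then have "h z * deriv (deriv ?g) z = deriv (deriv h) z * ?g z" by simp
    then show ?thesis
      by (auto intro!: derivative_eq_intros hd simp: algebra_simps)
  qed
  then have "\<exists>W. \<forall>z\<in>UNIV. ?W z = W"
    by (intro has_field_derivative_zero_constant[OF convex_UNIV]) simp
  then obtain W where W: "\<And>z. ?W z = W" by blast
  have "W = 0"
    by (rule wronskian_zero[OF h(1,2) g(1,2) sq_integrable_deriv_std_hermite W])
  then have W: "h z * deriv ?g z = deriv h z * ?g z" for z using W[of z] by simp
  obtain z0 where z0: "?g z0 \<noteq> 0" using g(3) by auto
  have "continuous (at z0) ?g" using hd(2) by (rule DERIV_isCont)
  \<comment> \<open>The quotient is formed only on a ball free of zeros of
    \<open>std_hermite k\<close>; analytic continuation extends the resulting identity.\<close>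
  then obtain e where e: "e > 0" "\<And>z. dist z z0 < e \<Longrightarrow> ?g z \<noteq> 0"
    using continuous_at_avoid[of z0 ?g 0] z0 by (metis dist_commute)
  define d where "d = h z0 / ?g z0"
  have const: "h z / ?g z = d" if "z \<in> ball z0 e" for z
  proof -
    have "((\<lambda>z. h z / ?g z) has_field_derivative 0) (at z within ball z0 e)" if "z \<in> ball z0 e" for z
    proof -
      have "?g z \<noteq> 0" using e that by (simp add: dist_commute)
      then have "((\<lambda>z. h z / ?g z) has_field_derivative 0) (at z)"
        using W[of z] by (auto intro!: derivative_eq_intros hd simp: mult.commute)
      then show ?thesis by (rule has_field_derivative_at_within)
    qed
    then have "\<exists>c. \<forall>z\<in>ball z0 e. h z / ?g z = c"
      by (rule has_field_derivative_zero_constant[OF convex_ball])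
    then show ?thesis using that e(1) by (metis centre_in_ball d_def)
  qed
  have eq: "h z = d * ?g z" for z
  proof -
    have "h z - d * ?g z = 0"
    proof (rule analytic_continuation[of "\<lambda>z. h z - d * ?g z" UNIV "ball z0 e" z0])
      show "(\<lambda>z. h z - d * ?g z) holomorphic_on UNIV" using h g by (intro holomorphic_intros)
      show "z0 islimpt ball z0 e" using e(1) by (simp add: islimpt_ball)
      fix z assume z: "z \<in> ball z0 e"
      then have "?g z \<noteq> 0" using e by (simp add: dist_commute)
      then show "h z - d * ?g z = 0" using const[OF z] by (simp add: field_simps)
    qed auto
    then show ?thesis by simp
  qed
  moreover have "d \<noteq> 0" using h(3) eq by auto
  ultimately show thesis using that[of d] by blast
qed

section \<open>Density of the span of the rotated Hermite functions\<close>

text \<open>Density is proved in the form V = \<open>UNIV\<close>; V will be the closure of the span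
  of the rotated Hermite functions.\<close>

locale closed_complex_subspace =
  fixes V :: "L2 set"
  assumes closed: "closed V"
    and zero_mem: "0 \<in> V"
    and add_mem: "F \<in> V \<Longrightarrow> G \<in> V \<Longrightarrow> F + G \<in> V"
    and scaleC_mem: "F \<in> V \<Longrightarrow> c \<cdot>\<^sub>C F \<in> V"
begin

text \<open>Products and pointwise limits live on functions rather than classes, so membership in V
  is tracked on representatives.\<close>

definition rep :: "(real \<Rightarrow> complex) \<Rightarrow> bool" where
  "rep f \<longleftrightarrow> sq_integrable f \<and> abs_L2 f \<in> V"

lemma rep_zero: "rep (\<lambda>x. 0)"
  using zero_mem by (simp add: rep_def zero_L2.abs_eq)

lemma rep_add: "rep f \<Longrightarrow> rep g \<Longrightarrow> rep (\<lambda>x. f x + g x)"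
  using add_mem[of "abs_L2 f" "abs_L2 g"] by (simp add: rep_def abs_L2_add sq_integrable_add)

lemma rep_cmult: "rep f \<Longrightarrow> rep (\<lambda>x. c * f x)"
  using scaleC_mem[of "abs_L2 f" c] by (simp add: rep_def abs_L2_scaleC sq_integrable_cmult)

lemma rep_sum: "(\<And>i. i \<in> I \<Longrightarrow> rep (f i)) \<Longrightarrow> rep (\<lambda>x. \<Sum>i\<in>I. f i x)"
  by (induction I rule: infinite_finite_induct) (auto intro: rep_add rep_zero)

lemma rep_lim:
  assumes "sq_integrable G" "\<And>n. rep (s n)" "\<And>n x. cmod (s n x) \<le> cmod (G x)"
    and "\<And>x. (\<lambda>n. s n x) \<longlonglongrightarrow> f x"
  shows "rep f"
proof -
  have "s n \<in> borel_measurable borel" for n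
    using assms(2)[of n] by (simp add: rep_def sq_integrable_def)
  note * = tendsto_abs_L2[OF assms(1) this assms(3,4)]
  then show ?thesis
    using closed_sequentially[OF closed, of "\<lambda>n. abs_L2 (s n)" "abs_L2 f"] assms(2)
    by (auto simp: rep_def)
qed

text \<open>
  These functions form an algebra closed under bounded pointwise limits. It contains $e^{ikx}$,
  hence polynomials in $\sin((x-d)/n)$, hence as a limit the indicator of $x > d$, hence the
  indicators of all Borel sets.
\<close>
definition multiplier :: "(real \<Rightarrow> complex) \<Rightarrow> bool" where
  "multiplier m \<longleftrightarrow> m \<in> borel_measurable borel \<and> (\<exists>C. \<forall>x. cmod (m x) \<le> C) \<and>
     (\<forall>F. (\<forall>k. rep (\<lambda>x. iexp (k * x) * F x)) \<longrightarrow> (\<forall>k. rep (\<lambda>x. iexp (k * x) * (m x * F x))))"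

lemma multiplierD:
  assumes "multiplier m" "\<And>k. rep (\<lambda>x. iexp (k * x) * F x)"
  shows "rep (\<lambda>x. iexp (k * x) * (m x * F x))"
  using assms by (simp add: multiplier_def)

text \<open>Multiplication by an exponential shifts the frequency, and the premise in
  \<open>multiplier\<close> covers all frequencies.\<close>

lemma multiplier_iexp: "multiplier (\<lambda>x. iexp (k * x))"
  unfolding multiplier_def
proof (intro conjI allI impI)
  show "(\<lambda>x. iexp (k * x)) \<in> borel_measurable borel" by measurable
  show "\<exists>C. \<forall>x. cmod (iexp (k * x)) \<le> C" by (intro exI[of _ 1]) simp
  fix F l assume "\<forall>k. rep (\<lambda>x. iexp (k * x) * F x)"
  then have "rep (\<lambda>x. iexp ((l + k) * x) * F x)" by blast
  then show "rep (\<lambda>x. iexp (l * x) * (iexp (k * x) * F x))"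
    by (simp add: algebra_simps flip: exp_add)
qed

lemma multiplier_const: "multiplier (\<lambda>x. c)"
  unfolding multiplier_def using rep_cmult[of "\<lambda>x. iexp (_ * x) * _ x" c]
  by (auto simp: mult.left_commute)

lemma multiplier_add: assumes "multiplier m" "multiplier m'" shows "multiplier (\<lambda>x. m x + m' x)"
  unfolding multiplier_def
proof (intro conjI allI impI)
  obtain C C' where "\<And>x. cmod (m x) \<le> C" "\<And>x. cmod (m' x) \<le> C'"
    using assms unfolding multiplier_def by blast
  then show "\<exists>C. \<forall>x. cmod (m x + m' x) \<le> C"
    by (intro exI[of _ "C + C'"] allI norm_triangle_le add_mono)
  show "(\<lambda>x. m x + m' x) \<in> borel_measurable borel"
    using assms unfolding multiplier_def by auto
  fix F k assume "\<forall>k. rep (\<lambda>x. iexp (k * x) * F x)"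
  then have "rep (\<lambda>x. iexp (k * x) * (m x * F x))" "rep (\<lambda>x. iexp (k * x) * (m' x * F x))"
    using assms unfolding multiplier_def by blast+
  from rep_add[OF this] show "rep (\<lambda>x. iexp (k * x) * ((m x + m' x) * F x))"
    by (simp add: algebra_simps)
qed

text \<open>Premise and conclusion of \<open>multiplier\<close> have the same shape, so the
  conclusion for one factor is the premise for the other.\<close>

lemma multiplier_mult: assumes "multiplier m" "multiplier m'" shows "multiplier (\<lambda>x. m x * m' x)"
  unfolding multiplier_def
proof (intro conjI allI impI)
  obtain C C' where C: "\<And>x. cmod (m x) \<le> C" "\<And>x. cmod (m' x) \<le> C'"
    using assms unfolding multiplier_def by blast
  have "cmod (m x * m' x) \<le> C * C'" for x
    unfolding norm_mult using C order_trans[OF norm_ge_zero C(1)] by (intro mult_mono) auto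
  then show "\<exists>C. \<forall>x. cmod (m x * m' x) \<le> C" by blast
  show "(\<lambda>x. m x * m' x) \<in> borel_measurable borel"
    using assms unfolding multiplier_def by auto
  fix F k assume "\<forall>k. rep (\<lambda>x. iexp (k * x) * F x)"
  then have "rep (\<lambda>x. iexp (k * x) * (m x * (m' x * F x)))"
    by (intro multiplierD[OF assms(1)] multiplierD[OF assms(2)]) blast
  then show "rep (\<lambda>x. iexp (k * x) * (m x * m' x * F x))"
    by (simp add: mult.assoc)
qed

lemma multiplier_lim:
  assumes m: "\<And>n. multiplier (s n)" and C: "\<And>n x. cmod (s n x) \<le> C"
    and lim: "\<And>x. (\<lambda>n. s n x) \<longlonglongrightarrow> f x"
  shows "multiplier f"
  unfolding multiplier_def
proof (intro conjI allI impI)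
  show "f \<in> borel_measurable borel"
    by (rule borel_measurable_LIMSEQ_metric[OF _ lim]) (use m in \<open>auto simp: multiplier_def\<close>)
  have "cmod (f x) \<le> C" for x
    by (rule LIMSEQ_le_const2[OF tendsto_norm[OF lim]]) (use C in blast)
  then show "\<exists>C. \<forall>x. cmod (f x) \<le> C" by blast
  fix F k assume F: "\<forall>k. rep (\<lambda>x. iexp (k * x) * F x)"
  show "rep (\<lambda>x. iexp (k * x) * (f x * F x))"
  proof (rule rep_lim[where G = "\<lambda>x. of_real C * (iexp (k * x) * F x)" and s = "\<lambda>n x. iexp (k * x) * (s n x * F x)"])
    show "sq_integrable (\<lambda>x. of_real C * (iexp (k * x) * F x))"
      using F by (intro sq_integrable_cmult) (auto simp: rep_def)
    show "rep (\<lambda>x. iexp (k * x) * (s n x * F x))" for n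
      using m[of n] F unfolding multiplier_def by blast
    have "C \<ge> 0" using order_trans[OF norm_ge_zero C] .
    then show "cmod (iexp (k * x) * (s n x * F x)) \<le> cmod (of_real C * (iexp (k * x) * F x))" for n x
      using C[of n x] by (simp add: norm_mult mult_right_mono)
    show "(\<lambda>n. iexp (k * x) * (s n x * F x)) \<longlonglongrightarrow> iexp (k * x) * (f x * F x)" for x
      by (intro tendsto_intros lim)
  qed
qed

lemma multiplier_poly_sin:
  assumes "real_polynomial_function p"
  shows "multiplier (\<lambda>x. of_real (p (sin (c * (x - d)))))"
  using assms
proof (induction p rule: real_polynomial_function.induct)
  case (linear f)
  have "f y = f 1 * y" for y
    using linear_scale[OF bounded_linear.linear[OF linear], of y 1] by (simp add: mult.commute)
  moreover have "complex_of_real (sin y) = - (\<i> / 2) * (iexp y + (- 1) * iexp (- y))" for y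
    by (simp add: complex_eq_iff Re_exp Im_exp)
  moreover have "iexp (c * (x - d)) = iexp (- (c * d)) * iexp (c * x)"
    "iexp (- (c * (x - d))) = iexp (c * d) * iexp ((- c) * x)" for x
    by (simp_all add: algebra_simps flip: exp_add)
  ultimately have "of_real (f (sin (c * (x - d))))
    = of_real (f 1) * (- (\<i> / 2) * (iexp (- (c * d)) * iexp (c * x) + (- 1) * (iexp (c * d) * iexp ((- c) * x))))" for x
    by (metis of_real_mult)
  then show ?case
    by (simp only:) (intro multiplier_mult multiplier_add multiplier_const multiplier_iexp)
next
  case (const c)
  show ?case by (rule multiplier_const)
next
  case (add f g)
  then show ?case unfolding of_real_add by (intro multiplier_add)
next
  case (mult f g)
  then show ?case unfolding of_real_mult by (intro multiplier_mult)
qed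

lemma multiplier_halfline: "multiplier (\<lambda>x. indicator {d<..} x)"
proof -
  \<comment> \<open>For x \<noteq> d and large n, the sine of (x - d)/(n + 1) has the sign of x - d
    and size of order 1/(n + 1). The factor (n + 1)^2 drives it to infinity, and clipping to [0, 1]
    yields the indicator; at x = d the value is 0. The polynomials approximate the clipping on
    [-1, 1], the range of the sine.\<close>
  define clip where "clip = (\<lambda>n s::real. max 0 (min 1 ((real n + 1)\<^sup>2 * s)))"
  have "\<exists>p. real_polynomial_function p \<and> (\<forall>s\<in>{-1..1}. \<bar>clip n s - p s\<bar> < 1 / (real n + 1))" for n
  proof -
    have "continuous_on {-1..1} (clip n)" unfolding clip_def by (intro continuous_intros)
    from Stone_Weierstrass_real_polynomial_function[OF compact_Icc this, of "1 / (real n + 1)"]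
    show ?thesis by (metis add_nonneg_pos divide_pos_pos of_nat_0_le_iff zero_less_one)
  qed
  then obtain p where p: "\<And>n. real_polynomial_function (p n)"
    "\<And>n s. s \<in> {-1..1} \<Longrightarrow> \<bar>clip n s - p n s\<bar> < 1 / (real n + 1)"
    by metis
  let ?s = "\<lambda>n x. sin (1 / (real n + 1) * (x - d))"
  show ?thesis
  \<comment> \<open>The bound 2 is 1 for the clipped value plus an approximation error below
    1.\<close>
  proof (rule multiplier_lim[where s = "\<lambda>n x. of_real (p n (?s n x))" and C = 2])
    show "multiplier (\<lambda>x. of_real (p n (?s n x)))" for n
      by (rule multiplier_poly_sin[OF p(1)])
    fix x
    have close: "\<bar>clip n (?s n x) - p n (?s n x)\<bar> < 1 / (real n + 1)" for n
      by (rule p(2)) auto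
    have "0 \<le> clip n (?s n x)" "clip n (?s n x) \<le> 1" "1 / (real n + 1) \<le> 1" for n
      by (auto simp: clip_def)
    then show "cmod (of_real (p n (?s n x))) \<le> 2" for n
      using close[of n] unfolding norm_of_real by (smt (verit))
    have "eventually (\<lambda>n. clip n (?s n x) = indicator {d<..} x) sequentially"
    proof -
      consider "x > d" | "x = d" | "x < d" by linarith
      then show ?thesis
      proof cases
        case 1
        define y where "y = x - d"
        have "y > 0" using 1 by (simp add: y_def)
        then have "filterlim (\<lambda>n. (real n + 1)\<^sup>2 * sin (1 / (real n + 1) * y)) at_top at_top"
          by real_asymp
        then have "eventually (\<lambda>n. (real n + 1)\<^sup>2 * ?s n x \<ge> 1) sequentially"
          unfolding y_def filterlim_at_top by blast
        then show ?thesis by eventually_elim (use 1 in \<open>simp add: clip_def\<close>)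
      next
        case 2
        then show ?thesis by (simp add: clip_def)
      next
        case 3
        define y where "y = d - x"
        have "y > 0" using 3 by (simp add: y_def)
        then have "filterlim (\<lambda>n. (real n + 1)\<^sup>2 * sin (1 / (real n + 1) * y)) at_top at_top"
          by real_asymp
        then have "eventually (\<lambda>n. (real n + 1)\<^sup>2 * sin (1 / (real n + 1) * y) \<ge> 0) sequentially"
          unfolding filterlim_at_top by blast
        then show ?thesis
        proof eventually_elim
          case (elim n)
          have "sin (1 / (real n + 1) * y) = - ?s n x"
            unfolding y_def sin_minus[symmetric] by (simp add: algebra_simps diff_divide_distrib)
          then have "(real n + 1)\<^sup>2 * ?s n x \<le> 0" using elim by simp
          then show ?case using 3 by (simp add: clip_def)
        qed
      qed
    qed
    then have 1: "(\<lambda>n. clip n (?s n x)) \<longlonglongrightarrow> indicator {d<..} x"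
      by (rule tendsto_eventually)
    have 2: "(\<lambda>n. clip n (?s n x) - p n (?s n x)) \<longlonglongrightarrow> 0"
    proof (rule Lim_null_comparison)
      show "eventually (\<lambda>n. norm (clip n (?s n x) - p n (?s n x)) \<le> 1 / (real n + 1)) sequentially"
        using close by (auto intro!: always_eventually less_imp_le)
      show "(\<lambda>n. 1 / (real n + 1)) \<longlonglongrightarrow> 0" by real_asymp
    qed
    have "(\<lambda>n. p n (?s n x)) \<longlonglongrightarrow> indicator {d<..} x"
      using tendsto_diff[OF 1 2] by simp
    then have "(\<lambda>n. complex_of_real (p n (?s n x))) \<longlonglongrightarrow> of_real (indicator {d<..} x)"
      by (rule tendsto_of_real)
    then show "(\<lambda>n. complex_of_real (p n (?s n x))) \<longlonglongrightarrow> indicator {d<..} x"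
      by (simp only: of_real_indicator)
  qed
qed

text \<open>Induction on the generation from open half-lines: complements give 1 minus an indicator,
  and a countable union is the bounded limit of finite ones, whose indicators are 1 - prod (1 - 1_{a
  i}).\<close>

lemma multiplier_borel:
  assumes "A \<in> sets borel"
  shows "multiplier (\<lambda>x. indicator A x)"
proof -
  have "{x. eucl_less d x} = {d<..}" for d :: real by (auto simp: eucl_less_def)
  then have "A \<in> sigma_sets UNIV (range (\<lambda>d::real. {d<..}))"
    using assms unfolding borel_eq_greaterThan by simp
  then show ?thesis
  proof induction
    case (Basic a)
    then show ?case using multiplier_halfline by auto
  next
    case Empty
    then show ?case using multiplier_const[of 0] by simp
  next
    case (Compl a)
    have "indicator (UNIV - a) x = 1 + (- 1) * (indicator a x :: complex)" for x
      by (simp add: indicator_def)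
    then show ?case
      by (simp only:) (intro multiplier_add multiplier_mult multiplier_const Compl.IH)
  next
    case (Union a)
    have prod: "multiplier (\<lambda>x. \<Prod>i<n. 1 + (- 1) * indicator (a i) x)" for n :: nat
    proof (induction n)
      case (Suc n)
      then show ?case
        unfolding prod.lessThan_Suc by (intro multiplier_add multiplier_mult multiplier_const Union.IH)
    qed (simp add: multiplier_const)
    have val: "1 + (- 1) * (\<Prod>i<n. 1 + (- 1) * indicator (a i) x) = (if \<exists>i<n. x \<in> a i then 1 else (0::complex))" for n x
    proof (induction n)
      case (Suc n)
      then show ?case by (auto simp: less_Suc_eq indicator_def split: if_splits)
    qed simp
    show ?case
    proof (rule multiplier_lim[where s = "\<lambda>n x. 1 + (- 1) * (\<Prod>i<n. 1 + (- 1) * indicator (a i) x)" and C = 1])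
      show "multiplier (\<lambda>x. 1 + (- 1) * (\<Prod>i<n. 1 + (- 1) * indicator (a i) x))" for n
        by (intro multiplier_add multiplier_mult multiplier_const prod)
      show "cmod (1 + (- 1) * (\<Prod>i<n. 1 + (- 1) * indicator (a i) x)) \<le> 1" for n x
        unfolding val by simp
      show "(\<lambda>n. 1 + (- 1) * (\<Prod>i<n. 1 + (- 1) * indicator (a i) x)) \<longlonglongrightarrow> (indicator (\<Union> (range a)) x :: complex)" for x
      proof (cases "x \<in> \<Union> (range a)")
        case True
        then obtain j where j: "x \<in> a j" by auto
        have "eventually (\<lambda>n. (if \<exists>i<n. x \<in> a i then 1 else (0::complex)) = indicator (\<Union> (range a)) x) sequentially"
          using eventually_gt_at_top[of j] by eventually_elim (use j in \<open>auto simp: indicator_def\<close>)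
        then show ?thesis unfolding val by (rule tendsto_eventually)
      next
        case False
        then show ?thesis unfolding val by (auto intro!: tendsto_eventually)
      qed
    qed
  qed
qed

text \<open>The Gaussian has no zeros, so every f is some g times it. The function g is reached from
  indicators by sums and monotone limits, then by splitting into real and imaginary, positive and
  negative parts.\<close>

lemma eq_UNIV_if_gauss:
  assumes \<mu>: "Re \<mu> > 0" and E: "\<And>k. rep (\<lambda>x. iexp (k * x) * gauss_exp \<mu> 0 x)"
  shows "V = UNIV"
proof -
  let ?E = "gauss_exp \<mu> 0"
  have rep_ind: "rep (\<lambda>x. indicator A x * ?E x)" if "A \<in> sets borel" for A
  proof -
    have "rep (\<lambda>x. iexp (0 * x) * (indicator A x * ?E x))"
      using multiplier_borel[OF that] E unfolding multiplier_def by blast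
    then show ?thesis by simp
  qed
  have sq_mono: "sq_integrable (\<lambda>x. of_real (u x) * ?E x)"
    if "sq_integrable (\<lambda>x. of_real (w x) * ?E x)" "u \<in> borel_measurable borel" "\<And>x. \<bar>u x\<bar> \<le> \<bar>w x\<bar>"
    for u w :: "real \<Rightarrow> real"
    by (rule sq_integrable_bound[OF that(1)])
      (use that(2,3) in \<open>auto simp: norm_mult intro!: mult_right_mono\<close>)
  \<comment> \<open>Square integrability stays a premise inside the induction because u may be
    unbounded; domination hands it down to summands and approximants.\<close>
  have nn: "sq_integrable (\<lambda>x. of_real (u x) * ?E x) \<longrightarrow> rep (\<lambda>x. of_real (u x) * ?E x)"
    if "u \<in> borel_measurable borel" "\<And>x. u x \<ge> 0" for u :: "real \<Rightarrow> real"
    using that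
  proof (induction u rule: borel_measurable_induct_real)
    case (set A)
    then show ?case using rep_ind[of A] by (simp add: of_real_indicator)
  next
    case (mult u c)
    show ?case
    proof
      assume s: "sq_integrable (\<lambda>x. of_real (c * u x) * ?E x)"
      show "rep (\<lambda>x. of_real (c * u x) * ?E x)"
      proof (cases "c = 0")
        case True then show ?thesis using rep_zero by simp
      next
        case False
        then have "sq_integrable (\<lambda>x. of_real (u x) * ?E x)"
          using sq_integrable_cmult[OF s, of "1 / of_real c"] by (simp add: mult.assoc)
        with mult have "rep (\<lambda>x. of_real (u x) * ?E x)" by blast
        from rep_cmult[OF this, of "of_real c"] show ?thesis by (simp add: mult.assoc)
      qed
    qed
  next
    case (add u v)
    show ?case
    proof
      assume s: "sq_integrable (\<lambda>x. of_real (v x + u x) * ?E x)"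
      have "sq_integrable (\<lambda>x. of_real (u x) * ?E x)" "sq_integrable (\<lambda>x. of_real (v x) * ?E x)"
        using add by (auto intro!: sq_mono[OF s])
      then show "rep (\<lambda>x. of_real (v x + u x) * ?E x)"
        using rep_add[of "\<lambda>x. of_real (v x) * ?E x" "\<lambda>x. of_real (u x) * ?E x"] add
        by (simp add: distrib_right)
    qed
  next
    case (seq U)
    show ?case
    proof
      assume s: "sq_integrable (\<lambda>x. of_real (u x) * ?E x)"
      have lim: "(\<lambda>i. U i x) \<longlonglongrightarrow> u x" for x using seq by simp
      have "mono (\<lambda>i. U i x)" for x
        using \<open>incseq U\<close> by (auto simp: mono_def le_fun_def)
      then have le: "U i x \<le> u x" for i x
        using incseq_le lim by blast
      have n: "cmod (of_real (U i x) * ?E x) \<le> cmod (of_real (u x) * ?E x)" for i x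
        using le[of i x] seq(2)[of i x] by (auto simp: norm_mult intro!: mult_right_mono)
      have "sq_integrable (\<lambda>x. of_real (U i x) * ?E x)" for i
        by (rule sq_mono[OF s]) (use seq(1,2)[of i] le[of i] in \<open>auto intro: order_trans[OF _ abs_ge_self]\<close>)
      then have r: "rep (\<lambda>x. of_real (U i x) * ?E x)" for i using seq by blast
      have l: "(\<lambda>i. of_real (U i x) * ?E x) \<longlonglongrightarrow> of_real (u x) * ?E x" for x
        by (intro tendsto_intros lim)
      show "rep (\<lambda>x. of_real (u x) * ?E x)"
        by (rule rep_lim[where s = "\<lambda>i x. of_real (U i x) * ?E x", OF s r n l])
    qed
  qed
  have real: "rep (\<lambda>x. of_real (u x) * ?E x)"
    if u: "u \<in> borel_measurable borel" and s: "sq_integrable (\<lambda>x. of_real (u x) * ?E x)" for u :: "real \<Rightarrow> real"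
  proof -
    have "rep (\<lambda>x. of_real (max 0 (u x)) * ?E x)" "rep (\<lambda>x. of_real (max 0 (- u x)) * ?E x)"
      using u by (auto intro!: nn[rule_format] sq_mono[OF s])
    from rep_add[OF this(1) rep_cmult[OF this(2), of "-1"]]
    have "rep (\<lambda>x. of_real (max 0 (u x)) * ?E x + - 1 * (of_real (max 0 (- u x)) * ?E x))" .
    moreover have "of_real (max 0 (u x)) * ?E x + - 1 * (of_real (max 0 (- u x)) * ?E x) = of_real (u x) * ?E x" for x
      by (simp add: max_def)
    ultimately show ?thesis by simp
  qed
  have "F \<in> V" for F
  proof (rule L2_cases[of F])
    fix f assume f: "sq_integrable f" "F = abs_L2 f"
    note [measurable] = sq_integrable_measurable[OF f(1)]
    define g where "g x = f x / ?E x" for x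
    have E0: "?E x \<noteq> 0" for x by (simp add: gauss_exp_def)
    have g: "f x = g x * ?E x" for x using E0 by (simp add: g_def)
    have gm [measurable]: "g \<in> borel_measurable borel" unfolding g_def by measurable
    have "rep (\<lambda>x. of_real (Re (g x)) * ?E x)" "rep (\<lambda>x. of_real (Im (g x)) * ?E x)"
      by (rule real, measurable, rule sq_integrable_bound[OF f(1)], measurable,
          simp add: g norm_mult mult_right_mono abs_Re_le_cmod abs_Im_le_cmod)+
    from rep_add[OF this(1) rep_cmult[OF this(2), of \<i>]]
    have "rep (\<lambda>x. of_real (Re (g x)) * ?E x + \<i> * (of_real (Im (g x)) * ?E x))" .
    also have "(\<lambda>x. of_real (Re (g x)) * ?E x + \<i> * (of_real (Im (g x)) * ?E x)) = f"
      unfolding g by (subst (3) complex_eq) (simp add: algebra_simps)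
    finally show ?thesis using f by (simp add: rep_def)
  qed
  then show ?thesis by blast
qed

text \<open>Partial sums of the exponential series times the Gaussian lie in V; the point is a
  common majorant for all of them.\<close>

lemma rep_iexp_gauss:
  assumes \<mu>: "Re \<mu> > 0" and E: "\<And>n. rep (\<lambda>x. of_real x ^ n * gauss_exp \<mu> 0 x)"
  shows "rep (\<lambda>x. iexp (k * x) * gauss_exp \<mu> 0 x)"
proof -
  let ?E = "gauss_exp \<mu> 0"
  define r where "r = Re \<mu>"
  have r: "r > 0" using \<mu> by (simp add: r_def)
  let ?s = "\<lambda>n x. (\<Sum>j<n. (\<i> * of_real (k * x)) ^ j /\<^sub>R fact j)"
  show ?thesis
  \<comment> \<open>The partial sums are at most e^{|k x|}, and |k x| \<le> k^2 / r + r x^2 / 4 uses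
    up only half of the Gaussian decay.\<close>
  proof (rule rep_lim[where G = "\<lambda>x. of_real (exp (k\<^sup>2 / r)) * gauss_exp (of_real (r / 2)) 0 x" and s = "\<lambda>n x. ?s n x * ?E x"])
    show "sq_integrable (\<lambda>x. of_real (exp (k\<^sup>2 / r)) * gauss_exp (of_real (r / 2)) 0 x)"
      using r by (intro sq_integrable_cmult sq_integrable_gauss_exp) simp
    have "rep (\<lambda>x. \<Sum>j<n. (\<i> * of_real k) ^ j / fact j * (of_real x ^ j * ?E x))" for n
      by (intro rep_sum rep_cmult E)
    moreover have "(\<Sum>j<n. (\<i> * of_real k) ^ j / fact j * (of_real x ^ j * ?E x)) = ?s n x * ?E x" for n x
      unfolding sum_distrib_right
      by (intro sum.cong) (simp_all add: scaleR_conv_of_real power_mult_distrib divide_inverse)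
    ultimately show "rep (\<lambda>x. ?s n x * ?E x)" for n by simp
    show "(\<lambda>n. ?s n x * ?E x) \<longlonglongrightarrow> iexp (k * x) * ?E x" for x
      using exp_converges[of "\<i> * of_real (k * x)"] unfolding sums_def by (intro tendsto_intros)
    fix n x
    have "cmod (?s n x) \<le> (\<Sum>j<n. \<bar>k * x\<bar> ^ j /\<^sub>R fact j)"
      by (rule order_trans[OF norm_sum]) (simp add: norm_power norm_mult abs_mult)
    also have "\<dots> \<le> exp \<bar>k * x\<bar>"
      using sum_le_suminf[OF summable_exp_generic[of "\<bar>k * x\<bar>"], of "{..<n}"] by (simp add: exp_def)
    finally have "cmod (?s n x * ?E x) \<le> exp \<bar>k * x\<bar> * exp (- (r * x\<^sup>2 / 2))"
      by (simp add: norm_mult norm_gauss_exp r_def)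
    also have "\<dots> \<le> exp (k\<^sup>2 / r - r * x\<^sup>2 / 4)"
    proof -
      have "k\<^sup>2 / r - r * x\<^sup>2 / 4 - (\<bar>k * x\<bar> - r * x\<^sup>2 / 2) = (2 * \<bar>k\<bar> - r * \<bar>x\<bar>)\<^sup>2 / (4 * r)"
        using r by (simp add: field_simps power2_eq_square abs_mult)
      moreover have "\<dots> \<ge> 0" using r by simp
      ultimately show ?thesis by (simp flip: exp_add)
    qed
    finally show "cmod (?s n x * ?E x) \<le> cmod (of_real (exp (k\<^sup>2 / r)) * gauss_exp (of_real (r / 2)) 0 x)"
      by (simp add: norm_mult norm_gauss_exp mult_exp_exp flip: exp_of_real)
  qed
qed

end

text \<open>The three-term recurrence, which serves both the density proof and the computation of
  the action of T.\<close>

lemma hermite_poly_Suc_Suc: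
  "hermite_poly (Suc (Suc n)) = [:0, 2:] * hermite_poly (Suc n) - smult (2 * (of_nat n + 1)) (hermite_poly n)"
  by (simp only: hermite_poly.simps(2)[of "Suc n"] pderiv_hermite_poly)

lemma poly_hermite_Suc_Suc:
  "poly (hermite_poly (Suc (Suc n))) z = 2 * z * poly (hermite_poly (Suc n)) z - 2 * (of_nat n + 1) * poly (hermite_poly n) z"
  unfolding hermite_poly_Suc_Suc by (simp add: algebra_simps)

context closed_complex_subspace
begin

text \<open>Solved for its middle term, the recurrence trades a factor x for a combination of the
  neighbours k - 1 and k + 1. Hence every monomial times the Gaussian lies in V.\<close>

lemma eq_UNIV_if_hermite:
  assumes m: "Re (m\<^sup>2) > 0"
    and v: "\<And>k. rep (\<lambda>x. poly (hermite_poly k) (m * of_real x) * gauss_exp (m\<^sup>2) 0 x)"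
  shows "V = UNIV"
proof -
  have m0: "m \<noteq> 0" using m by auto
  let ?v = "\<lambda>k x. poly (hermite_poly k) (m * of_real x) * gauss_exp (m\<^sup>2) 0 x"
  have "rep (\<lambda>x. of_real x ^ n * ?v k x)" for n k
  proof (induction n arbitrary: k)
    case 0
    then show ?case using v[of k] by simp
  next
    case (Suc n)
    show ?case
    proof (cases k)
      case 0
      \<comment> \<open>The index 0 has no lower neighbour, but the polynomial of index 1 is 2
        z.\<close>
      have "rep (\<lambda>x. 1 / (2 * m) * (of_real x ^ n * ?v 1 x))"
        by (intro rep_cmult Suc.IH)
      moreover have "(\<lambda>x. 1 / (2 * m) * (of_real x ^ n * ?v 1 x)) = (\<lambda>x. of_real x ^ Suc n * ?v 0 x)"
        using m0 by (simp add: fun_eq_iff)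
      ultimately show ?thesis unfolding 0 by simp
    next
      case (Suc l)
      have "rep (\<lambda>x. 1 / (2 * m) * (of_real x ^ n * ?v (Suc (Suc l)) x) + (of_nat l + 1) / m * (of_real x ^ n * ?v l x))"
        by (intro rep_add rep_cmult \<open>\<And>k. rep (\<lambda>x. of_real x ^ n * ?v k x)\<close>)
      moreover have "1 / (2 * m) * (of_real x ^ n * ?v (Suc (Suc l)) x) + (of_nat l + 1) / m * (of_real x ^ n * ?v l x)
          = of_real x ^ Suc n * ?v (Suc l) x" for x
        using m0 unfolding poly_hermite_Suc_Suc by (simp add: field_simps del: hermite_poly.simps)
      ultimately show ?thesis unfolding Suc by simp
    qed
  qed
  from this[of _ 0] have "rep (\<lambda>x. of_real x ^ n * gauss_exp (m\<^sup>2) 0 x)" for n by simp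
  from eq_UNIV_if_gauss[OF m rep_iexp_gauss[OF m this]] show ?thesis .
qed

end

section \<open>Complex spans and their closures\<close>

definition complex_span :: "(nat \<Rightarrow> L2) \<Rightarrow> L2 set" where
  "complex_span u = {\<Sum>k<n. c k \<cdot>\<^sub>C u k | n c. True}"

lemma sum_mem_complex_span: "(\<Sum>k<n. c k \<cdot>\<^sub>C u k) \<in> complex_span u"
  unfolding complex_span_def by blast

lemma scaleC_zero_left_L2: "0 \<cdot>\<^sub>C F = (0 :: L2)"
  using scaleR_L2_eq_scaleC[of 0 F] by simp

lemma closed_complex_subspace_closure_span: "closed_complex_subspace (closure (complex_span u))"
proof
  show "closed (closure (complex_span u))" by simp
  have "0 \<in> complex_span u"
    unfolding complex_span_def by (rule CollectI, rule exI[of _ 0]) simp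
  then show "0 \<in> closure (complex_span u)" using closure_subset by blast
  have add: "F + G \<in> complex_span u" if FG: "F \<in> complex_span u" "G \<in> complex_span u" for F G
  proof -
    obtain n c where F: "F = (\<Sum>k<n. c k \<cdot>\<^sub>C u k)"
      using FG(1) by (auto simp: complex_span_def)
    obtain n' c' where G: "G = (\<Sum>k<n'. c' k \<cdot>\<^sub>C u k)"
      using FG(2) by (auto simp: complex_span_def)
    \<comment> \<open>Padding with zero coefficients brings two finite sums to a common
      length.\<close>
    have extend: "(\<Sum>k<n. c k \<cdot>\<^sub>C u k) = (\<Sum>k<N. (if k < n then c k else 0) \<cdot>\<^sub>C u k)" if "n \<le> N" for n N c
      by (rule sum.mono_neutral_cong_left) (use that in \<open>auto simp: scaleC_zero_left_L2\<close>)
    have eq: "F + G = (\<Sum>k<n + n'. ((if k < n then c k else 0) + (if k < n' then c' k else 0)) \<cdot>\<^sub>C u k)"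
      unfolding F G extend[of n "n + n'" c, OF le_add1] extend[of n' "n + n'" c', OF le_add2]
      by (simp only: scaleC_add_left_L2 sum.distrib)
    show ?thesis unfolding eq by (rule sum_mem_complex_span)
  qed
  have scale: "z \<cdot>\<^sub>C F \<in> complex_span u" if "F \<in> complex_span u" for F z
  proof -
    obtain n c where F: "F = (\<Sum>k<n. c k \<cdot>\<^sub>C u k)"
      using \<open>F \<in> complex_span u\<close> by (auto simp: complex_span_def)
    have eq: "z \<cdot>\<^sub>C F = (\<Sum>k<n. (z * c k) \<cdot>\<^sub>C u k)"
      unfolding F linear_sum[OF bounded_linear.linear[OF bounded_linear_scaleC_L2]] scaleC_scaleC_L2 ..
    show ?thesis unfolding eq by (rule sum_mem_complex_span)
  qed
  show "F + G \<in> closure (complex_span u)"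
    if F: "F \<in> closure (complex_span u)" and G: "G \<in> closure (complex_span u)" for F G
  proof -
    obtain f where f: "\<And>n. f n \<in> complex_span u" "f \<longlonglongrightarrow> F"
      using F unfolding closure_sequential by blast
    obtain g where g: "\<And>n. g n \<in> complex_span u" "g \<longlonglongrightarrow> G"
      using G unfolding closure_sequential by blast
    have "(\<lambda>n. f n + g n) \<longlonglongrightarrow> F + G" "\<forall>n. f n + g n \<in> complex_span u"
      using f g add by (simp_all add: tendsto_add)
    then show ?thesis unfolding closure_sequential by (intro exI[of _ "\<lambda>n. f n + g n"]) simp
  qed
  show "z \<cdot>\<^sub>C F \<in> closure (complex_span u)" if F: "F \<in> closure (complex_span u)" for F z
  proof -
    obtain f where f: "\<And>n. f n \<in> complex_span u" "f \<longlonglongrightarrow> F"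
      using F unfolding closure_sequential by blast
    have "(\<lambda>n. z \<cdot>\<^sub>C f n) \<longlonglongrightarrow> z \<cdot>\<^sub>C F"
      by (rule bounded_linear.tendsto[OF bounded_linear_scaleC_L2 f(2)])
    then show ?thesis
      unfolding closure_sequential using scale f(1) by (intro exI[of _ "\<lambda>n. z \<cdot>\<^sub>C f n"]) simp
  qed
qed

section \<open>The Mehler kernel\<close>

text \<open>Both sides obey the same recurrence in k. For the left one it comes from the Hermite
  recurrence and integration by parts, and the relation between w, q and m makes the coefficients
  agree.\<close>

lemma integral_hermite_gauss_exp:
  assumes w: "Re w > 0" and q: "w * (1 - q\<^sup>2) = 2 * m\<^sup>2"
  shows "(LINT y|lborel. poly (hermite_poly k) (m * of_real y) * gauss_exp w (w * q * x) y)
    = q ^ k * poly (hermite_poly k) (m * x) * (LINT y|lborel. gauss_exp w (w * q * x) y)"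
proof -
  let ?\<beta> = "w * q * x"
  define I where "I p = (LINT y|lborel. poly p (of_real y) * gauss_exp w ?\<beta> y)" for p
  define P where "P k = pcompose (hermite_poly k) [:0, m:]" for k
  have w0: "w \<noteq> 0" using w by auto
  have I_diff: "I (p - r) = I p - I r" for p r
    unfolding I_def using integrable_poly_gauss_exp[OF w, of p ?\<beta>] integrable_poly_gauss_exp[OF w, of r ?\<beta>]
    by (simp add: left_diff_distrib)
  have I_smult: "I (smult c p) = c * I p" for c p
    unfolding I_def by (simp add: mult.assoc)
  have parts: "w * I ([:0, 1:] * p) = I (pderiv p) + ?\<beta> * I p" for p
    using integral_poly_gauss_exp_by_parts[OF w, of p ?\<beta>] by (simp add: I_def)
  have P0: "P 0 = 1" by (simp add: P_def pcompose_1)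
  have P1: "P (Suc 0) = smult (2 * m) ([:0, 1:] * 1)" by (simp add: P_def pcompose_pCons)
  have P2: "P (Suc (Suc n)) = smult (2 * m) ([:0, 1:] * P (Suc n)) - smult (2 * (of_nat n + 1)) (P n)" for n
  proof -
    have "pcompose [:0, 2:] [:0, m:] = smult (2 * m) [:0, 1:]" by (simp add: pcompose_pCons)
    then show ?thesis
      unfolding P_def hermite_poly_Suc_Suc pcompose_diff pcompose_mult pcompose_smult by simp
  qed
  have dP: "pderiv (P (Suc n)) = smult (2 * (of_nat n + 1) * m) (P n)" for n
    unfolding P_def pderiv_pcompose pderiv_hermite_poly
    by (simp add: pderiv_pCons pcompose_smult mult.commute)
  have "I (P k) = q ^ k * poly (P k) x * I 1"
  proof (induction k rule: induct_nat_012)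
    case 0
    then show ?case by (simp add: P0)
  next
    case 1
    have "I ([:0, 1:] * 1) = q * x * I 1"
      using parts[of 1] w0 by (simp add: pderiv_1 I_def)
    then show ?case unfolding One_nat_def P1 I_smult by simp
  next
    case (ge2 n)
    have "w * I (P (Suc (Suc n))) = 2 * m * (w * I ([:0, 1:] * P (Suc n))) - 2 * (of_nat n + 1) * w * I (P n)"
      unfolding P2 I_diff I_smult by (simp add: algebra_simps)
    also have "\<dots> = 2 * (of_nat n + 1) * (2 * m\<^sup>2 - w) * I (P n) + 2 * m * ?\<beta> * I (P (Suc n))"
      unfolding parts dP I_smult by (simp add: algebra_simps power2_eq_square)
    \<comment> \<open>The hypothesis on q makes this coefficient a multiple of w as well, so that w
      can be cancelled.\<close>
    also have "2 * m\<^sup>2 - w = - w * q\<^sup>2" using q by (simp add: algebra_simps)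
    finally have "I (P (Suc (Suc n))) = 2 * m * q * x * I (P (Suc n)) - 2 * (of_nat n + 1) * q\<^sup>2 * I (P n)"
    proof -
      assume *: "w * I (P (Suc (Suc n))) = 2 * (of_nat n + 1) * (- w * q\<^sup>2) * I (P n) + 2 * m * ?\<beta> * I (P (Suc n))"
      have "w * I (P (Suc (Suc n))) = w * (2 * m * q * x * I (P (Suc n)) - 2 * (of_nat n + 1) * q\<^sup>2 * I (P n))"
        unfolding * by (simp add: algebra_simps)
      then show ?thesis using w0 by (simp only: mult_cancel_left) simp
    qed
    then show ?case unfolding ge2 P2
      by (simp add: algebra_simps power2_eq_square)
  qed
  then show ?thesis
    by (simp add: I_def P_def poly_pcompose mult.commute)
qed

text \<open>Here a - b = \<mu> tanh t and a + b = \<mu> coth t. Their real parts are positive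
  multiples of cos (\<theta> + \<phi>) and cos (\<theta> - \<phi>), which are nonnegative by the
  definition of \<open>\<Omega>\<close>; the product of the same cosines gives the sign of
  A.\<close>

lemma mehler_parameters:
  fixes t \<mu> :: complex and \<theta> A :: real
  assumes \<theta>: "- pi / 2 < \<theta>" "\<theta> < pi / 2" and t: "t \<in> \<Omega> \<theta>"
    and A: "A = 1 / 2 * (cmod (sinh (2 * t)))\<^sup>2 * (cos (2 * \<theta>) + cos (2 * Arg (tanh t)))"
    and \<mu>: "\<mu> = exp (\<i> * of_real \<theta>)"
  defines "a \<equiv> \<mu> * cosh (2 * t) / sinh (2 * t)" and "b \<equiv> \<mu> / sinh (2 * t)"
  shows "sinh (2 * t) \<noteq> 0" "Re \<mu> > 0" "Re a > 0" "\<bar>Re b\<bar> \<le> Re a" "A \<ge> 0"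
    "(cmod (cosh (2 * t)))\<^sup>2 + (cmod (sinh (2 * t)))\<^sup>2 * cos (2 * \<theta>) = 1 + 2 * A"
proof -
  define s c where "s = sinh t" and "c = cosh t"
  \<comment> \<open>\<open>D\<close> is tanh t times |cosh t|^2, so it has the argument of tanh
    t.\<close>
  define D where "D = s * cnj c"
  define \<phi> where "\<phi> = Arg (tanh t)"
  have Ret: "Re t > 0" and arg: "\<bar>\<phi>\<bar> \<le> pi / 2 - \<bar>\<theta>\<bar>" using t by (auto simp: \<Omega>_def \<phi>_def)
  have S: "sinh (2 * t) = 2 * s * c" and C: "cosh (2 * t) = c\<^sup>2 + s\<^sup>2" and cs: "c\<^sup>2 - s\<^sup>2 = 1"
    by (simp_all add: s_def c_def sinh_double cosh_double cosh_square_eq)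
  \<comment> \<open>Re D = sinh (2 Re t) / 2. Positivity excludes zeros of sinh t and cosh t, and it
    gives cos \<phi> > 0.\<close>
  have ReD: "Re D > 0"
  proof -
    have "D = (exp t - exp (- t)) / 2 * ((exp (cnj t) + exp (- cnj t)) / 2)"
      by (simp add: D_def s_def c_def sinh_field_def cosh_field_def exp_cnj)
    also have "\<dots> = (exp (t + cnj t) - exp (- (t + cnj t)) + (exp (t - cnj t) - exp (cnj t - t))) / 4"
      by (simp add: field_simps exp_add exp_diff exp_minus)
    also have "t + cnj t = of_real (2 * Re t)" by (simp add: complex_eq_iff)
    finally have eq: "D = (exp (of_real (2 * Re t)) - exp (- of_real (2 * Re t)) + (exp (t - cnj t) - exp (cnj t - t))) / 4" .
    have "Re D = (exp (2 * Re t) - exp (- (2 * Re t))) / (4::real)"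
      unfolding eq by (simp add: Re_exp)
    moreover have "exp (- (2 * Re t)) < exp (2 * Re t)" using Ret by simp
    ultimately show ?thesis by (metis diff_gt_0_iff_gt divide_pos_pos zero_less_numeral)
  qed
  then have s0: "s \<noteq> 0" and c0: "c \<noteq> 0" and D0: "D \<noteq> 0" by (auto simp: D_def)
  show S0: "sinh (2 * t) \<noteq> 0" using s0 c0 by (simp add: S)
  have cc: "c * cnj c = of_real ((cmod c)\<^sup>2)" "s * cnj s = of_real ((cmod s)\<^sup>2)"
    by (rule complex_norm_square[symmetric])+
  have tanh: "tanh t = D / of_real ((cmod c)\<^sup>2)"
    using c0 unfolding tanh_def s_def[symmetric] c_def[symmetric] D_def cc(1)[symmetric] by simp
  have D: "D = of_real (cmod D) * cis \<phi>"
  proof -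
    have "tanh t = of_real (cmod (tanh t)) * cis \<phi>"
      unfolding \<phi>_def using rcis_cmod_Arg[of "tanh t"] by (simp add: rcis_def)
    moreover have "cmod (tanh t) = cmod D / (cmod c)\<^sup>2" unfolding tanh by (simp add: norm_divide norm_power)
    ultimately have "D / of_real ((cmod c)\<^sup>2) = of_real (cmod D / (cmod c)\<^sup>2) * cis \<phi>" unfolding tanh by simp
    then show ?thesis using c0 by (simp add: field_simps)
  qed
  have \<mu>cis: "\<mu> = cis \<theta>" by (simp add: \<mu> cis_conv_exp)
  have cos\<theta>: "cos \<theta> > 0" using cos_gt_zero_pi[of \<theta>] \<theta> by simp
  then show "Re \<mu> > 0" by (simp add: \<mu>cis)
  have cos1: "cos (\<theta> + \<phi>) \<ge> 0" and cos2: "cos (\<theta> - \<phi>) \<ge> 0"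
    using arg by (auto intro!: cos_ge_zero)
  have ReD': "Re D = cmod D * cos \<phi>" by (subst D) simp
  have cos\<phi>: "cos \<phi> > 0" using ReD D0 unfolding ReD' by (simp add: zero_less_mult_iff)
  have Re1: "Re (a - b) = cmod D * cos (\<theta> + \<phi>) / (cmod c)\<^sup>2"
  proof -
    have "a - b = \<mu> * (c\<^sup>2 + s\<^sup>2 - (c\<^sup>2 - s\<^sup>2)) / (2 * s * c)"
      unfolding a_def b_def S C cs by (simp add: ring_distribs add_divide_distrib diff_divide_distrib)
    also have "\<dots> = \<mu> * D / of_real ((cmod c)\<^sup>2)"
      using s0 c0 unfolding D_def cc(1)[symmetric] by (simp add: field_simps power2_eq_square)
    also have "\<mu> * D = of_real (cmod D) * cis (\<theta> + \<phi>)"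
      unfolding \<mu>cis by (subst D) (simp add: cis_mult mult.left_commute)
    finally show ?thesis by (simp only: Re_divide_of_real) simp
  qed
  have Re2: "Re (a + b) = cmod D * cos (\<theta> - \<phi>) / (cmod s)\<^sup>2"
  proof -
    have "a + b = \<mu> * (c\<^sup>2 + s\<^sup>2 + (c\<^sup>2 - s\<^sup>2)) / (2 * s * c)"
      unfolding a_def b_def S C cs by (simp add: ring_distribs add_divide_distrib diff_divide_distrib)
    also have "\<dots> = \<mu> * cnj D / of_real ((cmod s)\<^sup>2)"
      using s0 c0 unfolding D_def cc(2)[symmetric] by (simp add: field_simps power2_eq_square)
    also have "\<mu> * cnj D = of_real (cmod D) * cis (\<theta> - \<phi>)"
      unfolding \<mu>cis by (subst D) (simp add: cis_mult cis_cnj mult.left_commute)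
    finally show ?thesis by (simp only: Re_divide_of_real) simp
  qed
  have nonneg: "Re (a - b) \<ge> 0" "Re (a + b) \<ge> 0"
    unfolding Re1 Re2 using cos1 cos2 by simp_all
  then show "\<bar>Re b\<bar> \<le> Re a" by simp
  \<comment> \<open>On the boundary of \<open>\<Omega> \<theta>\<close> one of the cosines vanishes,
    but never both, as their sum is positive; hence Re a is strictly positive.\<close>
  have "cos (\<theta> + \<phi>) + cos (\<theta> - \<phi>) = 2 * cos \<theta> * cos \<phi>" by (simp add: cos_add cos_diff)
  then have "cos (\<theta> + \<phi>) > 0 \<or> cos (\<theta> - \<phi>) > 0" using cos\<theta> cos\<phi> by (smt (verit) mult_pos_pos)
  then have "Re (a - b) > 0 \<or> Re (a + b) > 0"
    unfolding Re1 Re2 using D0 s0 c0 by auto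
  then show "Re a > 0" using nonneg by auto
  have "cos (2 * \<theta>) + cos (2 * \<phi>) = 2 * (cos (\<theta> + \<phi>) * cos (\<theta> - \<phi>))"
  proof -
    have "(2 * \<theta> + 2 * \<phi>) / 2 = \<theta> + \<phi>" "(2 * \<theta> - 2 * \<phi>) / 2 = \<theta> - \<phi>" by simp_all
    then show ?thesis
      using cos_plus_cos[of "2 * \<theta>" "2 * \<phi>"] by (simp only: mult.assoc)
  qed
  then show "A \<ge> 0" using A cos1 cos2 by (simp add: \<phi>_def)
  have "D\<^sup>2 = of_real ((cmod D)\<^sup>2) * cis (2 * \<phi>)"
    by (subst D) (simp add: power_mult_distrib Complex.DeMoivre)
  then have "Re (D\<^sup>2) = (cmod D)\<^sup>2 * cos (2 * \<phi>)" by simp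
  moreover have "(cmod (sinh (2 * t)))\<^sup>2 = 4 * (cmod D)\<^sup>2"
    by (simp add: S D_def norm_mult power_mult_distrib)
  \<comment> \<open>Since c^2 - s^2 = 1, the squared modulus of c^2 + s^2 differs from 1 by the
    cross term 4 Re (D^2).\<close>
  moreover have "(cmod (cosh (2 * t)))\<^sup>2 = 1 + 4 * Re (D\<^sup>2)"
  proof -
    have "(cmod (c\<^sup>2 + s\<^sup>2))\<^sup>2 = (cmod (c\<^sup>2 - s\<^sup>2))\<^sup>2 + 4 * Re (s\<^sup>2 * cnj (c\<^sup>2))"
      unfolding cmod_power2 by (simp add: power2_eq_square algebra_simps)
    then show ?thesis unfolding cs C D_def by (simp only: power_mult_distrib complex_cnj_power) simp
  qed
  ultimately show "(cmod (cosh (2 * t)))\<^sup>2 + (cmod (sinh (2 * t)))\<^sup>2 * cos (2 * \<theta>) = 1 + 2 * A"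
    unfolding A \<phi>_def[symmetric] by (simp add: algebra_simps)
qed

text \<open>Multiplying the two Gaussians in y leads to \<open>integral_hermite_gauss_exp\<close>
  with w = a + m^2 and q = b / w. The relation for b^2 is its hypothesis, and it also turns e^{-a
  x^2 / 2} back into e^{-m^2 x^2 / 2}.\<close>

lemma gauss_op_hermite:
  assumes w: "Re (a + m\<^sup>2) > 0" and b: "b\<^sup>2 = (a + m\<^sup>2) * (a - m\<^sup>2)"
  shows "gauss_op a b c (\<lambda>y. poly (hermite_poly k) (m * of_real y) * gauss_exp (m\<^sup>2) 0 y) x
    = c * (LINT y|lborel. gauss_exp (a + m\<^sup>2) 0 y) * (b / (a + m\<^sup>2)) ^ k *
      (poly (hermite_poly k) (m * of_real x) * gauss_exp (m\<^sup>2) 0 x)"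
proof -
  define w where "w = a + m\<^sup>2"
  define q where "q = b / w"
  have "Re w > 0" using w by (simp add: w_def)
  then have w': "Re w > 0" "w \<noteq> 0" by auto
  have bw: "b\<^sup>2 = w * (w - 2 * m\<^sup>2)" using b by (simp add: w_def)
  have q: "w * (1 - q\<^sup>2) = 2 * m\<^sup>2"
  proof -
    have "q\<^sup>2 = (w - 2 * m\<^sup>2) / w"
      unfolding q_def power_divide bw using w'(2) by (simp add: power2_eq_square)
    then have "w * (1 - q\<^sup>2) = w - w * ((w - 2 * m\<^sup>2) / w)" by (simp only: right_diff_distrib mult_1_right)
    then show ?thesis using w'(2) by simp
  qed
  have wq: "w * q * of_real x = b * of_real x" using w'(2) by (simp add: q_def)
  have ker: "gauss_kernel a b c x y * (poly (hermite_poly k) (m * of_real y) * gauss_exp (m\<^sup>2) 0 y)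
    = c * gauss_exp a 0 x * (poly (hermite_poly k) (m * of_real y) * gauss_exp w (w * q * of_real x) y)" for y
  proof -
    have "gauss_exp w (w * q * of_real x) y = gauss_exp a (b * of_real x) y * gauss_exp (m\<^sup>2) 0 y"
      unfolding wq by (simp add: gauss_exp_mult w_def)
    then show ?thesis by (simp add: gauss_kernel_def mult_ac)
  qed
  have "gauss_op a b c (\<lambda>y. poly (hermite_poly k) (m * of_real y) * gauss_exp (m\<^sup>2) 0 y) x
    = c * gauss_exp a 0 x * (LINT y|lborel. poly (hermite_poly k) (m * of_real y) * gauss_exp w (w * q * of_real x) y)"
    unfolding gauss_op_def ker by (rule integral_mult_right_zero)
  also have "\<dots> = c * gauss_exp a 0 x * (q ^ k * poly (hermite_poly k) (m * of_real x) *
      ((LINT y|lborel. gauss_exp w 0 y) * exp ((w * q * of_real x)\<^sup>2 / (2 * w))))"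
    unfolding integral_hermite_gauss_exp[OF w'(1) q] by (subst gauss_integral_linear[OF w'(1)]) (rule refl)
  also have "\<dots> = c * (LINT y|lborel. gauss_exp w 0 y) * q ^ k * (poly (hermite_poly k) (m * of_real x) *
      (gauss_exp a 0 x * exp ((w * q * of_real x)\<^sup>2 / (2 * w))))"
    by (simp only: mult_ac)
  also have "gauss_exp a 0 x * exp ((w * q * of_real x)\<^sup>2 / (2 * w)) = gauss_exp (m\<^sup>2) 0 x"
  proof -
    have "- (a * (of_real x)\<^sup>2 / 2) + (b * of_real x)\<^sup>2 / (2 * w) = - (m\<^sup>2 * (of_real x)\<^sup>2 / 2)"
    proof -
      have "(b * of_real x)\<^sup>2 / (2 * w) = (w - 2 * m\<^sup>2) * (of_real x)\<^sup>2 / 2"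
        unfolding power_mult_distrib bw using w'(2) by simp
      then show ?thesis by (simp add: w_def field_simps)
    qed
    then show ?thesis unfolding gauss_exp_def wq by (simp flip: exp_add)
  qed
  finally show ?thesis by (simp only: w_def q_def)
qed

lemma rotated_std_hermite:
  "rotated \<theta> (std_hermite k) = (\<lambda>x. poly (hermite_poly k) (exp (\<i> * of_real \<theta> / 2) * of_real x) *
     gauss_exp ((exp (\<i> * of_real \<theta> / 2))\<^sup>2) 0 x)"
  by (simp add: rotated_def std_hermite_def gauss_exp_def power_mult_distrib fun_eq_iff)

text \<open>Used twice: as the relation for b^2 in \<open>gauss_op_hermite\<close>, and to evaluate
  P in \<open>gauss_norm_sq_mehler\<close>.\<close>

lemma mehler_sq_diff:
  fixes z \<mu> :: complex
  assumes "sinh z \<noteq> 0"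
  shows "(\<mu> * cosh z / sinh z)\<^sup>2 - (\<mu> / sinh z)\<^sup>2 = \<mu>\<^sup>2"
proof -
  have "(\<mu> * cosh z / sinh z)\<^sup>2 - (\<mu> / sinh z)\<^sup>2 = \<mu>\<^sup>2 * ((cosh z)\<^sup>2 - 1) / (sinh z)\<^sup>2"
    by (simp only: power_divide power_mult_distrib right_diff_distrib diff_divide_distrib mult_1_right)
  then show ?thesis using assms by (simp add: cosh_square_eq)
qed

text \<open>Scaling by 2 S^2 Re a, with S = |sinh 2t|, makes P, Q and \<omega> functions of A
  alone.\<close>

lemma gauss_norm_sq_mehler:
  fixes t \<mu> :: complex and A :: real
  assumes S0: "sinh (2 * t) \<noteq> 0" and \<mu>: "cmod \<mu> = 1" and A: "A \<ge> 0"
  defines "a \<equiv> \<mu> * cosh (2 * t) / sinh (2 * t)" and "b \<equiv> \<mu> / sinh (2 * t)"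
  assumes a: "Re a > 0" "\<bar>Re b\<bar> \<le> Re a" "Re (a + \<mu>) > 0"
    and X: "(cmod (cosh (2 * t)))\<^sup>2 + (cmod (sinh (2 * t)))\<^sup>2 * Re (\<mu>\<^sup>2) = 1 + 2 * A"
  shows "gauss_norm_sq a b (exp (- t) / (LINT y|lborel. gauss_exp (a + \<mu>) 0 y))
      (sqrt ((overlap_diag a b)\<^sup>2 - (overlap_off a b)\<^sup>2)) = 1 / (sqrt (1 + A) + sqrt A)"
proof -
  define S where "S = cmod (sinh (2 * t))"
  define \<alpha> where "\<alpha> = Re a"
  define P Q where "P = overlap_diag a b" and "Q = overlap_off a b"
  define \<omega> where "\<omega> = sqrt (P\<^sup>2 - Q\<^sup>2)"
  define Y where "Y = sqrt (1 + A) + sqrt A"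
  have S: "S > 0" using S0 by (simp add: S_def)
  have \<alpha>: "\<alpha> > 0" using a by (simp add: \<alpha>_def)
  have P: "P > 0" "\<bar>Q\<bar> \<le> P" using overlap_pos[OF a(1,2)] by (simp_all add: P_def Q_def)
  then have PQ: "Q\<^sup>2 \<le> P\<^sup>2" by (auto simp: abs_le_square_iff[symmetric])
  have Y: "Y > 0" using A by (simp add: Y_def add_pos_nonneg)
  let ?J = "LINT y|lborel. gauss_exp (a + \<mu>) 0 y"
  \<comment> \<open>As a + \<mu> = \<mu> e^{2t} / sinh 2t, the growth of e^t cancels the factor
    e^{-t} of the kernel constant, leaving 1 / (2 pi S) for its squared modulus.\<close>
  have w: "cmod (a + \<mu>) = (cmod (exp t))\<^sup>2 / S"
  proof -
    have "a + \<mu> = \<mu> * (cosh (2 * t) + sinh (2 * t)) / sinh (2 * t)"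
      using S0 by (simp add: a_def field_simps)
    also have "cosh (2 * t) + sinh (2 * t) = (exp t)\<^sup>2"
      by (simp add: cosh_plus_sinh exp_double)
    finally show ?thesis using \<mu> by (simp add: norm_divide norm_mult norm_power S_def)
  qed
  have c: "(cmod (exp (- t) / ?J))\<^sup>2 = 1 / (2 * pi * S)"
  proof -
    have "(cmod (exp (- t) / ?J))\<^sup>2 = (cmod (exp (- t)))\<^sup>2 / (2 * pi / cmod (a + \<mu>))"
      by (simp only: norm_divide power_divide norm_gauss_integral[OF a(3)])
    also have "\<dots> = (cmod (exp (- t)) * cmod (exp t))\<^sup>2 / (2 * pi * S)"
      unfolding w by (simp add: power_mult_distrib)
    also have "cmod (exp (- t)) * cmod (exp t) = 1"
      by (simp flip: norm_mult exp_add)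
    finally show ?thesis by simp
  qed
  have SP: "2 * S\<^sup>2 * \<alpha> * P = 1 + 2 * A"
  proof -
    have ab: "a\<^sup>2 - b\<^sup>2 = \<mu>\<^sup>2"
      unfolding a_def b_def by (rule mehler_sq_diff[OF S0])
    have "2 * \<alpha> * P = 2 * \<alpha>\<^sup>2 - Re (b\<^sup>2)"
      using \<alpha> by (simp add: P_def overlap_diag_def \<alpha>_def field_simps power2_eq_square)
    also have "\<dots> = (cmod a)\<^sup>2 + Re (a\<^sup>2 - b\<^sup>2)"
      unfolding cmod_power2 \<alpha>_def by (simp add: power2_eq_square)
    finally have "S\<^sup>2 * (2 * \<alpha> * P) = S\<^sup>2 * (cmod a)\<^sup>2 + S\<^sup>2 * Re (\<mu>\<^sup>2)"
      unfolding ab by (simp only: distrib_left)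
    then have "2 * S\<^sup>2 * \<alpha> * P = S\<^sup>2 * (cmod a)\<^sup>2 + S\<^sup>2 * Re (\<mu>\<^sup>2)"
      by (simp only: mult_ac)
    also have "S\<^sup>2 * (cmod a)\<^sup>2 = (cmod (cosh (2 * t)))\<^sup>2"
      using S \<mu> by (simp add: a_def norm_divide norm_mult power_divide S_def)
    finally show ?thesis using X by (simp add: S_def)
  qed
  have SQ: "2 * S\<^sup>2 * \<alpha> * Q = 1"
    using S \<alpha> \<mu> by (simp add: Q_def overlap_off_def \<alpha>_def b_def norm_divide power_divide S_def)
  \<comment> \<open>By (1 + 2A)^2 - 1 = 4 A (1 + A).\<close>
  have S\<omega>: "2 * S\<^sup>2 * \<alpha> * \<omega> = 2 * (sqrt (1 + A) * sqrt A)"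
  proof (rule power2_eq_imp_eq)
    have "(2 * S\<^sup>2 * \<alpha> * \<omega>)\<^sup>2 = (2 * S\<^sup>2 * \<alpha> * P)\<^sup>2 - (2 * S\<^sup>2 * \<alpha> * Q)\<^sup>2"
      using PQ by (simp add: \<omega>_def power_mult_distrib right_diff_distrib)
    also have "\<dots> = (2 * (sqrt (1 + A) * sqrt A))\<^sup>2"
      unfolding SP SQ using A by (simp add: power_mult_distrib) (simp add: power2_eq_square algebra_simps)
    finally show "(2 * S\<^sup>2 * \<alpha> * \<omega>)\<^sup>2 = (2 * (sqrt (1 + A) * sqrt A))\<^sup>2" .
    show "2 * S\<^sup>2 * \<alpha> * \<omega> \<ge> 0" using \<alpha> PQ by (simp add: \<omega>_def)
    show "2 * (sqrt (1 + A) * sqrt A) \<ge> 0" using A by simp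
  qed
  have Y2: "Y\<^sup>2 = 2 * S\<^sup>2 * \<alpha> * (P + \<omega>)"
    unfolding distrib_left SP S\<omega> Y_def power2_sum using A by simp
  have "1 / (2 * pi * S) * sqrt (pi / \<alpha>) * sqrt (2 * pi / (P + \<omega>)) = 1 / Y"
  proof (rule power2_eq_imp_eq)
    define R where "R = P + \<omega>"
    have "\<omega> \<ge> 0" using PQ by (simp add: \<omega>_def)
    then have R: "R > 0" using P by (simp add: R_def)
    have "(1 / (2 * pi * S) * sqrt (pi / \<alpha>) * sqrt (2 * pi / R))\<^sup>2 = 1 / (2 * pi * S)\<^sup>2 * (pi / \<alpha>) * (2 * pi / R)"
      using \<alpha> R by (simp add: power_mult_distrib power_divide)
    also have "\<dots> = 1 / (2 * S\<^sup>2 * \<alpha> * R)"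
      using \<alpha> S R by (simp add: field_simps power2_eq_square)
    finally show "(1 / (2 * pi * S) * sqrt (pi / \<alpha>) * sqrt (2 * pi / (P + \<omega>)))\<^sup>2 = (1 / Y)\<^sup>2"
      unfolding power_divide Y2 R_def by simp
    show "0 \<le> 1 / (2 * pi * S) * sqrt (pi / \<alpha>) * sqrt (2 * pi / (P + \<omega>))"
      using S \<alpha> R by (simp add: R_def)
    show "0 \<le> 1 / Y" using Y by simp
  qed
  then show ?thesis
    unfolding gauss_norm_sq_def c P_def[symmetric] Q_def[symmetric] \<omega>_def[symmetric] \<alpha>_def[symmetric] Y_def .
qed

text \<open>The graph of a continuous map is closed, which gives one inclusion; continuity along
  sequences from the dense set gives the other.\<close>

lemma closure_graph_on:
  fixes T :: "'a :: real_normed_vector \<Rightarrow> 'b :: real_normed_vector"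
  assumes T: "bounded_linear T" and S: "closure S = UNIV"
  shows "closure ((\<lambda>f. (f, T f)) ` S) = {(f, g). g = T f}"
proof (rule antisym)
  have "continuous_on UNIV (\<lambda>p :: 'a \<times> 'b. T (fst p))"
    by (rule bounded_linear.continuous_on[OF T continuous_on_fst[OF continuous_on_id]])
  then have "closed {p. snd p = T (fst p)}"
    by (rule closed_Collect_eq[OF continuous_on_snd[OF continuous_on_id]])
  then show "closure ((\<lambda>f. (f, T f)) ` S) \<subseteq> {(f, g). g = T f}"
    unfolding case_prod_unfold by (rule closure_minimal[rotated]) auto
  show "{(f, g). g = T f} \<subseteq> closure ((\<lambda>f. (f, T f)) ` S)"
  proof clarify
    fix f
    have "f \<in> closure S" using S by simp
    then obtain s where s: "\<And>n. s n \<in> S" "s \<longlonglongrightarrow> f" unfolding closure_sequential by blast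
    have "(\<lambda>n. (s n, T (s n))) \<longlonglongrightarrow> (f, T f)"
      by (rule tendsto_Pair[OF s(2) bounded_linear.tendsto[OF T s(2)]])
    then show "(f, T f) \<in> closure ((\<lambda>f. (f, T f)) ` S)"
      unfolding closure_sequential using s(1) by (intro exI[of _ "\<lambda>n. (s n, T (s n))"]) simp
  qed
qed

theorem theorem1p1:
  fixes \<theta> \<phi> A :: real and t :: complex and h :: "nat \<Rightarrow> complex \<Rightarrow> complex"
  assumes "\<theta> \<in> {- pi / 2 <..< pi / 2}"
    and "t \<in> \<Omega> \<theta>"
    and "\<phi> = Arg (tanh t)"
    and "A = 1 / 2 * (cmod (sinh (2 * t)))\<^sup>2 * (cos (2 * \<theta>) + cos (2 * \<phi>))"
    and "\<And>k. hermite_function k (h k)"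
  shows "\<exists>T. bounded_operator T
    \<and> exp_Q h \<theta> t = {(f, g). g = T f}
    \<and> onorm T = (sqrt (1 + A) + sqrt A) powr (- 1 / 2)"
proof -
  define m where "m = exp (\<i> * of_real \<theta> / 2)"
  define \<mu> where "\<mu> = exp (\<i> * of_real \<theta>)"
  have m2: "m\<^sup>2 = \<mu>" by (simp add: m_def \<mu>_def power2_eq_square flip: exp_add)
  define a where "a = \<mu> * cosh (2 * t) / sinh (2 * t)"
  define b where "b = \<mu> / sinh (2 * t)"
  have \<theta>: "- pi / 2 < \<theta>" "\<theta> < pi / 2" using assms(1) by auto
  note par = mehler_parameters[OF \<theta> assms(2) assms(4)[unfolded assms(3)] \<mu>_def, folded a_def b_def]
  define w where "w = a + \<mu>"
  have w: "Re w > 0" using par(2,3) by (simp add: w_def)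
  define J where "J = (LINT y|lborel. gauss_exp w 0 y)"
  have J: "J \<noteq> 0" unfolding J_def by (rule gauss_integral_nonzero[OF w])
  \<comment> \<open>Chosen so that c J = e^{-t}, the prescribed eigenvalue for k = 0.\<close>
  define c where "c = exp (- t) / J"
  define T where "T = gauss_L2 a b c"
  have T: "bounded_operator T" unfolding T_def by (rule bounded_operator_gauss_L2[OF par(3,4)])
  then have Tlin: "bounded_linear T" and Tscale: "T (z \<cdot>\<^sub>C F) = z \<cdot>\<^sub>C T F" for z F
    by (auto simp: bounded_operator_def)
  have \<mu>2: "cmod \<mu> = 1" "Re (\<mu>\<^sup>2) = cos (2 * \<theta>)"
    by (simp_all add: \<mu>_def Re_exp power2_eq_square flip: exp_add)

  define v where "v k = rotated \<theta> (std_hermite k)" for k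
  have v_eq: "v k = (\<lambda>x. poly (hermite_poly k) (m * of_real x) * gauss_exp (m\<^sup>2) 0 x)" for k
    unfolding v_def m_def by (rule rotated_std_hermite)
  have v: "sq_integrable (v k)" for k
    unfolding v_def std_hermite_def[abs_def] by (rule sq_integrable_rotated[OF \<theta>])
  \<comment> \<open>These nonzero constants relate the given Hermite functions to the explicit ones;
    they change neither the eigenvalues nor the span.\<close>
  have "\<exists>d. d \<noteq> 0 \<and> h k = (\<lambda>z. d * std_hermite k z)" for k
    using hermite_function_unique[OF assms(5)[of k]] by metis
  then obtain d where d: "\<And>k. d k \<noteq> 0" "\<And>k. h k = (\<lambda>z. d k * std_hermite k z)" by metis
  define u where "u k = abs_L2 (rotated \<theta> (h k))" for k
  have u: "u k = d k \<cdot>\<^sub>C abs_L2 (v k)" for k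
    unfolding u_def d(2) by (simp add: abs_L2_scaleC v) (simp add: v_def rotated_def[abs_def])

  have bsq: "b\<^sup>2 = (a + m\<^sup>2) * (a - m\<^sup>2)"
  proof -
    have "a\<^sup>2 - b\<^sup>2 = \<mu>\<^sup>2" unfolding a_def b_def by (rule mehler_sq_diff[OF par(1)])
    moreover have "(a + \<mu>) * (a - \<mu>) = a\<^sup>2 - \<mu>\<^sup>2" by (simp add: algebra_simps power2_eq_square)
    ultimately show ?thesis unfolding m2 by (simp add: diff_eq_eq)
  qed
  \<comment> \<open>w = \<mu> e^{2t} / sinh 2t, and e^{-2t} is the ratio of consecutive prescribed
    eigenvalues.\<close>
  have bw: "b / w = exp (- 2 * t)"
  proof -
    have "w = \<mu> * (cosh (2 * t) + sinh (2 * t)) / sinh (2 * t)"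
      using par(1) by (simp add: w_def a_def field_simps)
    then show ?thesis
      using par(1) unfolding cosh_plus_sinh by (simp add: b_def \<mu>_def exp_minus field_simps)
  qed
  have Tu: "T (u k) = exp (- t * (1 + 2 * of_nat k)) \<cdot>\<^sub>C u k" for k
  proof -
    have "c * J * (b / w) ^ k = exp (- t * (1 + 2 * of_nat k))"
    proof -
      have "(exp (- 2 * t)) ^ k = exp (of_nat k * (- 2 * t))" by (rule exp_of_nat_mult[symmetric])
      then have "c * J * (b / w) ^ k = exp (- t) * exp (of_nat k * (- 2 * t))"
        unfolding bw using J by (simp add: c_def)
      also have "\<dots> = exp (- t * (1 + 2 * of_nat k))"
        unfolding exp_add[symmetric] by (rule arg_cong[of _ _ exp]) (simp add: algebra_simps)
      finally show ?thesis .
    qed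
    then have "gauss_op a b c (v k) = (\<lambda>x. exp (- t * (1 + 2 * of_nat k)) * v k x)"
      using gauss_op_hermite[of a m b c k] w bsq
      unfolding v_eq m2 w_def[symmetric] J_def[symmetric] by (simp add: fun_eq_iff)
    then have "T (abs_L2 (v k)) = exp (- t * (1 + 2 * of_nat k)) \<cdot>\<^sub>C abs_L2 (v k)"
      unfolding T_def by (simp add: gauss_L2_abs abs_L2_scaleC v)
    then show ?thesis unfolding u Tscale by (simp add: scaleC_scaleC_L2 mult.commute)
  qed

  have dense: "closure (complex_span u) = UNIV"
  proof -
    interpret closed_complex_subspace "closure (complex_span u)"
      by (rule closed_complex_subspace_closure_span)
    have "abs_L2 (v k) \<in> closure (complex_span u)" for k
    proof -
      have "u k = (\<Sum>j<Suc k. (if j = k then 1 else 0) \<cdot>\<^sub>C u j)"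
      proof -
        have "(\<Sum>j<Suc k. (if j = k then 1 else 0) \<cdot>\<^sub>C u j) = (\<Sum>j\<in>{k}. 1 \<cdot>\<^sub>C u j)"
          by (rule sum.mono_neutral_cong_right) (auto simp: scaleC_zero_left_L2)
        then show ?thesis using scaleR_L2_eq_scaleC[of 1 "u k"] by simp
      qed
      then have "u k \<in> complex_span u"
        using sum_mem_complex_span[of "\<lambda>j. if j = k then 1 else 0" u "Suc k"] by simp
      then have "(1 / d k) \<cdot>\<^sub>C u k \<in> closure (complex_span u)"
        using closure_subset by (intro scaleC_mem) blast
      then show ?thesis
        using d(1)[of k] scaleR_L2_eq_scaleC[of 1 "abs_L2 (v k)"] unfolding u by (simp add: scaleC_scaleC_L2)
    qed
    then have "rep (v k)" for k using v by (simp add: rep_def)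
    then show ?thesis
      using par(2) by (intro eq_UNIV_if_hermite[of m]) (simp_all add: m2 v_eq)
  qed
  \<comment> \<open>T acts on each \<open>u k\<close> as prescribed, so the operator to be closed is
    the restriction of T to the span.\<close>
  have "exp_Q_span h \<theta> t = (\<lambda>f. (f, T f)) ` complex_span u"
  proof -
    have "T (\<Sum>k<n. z k \<cdot>\<^sub>C u k) = (\<Sum>k<n. z k \<cdot>\<^sub>C exp (- t * (1 + 2 * of_nat k)) \<cdot>\<^sub>C u k)" for n z
      by (simp add: linear_sum[OF bounded_linear.linear[OF Tlin]] Tscale Tu)
    then have "exp_Q_span h \<theta> t = {(\<Sum>k<n. z k \<cdot>\<^sub>C u k, T (\<Sum>k<n. z k \<cdot>\<^sub>C u k)) | n z. True}"
      unfolding exp_Q_span_def u_def[symmetric] by simp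
    then show ?thesis unfolding complex_span_def by blast
  qed
  then have graph: "exp_Q h \<theta> t = {(f, g). g = T f}"
    unfolding exp_Q_def by (simp add: closure_graph_on[OF Tlin dense])
  have "gauss_norm_sq a b c (sqrt ((overlap_diag a b)\<^sup>2 - (overlap_off a b)\<^sup>2)) = 1 / (sqrt (1 + A) + sqrt A)"
    unfolding c_def J_def w_def
    by (rule gauss_norm_sq_mehler[OF par(1) \<mu>2(1) par(5), folded a_def b_def, OF par(3,4) w[unfolded w_def] par(6)[folded \<mu>2(2)]])
  then have "onorm T = sqrt (1 / (sqrt (1 + A) + sqrt A))"
    unfolding T_def onorm_gauss_L2[OF par(3,4)] by (simp only:)
  also have "\<dots> = (sqrt (1 + A) + sqrt A) powr (- 1 / 2)"
  proof -
    have "sqrt (1 + A) + sqrt A > 0" using par(5) by (simp add: add_pos_nonneg)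
    then show ?thesis by (simp add: powr_minus powr_half_sqrt real_sqrt_divide inverse_eq_divide)
  qed
  finally show ?thesis using T graph by blast
qed

end
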